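(* Put $c_{\rm BSG}:=\frac{21}{128}$, $C_{\rm BSG}:=\frac{2^{69}}9$, $C_{\rm BSG,H}:=\frac{2^{33}}9$. There is a randomized algorithm with the following properties. It receives deterministic membership access to a nonempty set $S\subseteq\mathbb F_2^n$, independent exact uniform samples from $S$, and parameters $\alpha,\rho_{\rm snd},\rho_{\rm cmp}\in(0,1)$. It always terminates and returns either $\mathsf{FAIL}$ or a finite record $D$. (Soundness) Every nonfailure record $D$ defines one deterministic set $Y_D\subseteq S$. For an arbitrary input set $S$, without any energy assumption, there is an event of probability at least $1-\rho_{\rm snd}$ on which every nonfailure output satisfies $|Y_D|\ge c_{\rm BSG}\sqrt\alpha|S|$ and $|Y_D+Y_D|\le C_{\rm BSG}\alpha^{-4}|Y_D|$; that is, $$\Pr\Big[D\ne\mathsf{FAIL}\ \text{and}\ \big(|Y_D|<c_{\rm BSG}\sqrt\alpha\,|S|\ \text{or}\ |Y_D+Y_D|>C_{\rm BSG}\alpha^{-4}|Y_D|\big)\Big]\le\rho_{\rm snd}.$$ If the output has a high-branch tag, then on the same event it satisfies the stronger estimate $|Y_D+Y_D|\le C_{\rm BSG,H}\alpha^{-3}|Y_D|$. (Completeness) If, in addition, $E(S)\ge\alpha|S|^3$, then $\Pr[D=\mathsf{FAIL}]\le\rho_{\rm cmp}$. (Persistence and resources) Once $D$ is fixed, membership in $Y_D$ is deterministic, and every later query refers to this same set. If $$\Lambda:=1+n+\log\frac1\alpha+\log\frac1{\rho_{\rm snd}}+\log\frac1{\rho_{\rm cmp}},$$ then producing the output uses $O(\alpha^{-2}\Lambda^4)$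 samples from $S$ and $O(\alpha^{-4}\Lambda^5)$ membership queries to $S$. One membership query to $Y_D$ uses $O(\alpha^{-4}\Lambda^3)$ membership queries to $S$, and the record length is $O(n\alpha^{-2}\Lambda)$ bits. All these bounds are worst-case over the random choices of the algorithm.
   Context: For $S,T\subseteq\mathbb F_2^n$, $S+T=\{s+t:s\in S,t\in T\}$; $\log$ is base two. The additive energy is $E(S)=|\{(x_1,x_2,x_3,x_4)\in S^4:x_1+x_2=x_3+x_4\}|$. Implied constants in $O(\cdot)$ are absolute. Membership access means a deterministic oracle $x\mapsto\mathbf 1_S(x)$. A record is a finite bit string storing all the data needed to evaluate, with further membership queries to $S$, a fixed deterministic predicate $x\mapsto\mathbf 1_{Y_D}(x)$. Each nonfailure record carries a tag, either high-branch or low-branch: a high-branch record stores a difference $d\in\mathbb F_2^n$ and its set $Y_D$ is obtained by cleaning the fibre $S\cap(S+d)$; a low-branch record stores a centre $a\in S$ and a set $Q$ of differences (implicitly, through sampled data), and its set $Y_D$ is obtained by cleaning the neighbourhood $\{x\in S:a+x\in Q\}$. *)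

theory Defs
  imports
    "HOL-Probability.Probability"
    "HOL-Library.Z2"
    "HOL-Library.Set_Algebras"
    "Jordan_Normal_Form.Matrix"
begin

type_synonym point = "bit Matrix.vec"

abbreviation F2 :: "nat \<Rightarrow> point set" where
  "F2 n \<equiv> carrier_vec n"

definition energy :: "point set \<Rightarrow> nat" where
  "energy S = card {(x1, x2, x3, x4).
     x1 \<in> S \<and> x2 \<in> S \<and> x3 \<in> S \<and> x4 \<in> S \<and> x1 + x2 = x3 + x4}"

definition c_BSG :: real where "c_BSG = 21 / 128"
definition C_BSG :: real where "C_BSG = 2 ^ 69 / 9"
definition C_BSG_H :: real where "C_BSG_H = 2 ^ 33 / 9"

definition Lam :: "nat \<Rightarrow> real \<Rightarrow> real \<Rightarrow> real \<Rightarrow> real" where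
  "Lam n \<alpha> \<rho>snd \<rho>cmp =
     1 + real n + log 2 (1 / \<alpha>) + log 2 (1 / \<rho>snd) + log 2 (1 / \<rho>cmp)"

text \<open>
  Deterministic computations with membership access to a set: the computation sees the set only
  through the answers to its membership questions. The number of questions asked along the
  branch determined by the set is the query cost.
\<close>

datatype 'r dtree =
    Answer 'r
  | Ask point "bool \<Rightarrow> 'r dtree"

primrec dval :: "point set \<Rightarrow> 'r dtree \<Rightarrow> 'r" where
  "dval S (Answer r) = r"
| "dval S (Ask x k) = dval S (k (x \<in> S))"

primrec dcost :: "point set \<Rightarrow> 'r dtree \<Rightarrow> nat" where
  "dcost S (Answer r) = 0"
| "dcost S (Ask x k) = Suc (dcost S (k (x \<in> S)))"

text \<open>
  Randomized algorithms with membership access to a set, access to samples from it, and internal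
  fair coins. Since the datatype is inductive, there is no infinite branch, so every run
  terminates.
\<close>

datatype 'r ralg =
    Return 'r
  | Query point "bool \<Rightarrow> 'r ralg"
  | Sample "point \<Rightarrow> 'r ralg"
  | Coin "bool \<Rightarrow> 'r ralg"

text \<open>
  The joint distribution of the output, the number of samples drawn and the number of membership
  queries made. Each sample is fresh, hence independent of everything before, and exactly
  uniform on \<open>S\<close> (for finite nonempty \<open>S\<close>).
\<close>

primrec run :: "point set \<Rightarrow> 'r ralg \<Rightarrow> ('r \<times> nat \<times> nat) pmf" where
  "run S (Return r) = return_pmf (r, 0, 0)"
| "run S (Query x k) = map_pmf (\<lambda>(r, s, q). (r, s, Suc q)) (run S (k (x \<in> S)))"
| "run S (Sample k) =
     bind_pmf (pmf_of_set S) (\<lambda>x. map_pmf (\<lambda>(r, s, q). (r, Suc s, q)) (run S (k x)))"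
| "run S (Coin k) = bind_pmf (bernoulli_pmf (1 / 2)) (\<lambda>b. run S (k b))"

definition result :: "point set \<Rightarrow> 'r ralg \<Rightarrow> 'r pmf" where
  "result S A = map_pmf fst (run S A)"

type_synonym bits = "bool list"

text \<open>
  What the tag of a record and its stored data amount to: a difference, or a centre together
  with a set of differences. That set is given implicitly, by a deterministic membership
  test that may itself query \<open>S\<close>.
\<close>

datatype branch =
    High point
  | Low point "point \<Rightarrow> bool dtree"

definition is_high :: "branch \<Rightarrow> bool" where
  "is_high b \<longleftrightarrow> (\<exists>d. b = High d)"

text \<open>The set in which a record is cleaned: the fibre, or the neighbourhood of the centre.\<close>

fun base_set :: "point set \<Rightarrow> branch \<Rightarrow> point set" where
  "base_set S (High d) = S \<inter> {s + d |s. s \<in> S}"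
| "base_set S (Low a Q) = {x \<in> S. dval S (Q (a + x))}"

fun valid_branch :: "nat \<Rightarrow> point set \<Rightarrow> branch \<Rightarrow> bool" where
  "valid_branch n S (High d) \<longleftrightarrow> d \<in> F2 n"
| "valid_branch n S (Low a Q) \<longleftrightarrow> a \<in> S"

text \<open>
  The set defined by a record \<open>D\<close> under an evaluator \<open>mem\<close>. The evaluator is given
  the record and the point only, so whatever else it needs (such as thresholds depending on the
  parameters) has to be stored in the record.
\<close>

definition Yset :: "(bits \<Rightarrow> point \<Rightarrow> bool dtree) \<Rightarrow> nat \<Rightarrow> point set \<Rightarrow> bits \<Rightarrow> point set" where
  "Yset mem n S D = {x \<in> F2 n. dval S (mem D x)}"

end

theory Submission
  imports Defs
begin

text \<open>
  Write \<open>r d\<close> for the number of \<open>s \<in> S\<close> with \<open>s + d \<in> S\<close>, so that the energy is the sum of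
  \<open>r (a + b)\<close> over \<open>a, b \<in> S\<close>. If a fixed part of the energy comes from differences with
  \<open>r d \<ge> sqrt \<alpha> * |S| / 2\<close>, then a random difference \<open>d = a + b\<close> is good with probability at least
  \<open>\<alpha> / 16\<close>: most pairs \<open>x, z\<close> of the fibre of \<open>d\<close> have \<open>r (x + z)\<close> of order \<open>\<alpha> * |S|\<close>. Otherwise a
  layer-cake argument (Reiher and Schoen) gives a level \<open>t\<close> between \<open>\<alpha> / 32\<close> and \<open>sqrt \<alpha> / 4\<close>
  for which the pairs \<open>a, b\<close> with \<open>r (a + b) \<ge> t * |S|\<close> have density \<open>\<delta> \<ge> sqrt \<alpha>\<close> with \<open>\<delta> * t\<^sup>2\<close> at least of order \<open>\<alpha>\<^sup>2\<close>, and a random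
  centre is good with probability at least \<open>\<delta> / 16\<close>. In both cases any two points of the cleaned set are
  joined by many paths of length two, and counting the representations that these paths give bounds
  the doubling.

  A trial of either kind is cheap enough to be repeated until it succeeds with high probability, so
  the algorithm tries every dyadic level. Soundness does not depend on the energy: whatever the
  seed, Chernoff bounds make the empirical tests agree with the true counts up to the factor \<open>8 / 3\<close>,
  and the size of the result is tested on fresh samples.
\<close>

section \<open>Tail bounds for independent samples\<close>

text \<open>The output must be one fixed set, so the samples behind its tests are stored in the
  record, and the tests must be reliable for all differences and all pairs of points at once. The
  union bound over up to \<open>4 ^ n\<close> events brings the dimension into the sample sizes. The
  fibre of \<open>d\<close> has \<open>r d\<close> points, so it is large enough only if
  \<open>d\<close> is popular on the scale of \<open>sqrt \<alpha>\<close>; energy on rarer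
  differences calls for neighbourhoods. Picking a level by pigeonhole would lose a logarithm. The
  density demanded at level \<open>t\<close>, the larger of \<open>sqrt \<alpha>\<close> and
  \<open>\<alpha> ^ 2 / (1024 * t ^ 2)\<close>, is such that failure at all levels leaves two
  geometric sums. Most constants carry the factor \<open>3 / 8\<close> by which a test may err:
  \<open>21 / 128 = 3 / 8 * 7 / 8 * 1 / 2\<close>, where a good base has density at least
  \<open>sqrt \<alpha> / 2\<close> and cleaning keeps \<open>7 / 8\<close> of it. The query exponent
  is a product: about \<open>1 / \<alpha>\<close> trials, each of about \<open>(w * m) ^ 2\<close>
  queries with \<open>w\<close> of order \<open>1 / sqrt \<alpha>\<close> and \<open>m\<close> of
  order \<open>1 / \<alpha>\<close>.\<close>

abbreviation Pr :: "'a pmf \<Rightarrow> 'a set \<Rightarrow> real" where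
  "Pr p \<equiv> measure_pmf.prob p"

text \<open>Lets a later stage be analysed given a good outcome of the earlier ones, on whose
  samples its tests depend.\<close>

lemma prob_bind_le:
  fixes p :: "'a pmf"
  assumes "\<And>x. x \<in> set_pmf p \<Longrightarrow> x \<notin> B \<Longrightarrow> Pr (f x) E \<le> b" and "0 \<le> b"
  shows "Pr (bind_pmf p f) E \<le> Pr p B + b"
proof -
  have "emeasure (bind_pmf p f) E = (\<integral>\<^sup>+x. emeasure (f x) E \<partial>p)" by simp
  also have "\<dots> \<le> (\<integral>\<^sup>+x. indicator B x + ennreal b \<partial>p)"
  proof (rule nn_integral_mono_AE, simp add: AE_measure_pmf_iff, intro ballI)
    fix x assume x: "x \<in> set_pmf p"
    show "emeasure (f x) E \<le> indicator B x + ennreal b"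
    proof (cases "x \<in> B")
      case True
      then show ?thesis
        using measure_pmf.emeasure_le_1[of "f x" E] by (auto intro: order_trans add_increasing2)
    next
      case False
      then show ?thesis
        using assms(1)[OF x False] by (simp add: measure_pmf.emeasure_eq_measure ennreal_leI)
    qed
  qed
  also have "\<dots> = emeasure p B + ennreal b"
    by (subst nn_integral_add) (auto simp: measure_pmf.emeasure_space_1)
  also have "\<dots> = ennreal (Pr p B + b)"
    using assms(2) by (simp add: measure_pmf.emeasure_eq_measure ennreal_plus)
  finally show ?thesis
    using assms(2) by (simp add: measure_pmf.emeasure_eq_measure del: ennreal_plus)
qed

lemma prob_bind_le':
  assumes "\<And>x. x \<in> set_pmf p \<Longrightarrow> x \<notin> B \<Longrightarrow> Pr (f x) E \<le> b" and "0 \<le> b"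
    and "Pr p B \<le> a"
  shows "Pr (bind_pmf p f) E \<le> a + b"
  using prob_bind_le[of p B f E b] assms by fastforce

lemma prob_compl_le:
  assumes "Pr p G \<ge> q"
  shows "Pr p (- G) \<le> 1 - q"
  using assms measure_pmf.prob_compl[of G p] by (simp add: Compl_eq_Diff_UNIV)

lemma prob_UN_le:
  assumes "finite I" "\<And>i. i \<in> I \<Longrightarrow> Pr p (A i) \<le> b"
  shows "Pr p (\<Union>i\<in>I. A i) \<le> real (card I) * b"
proof -
  have "Pr p (\<Union>i\<in>I. A i) \<le> (\<Sum>i\<in>I. Pr p (A i))"
    using assms(1) by (intro measure_pmf.finite_measure_subadditive_finite) auto
  also have "\<dots> \<le> (\<Sum>i\<in>I. b)" by (intro sum_mono assms(2))
  finally show ?thesis by simp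
qed

section \<open>Exponential moments of empirical counts and Chernoff bounds\<close>

definition cnt :: "('a \<Rightarrow> bool) \<Rightarrow> 'a list \<Rightarrow> nat" where
  "cnt P xs = length (filter P xs)"

lemma cnt_le: "cnt P xs \<le> length xs"
  by (simp add: cnt_def)

lemma cnt_cong: "(\<And>x. x \<in> set xs \<Longrightarrow> P x = Q x) \<Longrightarrow> cnt P xs = cnt Q xs"
  by (simp add: cnt_def cong: filter_cong)

lemma nn_integral_bool:
  fixes p :: "'a pmf" and c :: real
  assumes "c > 0"
  shows "(\<integral>\<^sup>+x. ennreal (if P x then c else 1) \<partial>p) = ennreal (1 + (c - 1) * Pr p {x. P x})"
proof -
  let ?m = "Pr p {x. P x}"
  have "(\<integral>\<^sup>+x. ennreal (if P x then c else 1) \<partial>p)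
      = (\<integral>\<^sup>+x. ennreal c * indicator {x. P x} x + indicator {x. \<not> P x} x \<partial>p)"
    by (intro nn_integral_cong) (auto simp: indicator_def)
  also have "\<dots> = ennreal c * emeasure p {x. P x} + emeasure p {x. \<not> P x}"
    by (subst nn_integral_add) (auto simp: nn_integral_cmult)
  also have "\<dots> = ennreal (c * ?m + (1 - ?m))"
  proof -
    have "Pr p {x. \<not> P x} = 1 - ?m"
      using measure_pmf.prob_compl[of "{x. P x}" p] by (simp add: Compl_eq_Diff_UNIV[symmetric] Collect_neg_eq)
    then show ?thesis
      using assms by (simp add: measure_pmf.emeasure_eq_measure ennreal_mult'' ennreal_plus)
  qed
  also have "c * ?m + (1 - ?m) = 1 + (c - 1) * ?m" by (simp add: algebra_simps)
  finally show ?thesis .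
qed

lemma nn_integral_cnt:
  fixes p :: "'a pmf" and c :: real
  assumes "c > 0"
  shows "(\<integral>\<^sup>+xs. ennreal (c ^ cnt P xs) \<partial>replicate_pmf m p)
     = ennreal ((1 + (c - 1) * Pr p {x. P x}) ^ m)"
proof (induction m)
  case 0
  then show ?case by (simp add: cnt_def)
next
  case (Suc m)
  let ?\<mu> = "Pr p {x. P x}"
  have pos: "0 \<le> 1 + (c - 1) * ?\<mu>"
  proof -
    have "1 + (c - 1) * ?\<mu> = c * ?\<mu> + (1 - ?\<mu>)" by (simp add: algebra_simps)
    moreover have "0 \<le> c * ?\<mu>" using assms by simp
    moreover have "?\<mu> \<le> 1" by simp
    ultimately show ?thesis by linarith
  qed
  have "(\<integral>\<^sup>+xs. ennreal (c ^ cnt P xs) \<partial>replicate_pmf (Suc m) p)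
      = (\<integral>\<^sup>+x. (\<integral>\<^sup>+xs. ennreal (c ^ cnt P (x # xs)) \<partial>replicate_pmf m p) \<partial>p)"
    by simp
  also have "\<dots> = (\<integral>\<^sup>+x. ennreal (if P x then c else 1) * (\<integral>\<^sup>+xs. ennreal (c ^ cnt P xs) \<partial>replicate_pmf m p) \<partial>p)"
    by (intro nn_integral_cong, subst nn_integral_cmult[symmetric])
       (use assms in \<open>auto simp: cnt_def ennreal_mult' intro!: nn_integral_cong\<close>)
  also have "\<dots> = (\<integral>\<^sup>+x. ennreal (if P x then c else 1) \<partial>p) * ennreal ((1 + (c - 1) * ?\<mu>) ^ m)"
    by (simp add: Suc.IH nn_integral_multc)
  also have "\<dots> = ennreal ((1 + (c - 1) * ?\<mu>) ^ Suc m)"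
    unfolding nn_integral_bool[OF assms] using pos by (simp add: ennreal_mult')
  finally show ?case .
qed

text \<open>Markov's inequality for \<open>c\<close> raised to the number of successes; both tails below use it, with
  \<open>c = 2\<close> and \<open>c = 1/2\<close>.\<close>

lemma cnt_exp_moment:
  fixes p :: "'a pmf" and c :: real
  assumes "c > 0" and E: "\<And>xs. xs \<in> E \<Longrightarrow> K \<le> c ^ cnt P xs" and "K > 0"
  shows "Pr (replicate_pmf m p) E
      \<le> exp ((c - 1) * Pr p {x. P x} * real m) / K"
proof -
  let ?\<mu> = "Pr p {x. P x}"
  let ?q = "replicate_pmf m p"
  have pos: "0 \<le> 1 + (c - 1) * ?\<mu>"
  proof -
    have "1 + (c - 1) * ?\<mu> = c * ?\<mu> + (1 - ?\<mu>)" by (simp add: algebra_simps)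
    moreover have "0 \<le> c * ?\<mu>" using assms by simp
    moreover have "?\<mu> \<le> 1" by simp
    ultimately show ?thesis by linarith
  qed
  have "ennreal K * emeasure ?q E = (\<integral>\<^sup>+xs. ennreal K * indicator E xs \<partial>?q)"
    by (simp add: nn_integral_cmult_indicator)
  also have "\<dots> \<le> (\<integral>\<^sup>+xs. ennreal (c ^ cnt P xs) \<partial>?q)"
    by (intro nn_integral_mono) (auto simp: indicator_def intro!: ennreal_leI E)
  also have "\<dots> = ennreal ((1 + (c - 1) * ?\<mu>) ^ m)" by (rule nn_integral_cnt[OF assms(1)])
  finally have "K * Pr ?q E \<le> (1 + (c - 1) * ?\<mu>) ^ m"
    using assms(3) pos by (simp add: measure_pmf.emeasure_eq_measure ennreal_mult'[symmetric])
  also have "\<dots> \<le> exp ((c - 1) * ?\<mu>) ^ m"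
    by (intro power_mono pos) (rule exp_ge_add_one_self)
  also have "\<dots> = exp ((c - 1) * ?\<mu> * real m)" by (simp add: exp_of_nat_mult[symmetric] mult.commute)
  finally show ?thesis using assms(3) by (simp add: field_simps)
qed

lemma chernoff_upper:
  assumes "Pr p {x. P x} \<le> \<theta>"
  shows "Pr (replicate_pmf m p) {xs. 8 / 5 * \<theta> * real m \<le> real (cnt P xs)}
     \<le> exp (- (\<theta> * real m / 15))"
proof -
  have th: "0 \<le> \<theta>" using assms measure_nonneg[of p] by (meson order_trans)
  let ?K = "2 powr (8 / 5 * \<theta> * real m)"
  have "Pr (replicate_pmf m p) {xs. 8 / 5 * \<theta> * real m \<le> real (cnt P xs)}
     \<le> exp ((2 - 1) * Pr p {x. P x} * real m) / ?K"
    by (rule cnt_exp_moment) (auto simp: powr_realpow[symmetric])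
  also have "\<dots> \<le> exp (\<theta> * real m) / ?K"
    using assms by (intro divide_right_mono) (auto intro!: mult_right_mono)
  also have "\<dots> = exp (\<theta> * real m - 8 / 5 * \<theta> * real m * ln 2)"
    by (simp add: powr_def exp_diff)
  also have "\<dots> \<le> exp (- (\<theta> * real m / 15))"
  proof -
    \<comment> \<open>The exponent is \<open>\<theta> * m * (1 - 8 / 5 * ln 2)\<close>, and
      \<open>8 / 5 * (2 / 3) - 1 = 1 / 15\<close>.\<close>
    have "\<theta> * real m * (2 / 3) \<le> \<theta> * real m * ln 2"
      using th ln2_ge_two_thirds by (intro mult_left_mono) auto
    then show ?thesis by (simp add: algebra_simps)
  qed
  finally show ?thesis .
qed

lemma chernoff_lower:
  assumes "\<theta> \<le> Pr p {x. P x}" "0 \<le> \<theta>"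
  shows "Pr (replicate_pmf m p) {xs. real (cnt P xs) \<le> 3 / 5 * \<theta> * real m}
     \<le> exp (- (\<theta> * real m / 15))"
proof -
  let ?K = "(1/2) powr (3 / 5 * \<theta> * real m)"
  have "Pr (replicate_pmf m p) {xs. real (cnt P xs) \<le> 3 / 5 * \<theta> * real m}
     \<le> exp ((1/2 - 1) * Pr p {x. P x} * real m) / ?K"
  proof (rule cnt_exp_moment)
    fix xs assume "xs \<in> {xs. real (cnt P xs) \<le> 3 / 5 * \<theta> * real m}"
    then have "(1/2) powr (3 / 5 * \<theta> * real m) \<le> (1/2) powr real (cnt P xs)"
      by (intro powr_mono') auto
    then show "(1/2) powr (3 / 5 * \<theta> * real m) \<le> (1 / 2) ^ cnt P xs"
      by (simp add: powr_realpow)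
  qed auto
  also have "\<dots> \<le> exp (- (\<theta> * real m / 2)) / ?K"
    using assms mult_right_mono[OF assms(1), of "real m"]
    by (intro divide_right_mono) (auto simp: algebra_simps)
  also have "\<dots> = exp (- (\<theta> * real m / 2) + 3 / 5 * \<theta> * real m * ln 2)"
    by (simp add: powr_def ln_div exp_diff[symmetric])
  also have "\<dots> \<le> exp (- (\<theta> * real m / 15))"
  proof -
    \<comment> \<open>Here \<open>- 1 / 2 + 3 / 5 * (25 / 36) = - 1 / 12\<close>, which is below
      \<open>- 1 / 15\<close>.\<close>
    have "\<theta> * real m * ln 2 \<le> \<theta> * real m * (25 / 36)"
      using assms ln2_le_25_over_36 by (intro mult_left_mono) auto
    moreover have "0 \<le> \<theta> * real m" using assms by simp
    ultimately show ?thesis by (simp add: algebra_simps)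
  qed
  finally show ?thesis .
qed

text \<open>Since \<open>3 / 5 * (8 / 3) = 8 / 5\<close>, the upper tail at \<open>\<theta>\<close>
  and the lower tail at \<open>8 / 3 * \<theta>\<close> meet at a single threshold. It separates
  small from large probabilities; those in between may fall on either side.\<close>

lemma chernoff_uniform:
  assumes "finite I" "0 \<le> \<theta>"
  shows "Pr (replicate_pmf m p) {xs. \<not> (\<forall>i\<in>I.
      (Pr p {x. P i x} \<le> \<theta> \<longrightarrow> real (cnt (P i) xs) < 8 / 5 * \<theta> * real m) \<and>
      (8 / 3 * \<theta> \<le> Pr p {x. P i x} \<longrightarrow> 8 / 5 * \<theta> * real m < real (cnt (P i) xs)))}
     \<le> real (card I) * (2 * exp (- (\<theta> * real m / 15)))" (is "Pr ?q ?E \<le> _")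
proof -
  define A where "A i = {xs. Pr p {x. P i x} \<le> \<theta> \<and> 8 / 5 * \<theta> * real m \<le> real (cnt (P i) xs)}" for i
  define B where "B i = {xs. 8 / 3 * \<theta> \<le> Pr p {x. P i x} \<and> real (cnt (P i) xs) \<le> 8 / 5 * \<theta> * real m}" for i
  have "?E \<subseteq> (\<Union>i\<in>I. A i \<union> B i)" by (auto simp: A_def B_def not_less)
  then have "Pr ?q ?E \<le> Pr ?q (\<Union>i\<in>I. A i \<union> B i)"
    by (intro measure_pmf.finite_measure_mono) auto
  also have "\<dots> \<le> real (card I) * (2 * exp (- (\<theta> * real m / 15)))"
  proof (rule prob_UN_le[OF assms(1)])
    fix i
    have "Pr ?q (A i) \<le> exp (- (\<theta> * real m / 15))"
    proof (cases "Pr p {x. P i x} \<le> \<theta>")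
      case True
      then show ?thesis using chernoff_upper[OF True, of m] by (simp add: A_def)
    qed (simp add: A_def)
    moreover have "Pr ?q (B i) \<le> exp (- (\<theta> * real m / 15))"
    proof (cases "8 / 3 * \<theta> \<le> Pr p {x. P i x}")
      case True
      have "Pr ?q (B i) \<le> exp (- (8 / 3 * \<theta> * real m / 15))"
        using chernoff_lower[OF True, of m] True assms(2) by (simp add: B_def)
      also have "\<dots> \<le> exp (- (\<theta> * real m / 15))" using assms(2) by (simp add: mult_right_mono)
      finally show ?thesis .
    qed (simp add: B_def)
    moreover have "Pr ?q (A i \<union> B i) \<le> Pr ?q (A i) + Pr ?q (B i)"
      by (intro measure_Un_le) auto
    ultimately show "Pr ?q (A i \<union> B i) \<le> 2 * exp (- (\<theta> * real m / 15))" by linarith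
  qed
  finally show ?thesis .
qed

section \<open>Composing computations and their costs\<close>

primrec dbind :: "'a dtree \<Rightarrow> ('a \<Rightarrow> 'b dtree) \<Rightarrow> 'b dtree" where
  "dbind (Answer r) f = f r"
| "dbind (Ask x k) f = Ask x (\<lambda>b. dbind (k b) f)"

lemma dval_dbind [simp]: "dval S (dbind t f) = dval S (f (dval S t))"
  by (induction t) auto

lemma dcost_dbind [simp]: "dcost S (dbind t f) = dcost S t + dcost S (f (dval S t))"
  by (induction t) auto

definition dmap :: "('a \<Rightarrow> 'b) \<Rightarrow> 'a dtree \<Rightarrow> 'b dtree" where
  "dmap f t = dbind t (\<lambda>a. Answer (f a))"

lemma dval_dmap [simp]: "dval S (dmap f t) = f (dval S t)"
  and dcost_dmap [simp]: "dcost S (dmap f t) = dcost S t"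
  by (simp_all add: dmap_def)

definition dand :: "bool dtree \<Rightarrow> bool dtree \<Rightarrow> bool dtree" where
  "dand t u = dbind t (\<lambda>b. if b then u else Answer False)"

lemma dval_dand [simp]: "dval S (dand t u) \<longleftrightarrow> dval S t \<and> dval S u"
  by (simp add: dand_def)

lemma dcost_dand: "dcost S (dand t u) \<le> dcost S t + dcost S u"
  by (simp add: dand_def)

primrec dcnt :: "('a \<Rightarrow> bool dtree) \<Rightarrow> 'a list \<Rightarrow> nat dtree" where
  "dcnt P [] = Answer 0"
| "dcnt P (x # xs) = dbind (P x) (\<lambda>b. dmap (\<lambda>k. if b then Suc k else k) (dcnt P xs))"

lemma dval_dcnt [simp]: "dval S (dcnt P xs) = cnt (\<lambda>x. dval S (P x)) xs"
  by (induction xs) (auto simp: cnt_def)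

lemma dcost_dcnt:
  assumes "\<And>x. x \<in> set xs \<Longrightarrow> dcost S (P x) \<le> c"
  shows "dcost S (dcnt P xs) \<le> length xs * c"
  using assms by (induction xs) (fastforce intro: add_mono)+

primrec dfilter :: "('a \<Rightarrow> bool dtree) \<Rightarrow> 'a list \<Rightarrow> 'a list dtree" where
  "dfilter P [] = Answer []"
| "dfilter P (x # xs) = dbind (P x) (\<lambda>b. dmap (\<lambda>ys. if b then x # ys else ys) (dfilter P xs))"

lemma dval_dfilter [simp]: "dval S (dfilter P xs) = filter (\<lambda>x. dval S (P x)) xs"
  by (induction xs) auto

lemma dcost_dfilter:
  assumes "\<And>x. x \<in> set xs \<Longrightarrow> dcost S (P x) \<le> c"
  shows "dcost S (dfilter P xs) \<le> length xs * c"
  using assms by (induction xs) (fastforce intro: add_mono)+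

primrec rbind :: "'a ralg \<Rightarrow> ('a \<Rightarrow> 'b ralg) \<Rightarrow> 'b ralg" where
  "rbind (Return r) f = f r"
| "rbind (Query x k) f = Query x (\<lambda>b. rbind (k b) f)"
| "rbind (Sample k) f = Sample (\<lambda>x. rbind (k x) f)"
| "rbind (Coin k) f = Coin (\<lambda>b. rbind (k b) f)"

lemma run_rbind:
  "run S (rbind A f) = bind_pmf (run S A)
     (\<lambda>(a, s, q). map_pmf (\<lambda>(b, s', q'). (b, s + s', q + q')) (run S (f a)))"
proof (induction A)
  case (Return r)
  then show ?case by (simp add: bind_return_pmf map_pmf_def bind_assoc_pmf case_prod_beta' bind_return_pmf')
qed (simp_all add: map_pmf_def bind_assoc_pmf bind_return_pmf case_prod_beta')

lemma result_rbind [simp]: "result S (rbind A f) = bind_pmf (result S A) (\<lambda>a. result S (f a))"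
  unfolding result_def run_rbind
  by (simp add: map_pmf_def bind_assoc_pmf bind_return_pmf case_prod_beta')

lemma result_Return [simp]: "result S (Return r) = return_pmf r"
  by (simp add: result_def)

definition cost_le :: "point set \<Rightarrow> 'r ralg \<Rightarrow> nat \<Rightarrow> nat \<Rightarrow> bool" where
  "cost_le S A s q \<longleftrightarrow> (\<forall>(r, s', q') \<in> set_pmf (run S A). s' \<le> s \<and> q' \<le> q)"

lemma cost_le_mono: "cost_le S A s q \<Longrightarrow> s \<le> s' \<Longrightarrow> q \<le> q' \<Longrightarrow> cost_le S A s' q'"
  by (fastforce simp: cost_le_def)

lemma cost_le_Return [simp]: "cost_le S (Return r) s q"
  by (simp add: cost_le_def)

text \<open>The continuation is charged only on values that can occur, so the lengths of sampled
  lists are available when later tests are charged.\<close>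

lemma cost_le_rbind:
  assumes "cost_le S A s1 q1" "\<And>a. a \<in> set_pmf (result S A) \<Longrightarrow> cost_le S (f a) s2 q2"
  shows "cost_le S (rbind A f) (s1 + s2) (q1 + q2)"
  using assms unfolding cost_le_def run_rbind result_def
  by (fastforce intro: add_mono)

primrec of_dtree :: "'r dtree \<Rightarrow> 'r ralg" where
  "of_dtree (Answer r) = Return r"
| "of_dtree (Ask x k) = Query x (\<lambda>b. of_dtree (k b))"

lemma run_of_dtree: "run S (of_dtree t) = return_pmf (dval S t, 0, dcost S t)"
  by (induction t) auto

lemma result_of_dtree [simp]: "result S (of_dtree t) = return_pmf (dval S t)"
  by (simp add: result_def run_of_dtree)

lemma cost_le_of_dtree: "dcost S t \<le> q \<Longrightarrow> cost_le S (of_dtree t) 0 q"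
  by (simp add: cost_le_def run_of_dtree)

primrec replicate_alg :: "nat \<Rightarrow> 'a ralg \<Rightarrow> 'a list ralg" where
  "replicate_alg 0 A = Return []"
| "replicate_alg (Suc m) A = rbind A (\<lambda>x. rbind (replicate_alg m A) (\<lambda>xs. Return (x # xs)))"

lemma result_replicate_alg [simp]: "result S (replicate_alg m A) = replicate_pmf m (result S A)"
  by (induction m) simp_all

lemma cost_le_replicate_alg:
  assumes "cost_le S A s q"
  shows "cost_le S (replicate_alg m A) (m * s) (m * q)"
proof (induction m)
  case (Suc m)
  have "cost_le S (replicate_alg (Suc m) A) (s + (m * s + 0)) (q + (m * q + 0))"
    unfolding replicate_alg.simps by (intro cost_le_rbind assms Suc) simp
  then show ?case by simp
qed simp

definition draw :: "point ralg" where
  "draw = Sample Return"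

abbreviation uniform_pair :: "point set \<Rightarrow> (point \<times> point) pmf" where
  "uniform_pair S \<equiv> pair_pmf (pmf_of_set S) (pmf_of_set S)"

definition draw_pair :: "(point \<times> point) ralg" where
  "draw_pair = rbind draw (\<lambda>a. rbind draw (\<lambda>b. Return (a, b)))"

lemma result_draw [simp]: "result S draw = pmf_of_set S"
  by (simp add: draw_def result_def map_bind_pmf map_pmf_comp bind_return_pmf')

lemma result_draw_pair [simp]: "result S draw_pair = uniform_pair S"
  by (simp add: draw_pair_def pair_pmf_def)

lemma cost_le_draw: "cost_le S draw 1 0"
  by (simp add: draw_def cost_le_def)

lemma cost_le_draw_pair: "cost_le S draw_pair 2 0"
proof -
  have "cost_le S draw_pair (1 + (1 + 0)) (0 + (0 + 0))"
    unfolding draw_pair_def by (intro cost_le_rbind cost_le_draw) simp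
  then show ?thesis by (simp add: numeral_2_eq_2)
qed

section \<open>Running trials until one succeeds\<close>

primrec first_success :: "'r option ralg list \<Rightarrow> 'r option ralg" where
  "first_success [] = Return None"
| "first_success (A # As) =
     rbind A (\<lambda>r. case r of None \<Rightarrow> first_success As | Some D \<Rightarrow> Return (Some D))"

text \<open>A bad output is the value of one of the trials, so their errors add up.\<close>

lemma first_success_Some:
  assumes "\<And>A. A \<in> set As \<Longrightarrow> Pr (result S A) (Some ` B) \<le> \<epsilon>" "0 \<le> \<epsilon>"
  shows "Pr (result S (first_success As)) (Some ` B) \<le> real (length As) * \<epsilon>"
  using assms(1)
proof (induction As)
  case (Cons A As)
  have "Pr (result S (first_success (A # As))) (Some ` B) \<le> \<epsilon> + real (length As) * \<epsilon>"
    unfolding first_success.simps result_rbind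
  proof (rule prob_bind_le')
    show "Pr (result S A) (Some ` B) \<le> \<epsilon>" using Cons.prems by simp
    fix r assume "r \<notin> Some ` B"
    then show "Pr (result S (case r of None \<Rightarrow> first_success As | Some D \<Rightarrow> Return (Some D)))
        (Some ` B) \<le> real (length As) * \<epsilon>"
      using Cons assms(2) by (cases r) (auto simp: image_iff indicator_def)
  qed (use assms(2) in simp)
  then show ?case by (simp add: algebra_simps)
qed simp

lemma prob_bind_None:
  "Pr (bind_pmf p (\<lambda>r. case r of None \<Rightarrow> q | Some D \<Rightarrow> return_pmf (Some D))) {None}
    = Pr p {None} * Pr q {None}"
proof -
  have "pmf (bind_pmf p (\<lambda>r. case r of None \<Rightarrow> q | Some D \<Rightarrow> return_pmf (Some D))) None
      = (\<integral>x. pmf (case x of None \<Rightarrow> q | Some D \<Rightarrow> return_pmf (Some D)) None \<partial>p)"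
    by (rule pmf_bind)
  also have "\<dots> = (\<integral>x. indicator {None} x * pmf q None \<partial>p)"
    by (intro Bochner_Integration.integral_cong) (auto split: option.split)
  also have "\<dots> = pmf p None * pmf q None" by (simp add: measure_pmf_single)
  finally show ?thesis by (simp add: measure_pmf_single)
qed

lemma first_success_append_None:
  "Pr (result S (first_success (As @ Bs))) {None}
    = Pr (result S (first_success As)) {None} * Pr (result S (first_success Bs)) {None}"
proof (induction As)
  case (Cons A As)
  have *: "(\<lambda>r. result S (case r of None \<Rightarrow> first_success Cs | Some D \<Rightarrow> Return (Some D)))
     = (\<lambda>r. case r of None \<Rightarrow> result S (first_success Cs) | Some D \<Rightarrow> return_pmf (Some D))" for Cs :: "'a option ralg list"
    by (auto split: option.split)
  show ?case by (simp add: * prob_bind_None Cons.IH mult.assoc)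
qed simp


lemma first_success_replicate_None:
  "Pr (result S (first_success (replicate k A))) {None} = Pr (result S A) {None} ^ k"
proof (induction k)
  case (Suc k)
  have *: "(\<lambda>r. result S (case r of None \<Rightarrow> first_success Cs | Some D \<Rightarrow> Return (Some D)))
     = (\<lambda>r. case r of None \<Rightarrow> result S (first_success Cs) | Some D \<Rightarrow> return_pmf (Some D))" for Cs :: "'a option ralg list"
    by (auto split: option.split)
  show ?case by (simp add: * prob_bind_None Suc)
qed simp

text \<open>The list fails only if every block fails, so completeness can rest on the one block
  whose branch and level suit the set.\<close>

lemma first_success_sublist_None:
  "Pr (result S (first_success (As @ Bs @ Cs))) {None}
     \<le> Pr (result S (first_success Bs)) {None}"
proof -
  have "a * (b * c) \<le> b" if "0 \<le> a" "a \<le> 1" "0 \<le> b" "0 \<le> c" "c \<le> 1" for a b c :: real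
    using that mult_left_le[of c b] mult_left_le_one_le[of "b * c" a] by auto
  then show ?thesis unfolding first_success_append_None by simp
qed

lemma set_first_success:
  "Some D \<in> set_pmf (result S (first_success As)) \<Longrightarrow> \<exists>A\<in>set As. Some D \<in> set_pmf (result S A)"
  by (induction As) (auto split: option.splits)

lemma cost_le_first_success:
  assumes "\<And>A. A \<in> set As \<Longrightarrow> cost_le S A s q"
  shows "cost_le S (first_success As) (length As * s) (length As * q)"
  using assms
proof (induction As)
  case (Cons A As)
  have "cost_le S (first_success (A # As)) (s + length As * s) (q + length As * q)"
    unfolding first_success.simps
    by (rule cost_le_rbind) (use Cons in \<open>auto split: option.split\<close>)
  then show ?case by simp
qed simp

section \<open>Counting in the cube\<close>

lemma F2_eq_image: "F2 n = vec_of_list ` {xs :: bit list. length xs = n}"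
proof
  show "F2 n \<subseteq> vec_of_list ` {xs. length xs = n}"
  proof
    fix v :: point assume "v \<in> F2 n"
    then have "v = vec_of_list (list_of_vec v)" "length (list_of_vec v) = n"
      by (auto simp: vec_list)
    then show "v \<in> vec_of_list ` {xs. length xs = n}" by blast
  qed
qed (auto intro: carrier_vecI)

lemma UNIV_bit: "(UNIV :: bit set) = {0, 1}"
  using bit.exhaust by auto

lemma card_F2: "card (F2 n) \<le> 2 ^ n" and finite_F2 [simp]: "finite (F2 n)"
proof -
  have eq: "{xs :: bit list. length xs = n} = {xs. set xs \<subseteq> {0, 1} \<and> length xs = n}"
    using UNIV_bit by auto
  have *: "finite {xs :: bit list. length xs = n}" "card {xs :: bit list. length xs = n} = 2 ^ n"
    unfolding eq by (auto simp: finite_lists_length_eq card_lists_length_eq numeral_2_eq_2)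
  show "card (F2 n) \<le> 2 ^ n" "finite (F2 n)"
    unfolding F2_eq_image using card_image_le[OF *(1), of vec_of_list] *(2)
    by (auto intro: finite_imageI[OF *(1)])
qed

lemma bit_add_self: "(a :: bit) + a = 0"
  by (cases a) auto

lemma bit_add_shift: "((a :: bit) + c) + (b + c) = a + b"
  by (cases a; cases b; cases c) auto

lemma F2_cancel: "(x :: point) \<in> F2 n \<Longrightarrow> y \<in> F2 n \<Longrightarrow> x + (x + y) = y"
  by (auto intro!: eq_vecI simp: add.assoc[symmetric] bit_add_self)

lemma F2_add_left_cancel:
  fixes x y z :: point
  assumes "x \<in> F2 n" "y \<in> F2 n" "z \<in> F2 n"
  shows "x + y = x + z \<longleftrightarrow> y = z"
proof
  assume "x + y = x + z"
  then have "x + (x + y) = x + (x + z)" by (rule arg_cong)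
  then show "y = z" by (simp only: F2_cancel[OF assms(1,2)] F2_cancel[OF assms(1,3)])
qed (simp only:)

lemma F2_sum_shift:
  fixes x y z :: point
  assumes "x \<in> F2 n" "y \<in> F2 n" "z \<in> F2 n"
  shows "(x + z) + (y + z) = x + y"
proof (rule eq_vecI)
  note d = assms[THEN carrier_vecD]
  from d show "dim_vec ((x + z) + (y + z)) = dim_vec (x + y)" by simp
  fix i assume "i < dim_vec (x + y)"
  then have "i < n" using d by simp
  then have "vec_index ((x + z) + (y + z)) i = (vec_index x i + vec_index z i) + (vec_index y i + vec_index z i)" "vec_index (x + y) i = vec_index x i + vec_index y i"
    using d by (simp_all only: index_add_vec dim_vec)
  then show "vec_index ((x + z) + (y + z)) i = vec_index (x + y) i" by (simp only: bit_add_shift)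
qed

text \<open>For \<open>B\<close> and \<open>w\<close> in the cube this is both the number of ordered
  representations of \<open>w\<close> as a sum of two points of \<open>B\<close> and the size of the
  fibre of \<open>w\<close>.\<close>

definition rep :: "point set \<Rightarrow> point \<Rightarrow> nat" where
  "rep B w = card {b \<in> B. b + w \<in> B}"

lemma rep_le: "finite B \<Longrightarrow> rep B w \<le> card B"
  unfolding rep_def by (intro card_mono) auto

text \<open>The fourth coordinate of an energy quadruple is determined by the other three, as
  \<open>c + (a + b)\<close>.\<close>

lemma energy_eq:
  assumes S: "S \<subseteq> F2 n"
  shows "energy S = (\<Sum>(a, b)\<in>S \<times> S. rep S (a + b))"
proof -
  have fin: "finite S" by (rule finite_subset[OF S finite_F2])
  have canc: "a + (a + b) = b" if "a \<in> S" "b \<in> F2 n" for a b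
    using that S by (intro F2_cancel[where n = n]) auto
  have mem: "a \<in> F2 n" if "a \<in> S" for a
    using that S by auto
  let ?A = "{(x1, x2, x3, x4). x1 \<in> S \<and> x2 \<in> S \<and> x3 \<in> S \<and> x4 \<in> S \<and> x1 + x2 = x3 + x4}"
  let ?B = "SIGMA p:S \<times> S. {c \<in> S. c + (fst p + snd p) \<in> S}"
  have "bij_betw (\<lambda>(a, b, c, d). ((a, b), c)) ?A ?B"
    by (rule bij_betw_byWitness[where f' = "\<lambda>((a, b), c). (a, b, c, c + (a + b))"])
       (auto simp: canc mem)
  then have "energy S = card ?B" unfolding energy_def by (rule bij_betw_same_card)
  also have "\<dots> = (\<Sum>p\<in>S \<times> S. rep S (fst p + snd p))"
    unfolding rep_def by (rule card_SigmaI) (use fin in auto)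
  finally show ?thesis by (simp add: case_prod_beta')
qed

lemma sum_rep:
  assumes S: "S \<subseteq> F2 n" and Q: "Q \<subseteq> F2 n"
  shows "(\<Sum>d\<in>Q. rep S d) = card {(a, b) \<in> S \<times> S. a + b \<in> Q}"
proof -
  have fin: "finite S" "finite Q" using finite_subset[OF S finite_F2] finite_subset[OF Q finite_F2] by auto
  have canc: "a + (a + b) = b" if "a \<in> S" "b \<in> F2 n" for a b
    using that S by (intro F2_cancel[where n = n]) auto
  have mem: "a \<in> F2 n" if "a \<in> S" for a
    using that S by auto
  have memQ: "a \<in> F2 n" if "a \<in> Q" for a
    using that Q by auto
  have "bij_betw (\<lambda>(d, s). (s, s + d)) (SIGMA d:Q. {s \<in> S. s + d \<in> S}) {(a, b) \<in> S \<times> S. a + b \<in> Q}"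
    by (rule bij_betw_byWitness[where f' = "\<lambda>(a, b). (a + b, a)"])
       (auto simp: canc mem memQ)
  then have "card {(a, b) \<in> S \<times> S. a + b \<in> Q} = card (SIGMA d:Q. {s \<in> S. s + d \<in> S})"
    by (rule bij_betw_same_card[symmetric])
  also have "\<dots> = (\<Sum>d\<in>Q. rep S d)"
    unfolding rep_def by (rule card_SigmaI) (use fin in auto)
  finally show ?thesis ..
qed

text \<open>The pairs of \<open>S\<close> with \<open>a + b = d\<close> number
  \<open>rep S d\<close>; so sums over pairs become weighted sums over differences.\<close>

lemma sum_rep_weighted:
  fixes g :: "point \<Rightarrow> real"
  assumes S: "S \<subseteq> F2 n"
  shows "(\<Sum>(a, b)\<in>S \<times> S. g (a + b)) = (\<Sum>d\<in>F2 n. real (rep S d) * g d)"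
proof -
  have fin: "finite S" by (rule finite_subset[OF S finite_F2])
  have canc: "a + (a + b) = b" if "a \<in> S" "b \<in> F2 n" for a b
    using that S by (intro F2_cancel[where n = n]) auto
  have mem: "a \<in> F2 n" if "a \<in> S" for a
    using that S by auto
  have "bij_betw (\<lambda>(d, s). (s, s + d)) (SIGMA d:F2 n. {s \<in> S. s + d \<in> S}) (S \<times> S)"
    by (rule bij_betw_byWitness[where f' = "\<lambda>(a, b). (a + b, a)"])
       (auto simp: canc mem)
  then have "(\<Sum>(a, b)\<in>S \<times> S. g (a + b))
     = (\<Sum>(d, s)\<in>(SIGMA d:F2 n. {s \<in> S. s + d \<in> S}). g (s + (s + d)))"
    by (subst sum.reindex_bij_betw[symmetric]) (auto simp: case_prod_beta' intro!: sum.cong)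
  also have "\<dots> = (\<Sum>(d, s)\<in>(SIGMA d:F2 n. {s \<in> S. s + d \<in> S}). g d)"
    by (intro sum.cong) (auto simp: canc)
  also have "\<dots> = (\<Sum>d\<in>F2 n. \<Sum>s\<in>{s \<in> S. s + d \<in> S}. g d)"
    by (subst sum.Sigma) (use fin in auto)
  finally show ?thesis by (simp add: rep_def)
qed

text \<open>Each \<open>w = x + y\<close> has many representations \<open>b + (b + x + z) + c + (c + y + z)\<close> with all four
  summands in \<open>B\<close>; once \<open>x\<close> and \<open>y\<close> are chosen for each \<open>w\<close>, the summands determine \<open>w\<close>, \<open>z\<close>,
  \<open>b\<close> and \<open>c\<close>.\<close>

lemma doubling_bound:
  fixes M K :: real
  assumes B: "B \<subseteq> F2 n" and N: "N \<subseteq> F2 n" and Y: "Y \<subseteq> F2 n"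
    and path: "\<And>x y. x \<in> Y \<Longrightarrow> y \<in> Y \<Longrightarrow>
      M \<le> real (card {z \<in> N. K \<le> real (rep B (x + z)) \<and> K \<le> real (rep B (y + z))})"
    and K: "0 \<le> K"
  shows "real (card (Y + Y)) * M * K\<^sup>2 \<le> real (card B) ^ 4"
proof -
  have fin: "finite B" "finite N" "finite Y" 
    using finite_subset[OF B finite_F2] finite_subset[OF N finite_F2] finite_subset[OF Y finite_F2] by auto
  have "\<forall>w\<in>Y + Y. \<exists>p. fst p \<in> Y \<and> snd p \<in> Y \<and> w = fst p + snd p"
    by (auto simp: set_plus_def)
  then obtain P where P: "\<forall>w\<in>Y + Y. fst (P w) \<in> Y \<and> snd (P w) \<in> Y \<and> w = fst (P w) + snd (P w)"
    by (rule bchoice[THEN exE])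
  define X where "X w = fst (P w)" for w
  define X' where "X' w = snd (P w)" for w
  have X: "X w \<in> Y \<and> X' w \<in> Y \<and> w = X w + X' w" if "w \<in> Y + Y" for w
    using P that by (simp add: X_def X'_def)
  define G where "G w = {z \<in> N. K \<le> real (rep B (X w + z)) \<and> K \<le> real (rep B (X' w + z))}" for w
  define R where "R w = {b \<in> B. b + w \<in> B}" for w
  define T where "T = (SIGMA w:Y + Y. SIGMA z:G w. R (X w + z) \<times> R (X' w + z))"
  define f where "f = (\<lambda>(w, z, b, c). (b, b + (X w + z), c, c + (X' w + z)))"
  have "Y + Y = (\<Union>x\<in>Y. (\<lambda>y. x + y) ` Y)"
    unfolding set_plus_def by blast
  then have finYY: "finite (Y + Y)" by (simp only: finite_imageI finite_UN_I fin)
  have finG: "finite (G w)" for w using fin by (simp add: G_def)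
  have finR: "finite (R w)" for w using fin by (simp add: R_def)
  have inj: "inj_on f T"
  proof (rule inj_onI)
    fix p p' assume p: "p \<in> T" and p': "p' \<in> T" and eq: "f p = f p'"
    obtain w z b c where pe: "p = (w, z, b, c)" by (rule prod_cases4)
    obtain w' z' b' c' where pe': "p' = (w', z', b', c')" by (rule prod_cases4)
    have w: "w \<in> Y + Y" "w' \<in> Y + Y" and z: "z \<in> F2 n" "z' \<in> F2 n" and bc: "b \<in> F2 n" "c \<in> F2 n"
      using p p' N B by (auto simp: pe pe' T_def G_def R_def)
    have XY: "X w \<in> F2 n" "X' w \<in> F2 n" "X w' \<in> F2 n" "X' w' \<in> F2 n"
      using X[OF w(1)] X[OF w(2)] Y by auto
    have e: "b = b'" "c = c'" "X w + z = X w' + z'" "X' w + z = X' w' + z'"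
      using eq bc XY z by (auto simp: f_def pe pe' F2_add_left_cancel)
    have "w = (X w + z) + (X' w + z)" using X[OF w(1)] F2_sum_shift[OF XY(1,2) z(1)] by simp
    also have "\<dots> = w'" using X[OF w(2)] F2_sum_shift[OF XY(3,4) z(2)] e by simp
    finally have ww: "w = w'" .
    moreover have "z = z'" using e(3) XY z by (simp add: ww F2_add_left_cancel)
    ultimately show "p = p'" using e by (simp add: pe pe')
  qed
  have "f ` T \<subseteq> B \<times> B \<times> B \<times> B" by (auto simp: f_def T_def R_def)
  then have "card T \<le> card (B \<times> B \<times> B \<times> B)"
    by (rule card_inj_on_le[OF inj]) (use fin in simp)
  then have 1: "real (card T) \<le> real (card B) ^ 4"
    by (simp add: card_cartesian_product power4_eq_xxxx mult.assoc flip: of_nat_mult)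
  have "real (card T) = (\<Sum>w\<in>Y + Y. \<Sum>z\<in>G w. real (rep B (X w + z)) * real (rep B (X' w + z)))"
    unfolding T_def using finYY finG finR
    by (simp add: card_SigmaI card_cartesian_product rep_def R_def)
  also have "\<dots> \<ge> (\<Sum>w\<in>Y + Y. M * K\<^sup>2)"
  proof (rule sum_mono)
    fix w assume w: "w \<in> Y + Y"
    have "M * K\<^sup>2 \<le> real (card (G w)) * K\<^sup>2"
      unfolding G_def using X[OF w] by (intro mult_right_mono path) auto
    also have "\<dots> = (\<Sum>z\<in>G w. K * K)" by (simp add: power2_eq_square)
    also have "\<dots> \<le> (\<Sum>z\<in>G w. real (rep B (X w + z)) * real (rep B (X' w + z)))"
      by (intro sum_mono mult_mono) (use K in \<open>auto simp: G_def\<close>)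
    finally show "M * K\<^sup>2 \<le> (\<Sum>z\<in>G w. real (rep B (X w + z)) * real (rep B (X' w + z)))" .
  qed
  finally have "real (card (Y + Y)) * (M * K\<^sup>2) \<le> real (card T)" by (simp only: sum_constant)
  then show ?thesis using 1 by (simp only: mult.assoc)
qed

text \<open>Swapping the sums: a pair with \<open>cod x z < K\<close> lies in
  \<open>N \<omega>\<close> for fewer than \<open>K\<close> indices, and the other pairs contribute
  nothing.\<close>

lemma sum_card_pairs:
  fixes K :: real
  assumes "finite \<Omega>" "finite S" and N: "\<And>\<omega>. \<omega> \<in> \<Omega> \<Longrightarrow> N \<omega> \<subseteq> S"
    and cod: "\<And>x z. x \<in> S \<Longrightarrow> z \<in> S \<Longrightarrow> card {\<omega> \<in> \<Omega>. x \<in> N \<omega> \<and> z \<in> N \<omega>} \<le> cod x z"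
    and K: "0 \<le> K"
  shows "(\<Sum>\<omega>\<in>\<Omega>. real (card {(x, z) \<in> N \<omega> \<times> N \<omega>. real (cod x z) < K})) \<le> K * real (card S) ^ 2"
proof -
  have "(\<Sum>\<omega>\<in>\<Omega>. real (card {(x, z) \<in> N \<omega> \<times> N \<omega>. real (cod x z) < K}))
      = (\<Sum>\<omega>\<in>\<Omega>. \<Sum>p\<in>S \<times> S. if fst p \<in> N \<omega> \<and> snd p \<in> N \<omega> \<and> real (cod (fst p) (snd p)) < K then 1 else 0)"
  proof (rule sum.cong[OF refl])
    fix \<omega> assume "\<omega> \<in> \<Omega>"
    then have "{(x, z) \<in> N \<omega> \<times> N \<omega>. real (cod x z) < K}
       = {p \<in> S \<times> S. fst p \<in> N \<omega> \<and> snd p \<in> N \<omega> \<and> real (cod (fst p) (snd p)) < K}"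
      using N by auto
    then show "real (card {(x, z) \<in> N \<omega> \<times> N \<omega>. real (cod x z) < K})
      = (\<Sum>p\<in>S \<times> S. if fst p \<in> N \<omega> \<and> snd p \<in> N \<omega> \<and> real (cod (fst p) (snd p)) < K then 1 else 0)"
      using assms(2) by (simp add: sum.If_cases Int_def)
  qed
  also have "\<dots> = (\<Sum>p\<in>S \<times> S. \<Sum>\<omega>\<in>\<Omega>. if fst p \<in> N \<omega> \<and> snd p \<in> N \<omega> \<and> real (cod (fst p) (snd p)) < K then 1 else 0)"
    by (rule sum.swap)
  also have "\<dots> \<le> (\<Sum>p\<in>S \<times> S. K)"
  proof (rule sum_mono)
    fix p assume p: "p \<in> S \<times> S"
    show "(\<Sum>\<omega>\<in>\<Omega>. if fst p \<in> N \<omega> \<and> snd p \<in> N \<omega> \<and> real (cod (fst p) (snd p)) < K then 1 else 0) \<le> K"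
    proof (cases "real (cod (fst p) (snd p)) < K")
      case True
      then have "(\<Sum>\<omega>\<in>\<Omega>. if fst p \<in> N \<omega> \<and> snd p \<in> N \<omega> \<and> real (cod (fst p) (snd p)) < K then 1 else (0::real))
         = real (card {\<omega> \<in> \<Omega>. fst p \<in> N \<omega> \<and> snd p \<in> N \<omega>})"
        using assms(1) by (simp add: sum.If_cases Int_def)
      also have "\<dots> \<le> K" using True cod[of "fst p" "snd p"] p by fastforce
      finally show ?thesis .
    qed (use K in simp)
  qed
  also have "\<dots> = K * real (card S) ^ 2"
    by (simp add: card_cartesian_product power2_eq_square)
  finally show ?thesis .
qed

text \<open>Markov's inequality on rows: \<open>9 / 2048\<close> is one eighth of
  \<open>9 / 256\<close>, so at most an eighth of the rows are heavy.\<close>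

lemma card_light_rows:
  fixes N :: "'a set"
  assumes "finite N" "real (card {(x, z) \<in> N \<times> N. T x z}) \<le> 9 / 2048 * real (card N) ^ 2"
  shows "real (card {x \<in> N. real (card {z \<in> N. T x z}) \<le> 9 / 256 * real (card N)}) \<ge> 7 / 8 * real (card N)"
proof (cases "N = {}")
  case False
  then have pos: "real (card N) > 0" using assms(1) by (simp add: card_gt_0_iff)
  let ?H = "{x \<in> N. 9 / 256 * real (card N) < real (card {z \<in> N. T x z})}"
  let ?L = "{x \<in> N. real (card {z \<in> N. T x z}) \<le> 9 / 256 * real (card N)}"
  have "{(x, z) \<in> N \<times> N. T x z} = (SIGMA x:N. {z \<in> N. T x z})" by auto
  then have "real (card {(x, z) \<in> N \<times> N. T x z}) = (\<Sum>x\<in>N. real (card {z \<in> N. T x z}))"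
    using assms(1) by (simp add: card_SigmaI)
  also have "\<dots> \<ge> (\<Sum>x\<in>?H. real (card {z \<in> N. T x z}))"
    using assms(1) by (intro sum_mono2) auto
  also have "(\<Sum>x\<in>?H. real (card {z \<in> N. T x z})) \<ge> (\<Sum>x\<in>?H. 9 / 256 * real (card N))"
    by (intro sum_mono) auto
  finally have "real (card ?H) * (9 / 256 * real (card N)) \<le> 9 / 2048 * real (card N) ^ 2"
    using assms(2) unfolding sum_constant by linarith
  then have "real (card ?H) * (9 / 256) \<le> 9 / 2048 * real (card N)"
    using pos by (simp add: power2_eq_square)
  moreover have "real (card N) = real (card ?H) + real (card ?L)"
    using assms(1) unfolding of_nat_add[symmetric]
    by (subst card_Un_disjoint[symmetric]) (auto intro!: arg_cong[where f = card])
  ultimately show ?thesis by linarith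
qed simp

lemma F2_sum_shift':
  fixes x y z :: point
  assumes "x \<in> F2 n" "y \<in> F2 n" "z \<in> F2 n"
  shows "(y + x) + (x + z) = y + z"
  using F2_sum_shift[OF assms(2,3,1)] comm_add_vec[OF assms(1,3)] by simp

text \<open>If \<open>t / 2 ^ i \<le> X < t / 2 ^ (i - 1)\<close> with
  \<open>1 \<le> i \<le> J\<close>, the levels from \<open>i\<close> to \<open>J\<close> and the
  remainder \<open>t / 2 ^ J\<close> add up to exactly \<open>t / 2 ^ (i - 1)\<close>.\<close>

lemma staircase_le:
  fixes X t :: real
  assumes "0 \<le> t"
  shows "X \<le> (if t \<le> X then X else 0) + t / 2 ^ J + (\<Sum>k=1..J. if t / 2 ^ k \<le> X then t / 2 ^ k else 0)"
proof (induction J)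
  case (Suc J)
  let ?s = "\<Sum>k=1..J. if t / 2 ^ k \<le> X then t / 2 ^ k else 0"
  have s: "0 \<le> ?s" using assms by (intro sum_nonneg) auto
  have t: "t / 2 ^ J = t / 2 ^ Suc J + t / 2 ^ Suc J" by simp
  have nn: "0 \<le> t / 2 ^ Suc J" using assms by simp
  have e: "(\<Sum>k=1..Suc J. if t / 2 ^ k \<le> X then t / 2 ^ k else 0)
      = ?s + (if t / 2 ^ Suc J \<le> X then t / 2 ^ Suc J else 0)" by simp
  have p: "0 \<le> (if t \<le> X then X else 0)" using assms by auto
  show ?case
  proof (cases "t / 2 ^ Suc J \<le> X")
    case True
    show ?thesis unfolding e if_P[OF True] using Suc.IH t by linarith
  next
    case False
    show ?thesis unfolding e if_not_P[OF False] using False s p by linarith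
  qed
qed (use assms in simp)

lemma sum_geometric_le:
  fixes t :: real
  assumes "0 \<le> t"
  shows "(\<Sum>k=1..J. t / 2 ^ k) \<le> t"
proof -
  have "(\<Sum>k=1..J. t / 2 ^ k) = t - t / 2 ^ J"
    by (induction J) (auto simp: field_simps)
  then show ?thesis using assms by simp
qed

lemma sum_powers_two_le: "(\<Sum>k=1..J. (2::real) ^ k) \<le> 2 * 2 ^ J"
  by (induction J) auto

text \<open>The normalised energy, at least \<open>\<alpha>\<close>, is at most the sum of three
  parts: the popular differences, the remainder below the last level, and the dyadic levels. With
  shares \<open>3 / 8\<close>, \<open>1 / 16\<close> and \<open>9 / 16\<close>, a shortfall in the
  first part leaves more than \<open>9 / 16\<close> for the levels.\<close>

lemma energy_dichotomy:
  fixes \<alpha> :: real and e :: nat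
  defines "t \<equiv> \<lambda>k. sqrt \<alpha> / 2 / 2 ^ k"
  assumes S: "S \<subseteq> F2 n" "S \<noteq> {}" and \<alpha>: "0 < \<alpha>"
    and E: "\<alpha> * real (card S) ^ 3 \<le> real (energy S)"
    and e: "1 / sqrt \<alpha> \<le> 2 ^ e" "2 ^ e \<le> 2 / sqrt \<alpha>"
  obtains
    (high) "3 / 8 * \<alpha> * real (card S) ^ 3
        \<le> (\<Sum>d\<in>{d \<in> F2 n. sqrt \<alpha> / 2 * real (card S) \<le> real (rep S d)}. real (rep S d) ^ 2)"
  | (low) k where "k \<in> {1..e + 3}"
      "max (sqrt \<alpha>) (\<alpha> ^ 2 / (1024 * t k ^ 2)) * real (card S) ^ 2
        \<le> real (card {(a, b) \<in> S \<times> S. t k * real (card S) \<le> real (rep S (a + b))})"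
proof -
  have finS: "finite S" by (rule finite_subset[OF S(1) finite_F2])
  define s where "s = real (card S)"
  have s: "s > 0" using finS S(2) by (simp add: s_def card_gt_0_iff)
  have sq: "sqrt \<alpha> > 0" "sqrt \<alpha> * sqrt \<alpha> = \<alpha>" using \<alpha> by auto
  \<comment> \<open>The three extra levels bring the remainder \<open>t J\<close> down to
    \<open>\<alpha> / 16\<close>.\<close>
  define J where "J = e + 3"
  define H where "H = {d \<in> F2 n. sqrt \<alpha> / 2 * s \<le> real (rep S d)}"
  define c where "c k = real (card {(a, b) \<in> S \<times> S. t k * s \<le> real (rep S (a + b))})" for k
  define X where "X d = real (rep S d) / s" for d
  have X_iff: "u \<le> X d \<longleftrightarrow> u * s \<le> real (rep S d)" for u d
    using s by (simp add: X_def field_simps)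
  have t_pos: "t k > 0" for k using sq by (simp add: t_def)
  have tk: "t 0 / 2 ^ k = t k" for k by (simp add: t_def)
  have "\<alpha> * s ^ 2 \<le> real (energy S) / s"
    using E s by (simp add: s_def[symmetric] field_simps power2_eq_square power3_eq_cube)
  also have "\<dots> = (\<Sum>(a, b)\<in>S \<times> S. X (a + b))"
    unfolding energy_eq[OF S(1)] X_def by (simp add: sum_divide_distrib case_prod_beta')
  also have "\<dots> \<le> (\<Sum>(a, b)\<in>S \<times> S. (if t 0 \<le> X (a + b) then X (a + b) else 0) + t 0 / 2 ^ J
      + (\<Sum>k=1..J. if t 0 / 2 ^ k \<le> X (a + b) then t 0 / 2 ^ k else 0))"
    using t_pos[of 0] by (intro sum_mono) (auto simp only: case_prod_beta' intro!: staircase_le)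
  also have "\<dots> = (\<Sum>(a, b)\<in>S \<times> S. if t 0 \<le> X (a + b) then X (a + b) else 0) + s ^ 2 * t J
      + (\<Sum>(a, b)\<in>S \<times> S. \<Sum>k=1..J. if t k \<le> X (a + b) then t k else 0)"
    unfolding tk by (simp add: sum.distrib case_prod_beta' card_cartesian_product power2_eq_square s_def)
  also have "(\<Sum>(a, b)\<in>S \<times> S. if t 0 \<le> X (a + b) then X (a + b) else 0)
      = (\<Sum>d\<in>F2 n. real (rep S d) * (if t 0 \<le> X d then X d else 0))"
    by (rule sum_rep_weighted[OF S(1)])
  also have "\<dots> = (\<Sum>d\<in>H. real (rep S d) ^ 2) / s"
    unfolding H_def sum_divide_distrib X_iff
    by (subst sum.inter_filter[OF finite_F2]) (auto intro!: sum.cong simp: X_def power2_eq_square t_def)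
  also have "(\<Sum>(a, b)\<in>S \<times> S. \<Sum>k=1..J. if t k \<le> X (a + b) then t k else 0) = (\<Sum>k=1..J. t k * c k)"
  proof -
    have "(\<Sum>(a, b)\<in>S \<times> S. \<Sum>k=1..J. if t k \<le> X (a + b) then t k else 0)
        = (\<Sum>k=1..J. \<Sum>p\<in>S \<times> S. if t k \<le> X (fst p + snd p) then t k else 0)"
      unfolding case_prod_beta' by (rule sum.swap)
    also have "\<dots> = (\<Sum>k=1..J. t k * c k)"
    proof (rule sum.cong[OF refl])
      fix k
      have eq: "{(a, b) \<in> S \<times> S. t k * s \<le> real (rep S (a + b))} = {p \<in> S \<times> S. t k \<le> X (fst p + snd p)}"
        by (auto simp: X_iff)
      have "(\<Sum>p\<in>S \<times> S. if t k \<le> X (fst p + snd p) then t k else 0)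
        = (\<Sum>p\<in>{p \<in> S \<times> S. t k \<le> X (fst p + snd p)}. t k)"
        by (rule sum.inter_filter[symmetric]) (use finS in simp)
      then show "(\<Sum>p\<in>S \<times> S. if t k \<le> X (fst p + snd p) then t k else 0) = t k * c k"
        unfolding c_def eq by simp
    qed
    finally show ?thesis .
  qed
  finally have main: "\<alpha> * s ^ 2 \<le> (\<Sum>d\<in>H. real (rep S d) ^ 2) / s + s ^ 2 * t J + (\<Sum>k=1..J. t k * c k)" .
  have tJ: "t J \<le> \<alpha> / 16"
  proof -
    have "t J = sqrt \<alpha> / 16 * (1 / 2 ^ e)" by (simp add: t_def J_def power_add)
    also have "\<dots> \<le> sqrt \<alpha> / 16 * sqrt \<alpha>"
      using e(1) sq by (intro mult_left_mono) (auto simp: field_simps)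
    finally show ?thesis using sq by simp
  qed
  show thesis
  proof (cases "3 / 8 * \<alpha> * s ^ 3 \<le> (\<Sum>d\<in>H. real (rep S d) ^ 2)")
    case True
    then show thesis using high by (simp add: s_def H_def)
  next
    case False
    then have "(\<Sum>d\<in>H. real (rep S d) ^ 2) / s < 3 / 8 * \<alpha> * s ^ 2"
      using s by (simp add: field_simps power2_eq_square power3_eq_cube)
    moreover have "s ^ 2 * t J \<le> s ^ 2 * (\<alpha> / 16)"
      using tJ by (intro mult_left_mono) auto
    ultimately have lower: "9 / 16 * \<alpha> * s ^ 2 < (\<Sum>k=1..J. t k * c k)"
      using main by (simp add: algebra_simps)
    \<comment> \<open>Otherwise, with the maximum replaced by a sum, \<open>t k * c k\<close> is
      bounded by a decreasing and an increasing geometric term. They add up to at most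
      \<open>\<alpha> / 2\<close> and \<open>\<alpha> / 16\<close> times \<open>s ^ 2\<close>,
      together the share \<open>9 / 16\<close>.\<close>
    have "\<exists>k\<in>{1..J}. max (sqrt \<alpha>) (\<alpha> ^ 2 / (1024 * t k ^ 2)) * s ^ 2 \<le> c k"
    proof (rule ccontr)
      assume none: "\<not> ?thesis"
      then have c: "c k \<le> (sqrt \<alpha> + \<alpha> ^ 2 / (1024 * t k ^ 2)) * s ^ 2" if "k \<in> {1..J}" for k
      proof -
        have "c k < max (sqrt \<alpha>) (\<alpha> ^ 2 / (1024 * t k ^ 2)) * s ^ 2"
          using that none by (simp add: not_le)
        also have "\<dots> \<le> (sqrt \<alpha> + \<alpha> ^ 2 / (1024 * t k ^ 2)) * s ^ 2"
          using sq by (intro mult_right_mono) auto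
        finally show ?thesis by simp
      qed
      have split: "t k * ((sqrt \<alpha> + \<alpha> ^ 2 / (1024 * t k ^ 2)) * s ^ 2)
          = s ^ 2 * sqrt \<alpha> * t k + s ^ 2 * \<alpha> ^ 2 / 1024 / t k" for k
        using t_pos[of k] by (simp add: field_simps power2_eq_square)
      have inv: "s ^ 2 * \<alpha> ^ 2 / 1024 / t k = s ^ 2 * \<alpha> ^ 2 / 512 / sqrt \<alpha> * 2 ^ k" for k
        by (simp add: t_def)
      have "(\<Sum>k=1..J. t k * c k) \<le> (\<Sum>k=1..J. t k * ((sqrt \<alpha> + \<alpha> ^ 2 / (1024 * t k ^ 2)) * s ^ 2))"
        using t_pos by (intro sum_mono mult_left_mono c) (auto intro: less_imp_le)
      also have "\<dots> = (\<Sum>k=1..J. s ^ 2 * sqrt \<alpha> * (sqrt \<alpha> / 2 / 2 ^ k) + s ^ 2 * \<alpha> ^ 2 / 512 / sqrt \<alpha> * 2 ^ k)"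
        unfolding split inv unfolding t_def ..
      also have "\<dots> = s ^ 2 * sqrt \<alpha> * (\<Sum>k=1..J. sqrt \<alpha> / 2 / 2 ^ k)
          + s ^ 2 * \<alpha> ^ 2 / 512 / sqrt \<alpha> * (\<Sum>k=1..J. 2 ^ k)"
        by (simp only: sum.distrib sum_distrib_left)
      also have "\<dots> \<le> s ^ 2 * sqrt \<alpha> * (sqrt \<alpha> / 2) + s ^ 2 * \<alpha> ^ 2 / 512 / sqrt \<alpha> * (2 * 2 ^ J)"
        using sq by (intro add_mono mult_left_mono sum_geometric_le sum_powers_two_le) auto
      also have "\<dots> \<le> s ^ 2 * sqrt \<alpha> * (sqrt \<alpha> / 2) + s ^ 2 * \<alpha> ^ 2 / 512 / sqrt \<alpha> * (32 / sqrt \<alpha>)"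
        using e(2) sq by (intro add_mono mult_left_mono) (auto simp: J_def power_add)
      also have "\<dots> = 9 / 16 * \<alpha> * s ^ 2"
      proof -
        have 1: "s ^ 2 * sqrt \<alpha> * (sqrt \<alpha> / 2) = s ^ 2 * (sqrt \<alpha> * sqrt \<alpha>) / 2" by simp
        have *: "x / 512 / r * (32 / r) = x / 16 / (r * r)" for x r :: real by simp
        have "s ^ 2 * \<alpha> ^ 2 / 512 / sqrt \<alpha> * (32 / sqrt \<alpha>) = s ^ 2 * \<alpha> ^ 2 / 16 / (sqrt \<alpha> * sqrt \<alpha>)"
          by (rule *)
        then show ?thesis using \<alpha> 1 unfolding sq(2) by (simp add: power2_eq_square)
      qed
      finally show False using lower by simp
    qed
    then show thesis using low unfolding J_def c_def s_def by blast
  qed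
qed

text \<open>If \<open>x\<close> and \<open>z\<close> lie in the fibre of \<open>d\<close>, then
  \<open>b = x + d\<close> and \<open>b + (x + z) = z + d\<close> are in \<open>S\<close>, and
  \<open>b\<close> determines \<open>d\<close>.\<close>

lemma card_fibre_pairs_le:
  assumes S: "S \<subseteq> F2 n" and x: "x \<in> S" and z: "z \<in> S"
  shows "card {d \<in> F2 n. x \<in> {x \<in> S. x + d \<in> S} \<and> z \<in> {x \<in> S. x + d \<in> S}} \<le> rep S (x + z)"
  unfolding rep_def
proof (rule card_inj_on_le)
  have F: "x \<in> F2 n" "z \<in> F2 n" using S x z by auto
  show "inj_on (\<lambda>d. x + d) {d \<in> F2 n. x \<in> {x \<in> S. x + d \<in> S} \<and> z \<in> {x \<in> S. x + d \<in> S}}"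
    using F by (auto intro!: inj_onI simp: F2_add_left_cancel)
  show "finite {b \<in> S. b + (x + z) \<in> S}" using finite_subset[OF S finite_F2] by simp
  have "x + d + (x + z) = z + d" if "d \<in> F2 n" for d
    using F2_sum_shift'[OF F(1) that F(2)] comm_add_vec[OF F(1) that] comm_add_vec[OF F(2) that] by simp
  then show "(\<lambda>d. x + d) ` {d \<in> F2 n. x \<in> {x \<in> S. x + d \<in> S} \<and> z \<in> {x \<in> S. x + d \<in> S}} \<subseteq> {b \<in> S. b + (x + z) \<in> S}"
    by auto
qed

text \<open>Both counting lemmas below weigh the seeds by the size of their set \<open>N\<close>: the seeds with too many
  bad pairs carry only part of the total weight, because the bad pairs are few on average.\<close>

lemma many_good_differences:
  fixes \<alpha> :: real
  assumes S: "S \<subseteq> F2 n" "S \<noteq> {}" and \<alpha>: "0 < \<alpha>"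
    and N_def: "\<And>d. N d = {x \<in> S. x + d \<in> S}"
    and H: "3 / 8 * \<alpha> * real (card S) ^ 3
        \<le> (\<Sum>d\<in>{d \<in> F2 n. sqrt \<alpha> / 2 * real (card S) \<le> real (rep S d)}. real (rep S d) ^ 2)"
  shows "\<alpha> / 16 * real (card S) ^ 2 \<le> real (card {(a, b) \<in> S \<times> S.
      sqrt \<alpha> / 2 * real (card S) \<le> real (card (N (a + b))) \<and>
      real (card {(x, z) \<in> N (a + b) \<times> N (a + b). real (rep S (x + z)) < \<alpha> / 768 * real (card S)})
        \<le> 9 / 2048 * real (card (N (a + b))) ^ 2})"
proof -
  have finS: "finite S" by (rule finite_subset[OF S(1) finite_F2])
  define s where "s = real (card S)"
  have s: "s > 0" using finS S(2) by (simp add: s_def card_gt_0_iff)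
  have cN: "card (N d) = rep S d" for d by (simp add: N_def rep_def)
  define bad where "bad d = real (card {(x, z) \<in> N d \<times> N d. real (rep S (x + z)) < \<alpha> / 768 * s})" for d
  define H where "H = {d \<in> F2 n. sqrt \<alpha> / 2 * s \<le> real (rep S d)}"
  define G where "G = {d \<in> H. bad d \<le> 9 / 2048 * real (rep S d) ^ 2}"
  have fin: "finite H" by (simp add: H_def)
  have HF: "H \<subseteq> F2 n" by (auto simp: H_def)
  have "(\<Sum>d\<in>F2 n. bad d) \<le> \<alpha> / 768 * s * s ^ 2"
    unfolding bad_def s_def
    by (rule sum_card_pairs) (use finS S \<alpha> card_fibre_pairs_le[OF S(1)] in \<open>auto simp: N_def\<close>)
  moreover have "(\<Sum>d\<in>H - G. real (rep S d) ^ 2) \<le> (\<Sum>d\<in>F2 n. 2048 / 9 * bad d)"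
  proof -
    have "(\<Sum>d\<in>H - G. real (rep S d) ^ 2) \<le> (\<Sum>d\<in>H - G. 2048 / 9 * bad d)"
      by (intro sum_mono) (auto simp: G_def field_simps)
    also have "\<dots> \<le> (\<Sum>d\<in>F2 n. 2048 / 9 * bad d)"
      using HF by (intro sum_mono2) (auto simp: bad_def)
    finally show ?thesis .
  qed
  ultimately have "(\<Sum>d\<in>H - G. real (rep S d) ^ 2) \<le> 8 / 27 * \<alpha> * s ^ 3"
    unfolding sum_distrib_left[symmetric] by (simp add: power2_eq_square power3_eq_cube)
  moreover have "(\<Sum>d\<in>H. real (rep S d) ^ 2) = (\<Sum>d\<in>H - G. real (rep S d) ^ 2) + (\<Sum>d\<in>G. real (rep S d) ^ 2)"
    by (rule sum.subset_diff) (use fin in \<open>auto simp: G_def\<close>)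
  moreover have "3 / 8 * \<alpha> * s ^ 3 \<le> (\<Sum>d\<in>H. real (rep S d) ^ 2)" using H by (simp add: H_def s_def)
  moreover have "0 \<le> \<alpha> * s ^ 3" using \<alpha> s by simp
  \<comment> \<open>The bad differences cost \<open>2048 / 9 / 768 = 8 / 27\<close>, and
    \<open>3 / 8 - 8 / 27 = 17 / 216\<close> is more than \<open>1 / 16\<close>.\<close>
  ultimately have "\<alpha> / 16 * s ^ 3 \<le> (\<Sum>d\<in>G. real (rep S d) ^ 2)" by simp
  \<comment> \<open>One factor \<open>rep S d\<close> is given up for \<open>s\<close>; the other is
    the weight with which a sampled sum \<open>a + b\<close> equals \<open>d\<close>.\<close>
  also have "\<dots> \<le> (\<Sum>d\<in>G. s * real (rep S d))"
    using rep_le[OF finS] by (intro sum_mono) (auto simp: s_def power2_eq_square intro!: mult_right_mono)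
  also have "\<dots> = s * real (\<Sum>d\<in>G. rep S d)" by (simp add: sum_distrib_left)
  also have "(\<Sum>d\<in>G. rep S d) = card {(a, b) \<in> S \<times> S. a + b \<in> G}"
    using S(1) HF by (intro sum_rep) (auto simp: G_def)
  finally have "\<alpha> / 16 * s ^ 2 \<le> real (card {(a, b) \<in> S \<times> S. a + b \<in> G})"
    using s by (simp add: power2_eq_square power3_eq_cube)
  also have "\<dots> \<le> real (card {(a, b) \<in> S \<times> S. sqrt \<alpha> / 2 * s \<le> real (card (N (a + b))) \<and>
      bad (a + b) \<le> 9 / 2048 * real (card (N (a + b))) ^ 2})"
    unfolding of_nat_le_iff
    by (rule card_mono) (auto simp: G_def H_def cN intro: finite_subset[OF _ finite_cartesian_product[OF finS finS]])
  finally show ?thesis by (simp add: s_def bad_def)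
qed

lemma many_good_centres:
  fixes \<delta> D :: real
  assumes S: "S \<subseteq> F2 n" "S \<noteq> {}" and Q: "Q \<subseteq> F2 n"
    and N_def: "\<And>a. N a = {x \<in> S. a + x \<in> Q}"
    and cod_def: "\<And>x z. cod x z = card {b \<in> S. b + x \<in> Q \<and> b + z \<in> Q}"
    and \<delta>: "\<delta> > 0" "\<delta> * real (card S) ^ 2 = real (card {(a, b) \<in> S \<times> S. a + b \<in> Q})"
    and D: "0 \<le> D" "D \<le> 8 / 5 * \<delta>"
  shows "\<delta> / 16 * real (card S) \<le> real (card {a \<in> S. \<delta> / 2 * real (card S) \<le> real (card (N a)) \<and>
      real (card {(x, z) \<in> N a \<times> N a. real (cod x z) < D ^ 2 / 3072 * real (card S)})
        \<le> 9 / 2048 * real (card (N a)) ^ 2})"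
proof -
  have finS: "finite S" by (rule finite_subset[OF S(1) finite_F2])
  define s where "s = real (card S)"
  have s: "s > 0" using finS S(2) by (simp add: s_def card_gt_0_iff)
  have NS: "N a \<subseteq> S" for a by (auto simp: N_def)
  define bad where "bad a = real (card {(x, z) \<in> N a \<times> N a. real (cod x z) < D ^ 2 / 3072 * s})" for a
  define L where "L = {a \<in> S. \<delta> / 2 * s \<le> real (card (N a))}"
  define G where "G = {a \<in> L. bad a \<le> 9 / 2048 * real (card (N a)) ^ 2}"
  have fin: "finite L" "finite G" using finS by (simp_all add: L_def G_def)
  have "{(a, b) \<in> S \<times> S. a + b \<in> Q} = (SIGMA a:S. N a)" by (auto simp: N_def)
  then have tot: "\<delta> * s ^ 2 = (\<Sum>a\<in>S. real (card (N a)))"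
    using \<delta>(2) finS by (simp add: s_def N_def card_SigmaI)
  have "(\<Sum>a\<in>S - L. real (card (N a))) \<le> (\<Sum>a\<in>S. \<delta> / 2 * s)"
    using s \<delta> finS by (intro order_trans[OF sum_mono sum_mono2]) (auto simp: L_def)
  also have "\<dots> = \<delta> / 2 * s ^ 2" by (simp add: s_def power2_eq_square)
  finally have small: "(\<Sum>a\<in>S - L. real (card (N a))) \<le> \<delta> / 2 * s ^ 2" .
  have "(\<Sum>a\<in>S. bad a) \<le> D ^ 2 / 3072 * s * s ^ 2"
    unfolding bad_def s_def
    by (rule sum_card_pairs) (use finS in \<open>auto simp: N_def cod_def intro: card_mono\<close>)
  \<comment> \<open>\<open>D\<close> stands for the measured density. Its possible excess over
    \<open>\<delta>\<close> gives \<open>(8 / 5) ^ 2 / 3072 = 1 / 1200\<close>.\<close>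
  also have "\<dots> \<le> (8 / 5 * \<delta>) ^ 2 / 3072 * s * s ^ 2"
    using D s by (intro mult_right_mono divide_right_mono power_mono) auto
  finally have bad: "(\<Sum>a\<in>S. bad a) \<le> \<delta> ^ 2 * s ^ 3 / 1200"
    by (simp add: power2_eq_square power3_eq_cube)
  have "(\<Sum>a\<in>L - G. real (card (N a))) \<le> (\<Sum>a\<in>L - G. 4096 / (9 * \<delta> * s) * bad a)"
  proof (rule sum_mono)
    fix a assume a: "a \<in> L - G"
    then have big: "\<delta> / 2 * s \<le> real (card (N a))" and b: "9 / 2048 * real (card (N a)) ^ 2 \<le> bad a"
      by (auto simp: L_def G_def)
    have "9 / 2048 * (real (card (N a)) * (\<delta> / 2 * s)) \<le> 9 / 2048 * real (card (N a)) ^ 2"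
      unfolding power2_eq_square using big by (intro mult_left_mono) auto
    then show "real (card (N a)) \<le> 4096 / (9 * \<delta> * s) * bad a"
      using b \<delta> s by (simp add: field_simps)
  qed
  also have "\<dots> \<le> (\<Sum>a\<in>S. 4096 / (9 * \<delta> * s) * bad a)"
    using finS \<delta> s by (intro sum_mono2) (auto simp: bad_def L_def)
  also have "\<dots> \<le> 4096 / (9 * \<delta> * s) * (\<delta> ^ 2 * s ^ 3 / 1200)"
    unfolding sum_distrib_left[symmetric] using bad \<delta> s by (intro mult_left_mono) auto
  also have "\<dots> = 4096 / 10800 * \<delta> * s ^ 2"
    using \<delta> s by (simp add: power2_eq_square power3_eq_cube)
  finally have lost: "(\<Sum>a\<in>L - G. real (card (N a))) \<le> 4096 / 10800 * \<delta> * s ^ 2" .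
  have "(\<Sum>a\<in>S. real (card (N a))) = (\<Sum>a\<in>S - L. real (card (N a))) + (\<Sum>a\<in>L. real (card (N a)))"
    by (rule sum.subset_diff) (use finS in \<open>auto simp: L_def\<close>)
  moreover have "(\<Sum>a\<in>L. real (card (N a))) = (\<Sum>a\<in>L - G. real (card (N a))) + (\<Sum>a\<in>G. real (card (N a)))"
    by (rule sum.subset_diff) (use fin in \<open>auto simp: G_def\<close>)
  moreover have "0 \<le> \<delta> * s ^ 2" using \<delta> by simp
  \<comment> \<open>Of the total weight, \<open>1 - 1 / 2 - 4096 / 10800\<close> is left, which
    exceeds \<open>1 / 16\<close>.\<close>
  ultimately have "\<delta> / 16 * s ^ 2 \<le> (\<Sum>a\<in>G. real (card (N a)))"
    using tot small lost by simp
  also have "\<dots> \<le> (\<Sum>a\<in>G. s)"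
    using NS finS by (intro sum_mono) (auto simp: s_def card_mono)
  also have "\<dots> = real (card G) * s" by simp
  finally have "\<delta> / 16 * s \<le> real (card G)" using s by (simp add: power2_eq_square)
  then show ?thesis by (simp add: G_def L_def bad_def s_def conj_assoc)
qed

text \<open>With all four summands in \<open>S\<close>, \<open>doubling_bound\<close> makes
  \<open>|Y + Y| * |N|\<close> at most of order \<open>|S| ^ 2 / \<alpha> ^ 2\<close>. Bounding
  \<open>|N|\<close> below by \<open>|Y|\<close>, and \<open>|S| ^ 2\<close> above by a multiple of
  \<open>|Y| ^ 2 / \<alpha>\<close>, gives the third power.\<close>

lemma high_doubling:
  fixes \<alpha> :: real
  assumes S: "S \<subseteq> F2 n" "S \<noteq> {}" and \<alpha>: "0 < \<alpha>" and YN: "Y \<subseteq> N" and NS: "N \<subseteq> S"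
    and size: "21 / 128 * sqrt \<alpha> * real (card S) \<le> real (card Y)"
    and path: "\<And>x y. x \<in> Y \<Longrightarrow> y \<in> Y \<Longrightarrow> real (card N) / 2 \<le> real (card {z \<in> N.
      \<alpha> / 2048 * real (card S) \<le> real (rep S (x + z)) \<and> \<alpha> / 2048 * real (card S) \<le> real (rep S (y + z))})"
  shows "real (card (Y + Y)) \<le> C_BSG_H * \<alpha> powi (-3) * real (card Y)"
proof -
  have finS: "finite S" by (rule finite_subset[OF S(1) finite_F2])
  define s y c where "s = real (card S)" and "y = real (card Y)" and "c = real (card (Y + Y))"
  have s: "s > 0" using finS S(2) by (simp add: s_def card_gt_0_iff)
  have size': "21 / 128 * sqrt \<alpha> * s \<le> y" using size by (simp add: s_def y_def)
  have "0 < 21 / 128 * sqrt \<alpha> * s" using \<alpha> s by simp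
  then have y: "y > 0" using size' by linarith
  have yN: "y \<le> real (card N)"
    using finite_subset[OF NS finS] YN by (simp add: y_def card_mono)
  have "c * (real (card N) / 2) * (\<alpha> / 2048 * s)\<^sup>2 \<le> s ^ 4"
    unfolding c_def s_def
    by (rule doubling_bound[where N = N and n = n]) (use S NS YN \<alpha> path in auto)
  moreover have "c * (y / 2) * (\<alpha> / 2048 * s)\<^sup>2 \<le> c * (real (card N) / 2) * (\<alpha> / 2048 * s)\<^sup>2"
    using yN by (intro mult_right_mono mult_left_mono) (auto simp: c_def)
  ultimately have "c * (y / 2) * (\<alpha> / 2048 * s)\<^sup>2 \<le> s ^ 4" by simp
  then have "(c * y * \<alpha>\<^sup>2 / 2 ^ 23) * s\<^sup>2 \<le> s\<^sup>2 * s\<^sup>2"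
    by (simp add: power2_eq_square power4_eq_xxxx mult_ac)
  then have 1: "c * y * \<alpha>\<^sup>2 / 2 ^ 23 \<le> s\<^sup>2"
    by (rule mult_right_le_imp_le) (use s in simp)
  have "(21 / 128 * sqrt \<alpha> * s)\<^sup>2 \<le> y\<^sup>2" using size' \<alpha> s by (intro power_mono) auto
  then have 2: "(21 / 128)\<^sup>2 * \<alpha> * s\<^sup>2 \<le> y\<^sup>2"
    by (simp only: power_mult_distrib real_sqrt_pow2[OF less_imp_le[OF \<alpha>]])
  have "(21 / 128)\<^sup>2 * \<alpha> * (c * y * \<alpha>\<^sup>2 / 2 ^ 23) \<le> y\<^sup>2"
    by (rule order_trans[OF mult_left_mono[OF 1] 2]) (use \<alpha> in simp)
  then have "(c * (21 / 128)\<^sup>2 * \<alpha> ^ 3 / 2 ^ 23) * y \<le> y * y"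
    by (simp add: power2_eq_square power3_eq_cube mult_ac)
  then have "c * (21 / 128)\<^sup>2 * \<alpha> ^ 3 / 2 ^ 23 \<le> y" using y by simp
  then have "c \<le> 2 ^ 37 / 441 * y / \<alpha> ^ 3"
    using \<alpha> by (simp add: field_simps power2_eq_square)
  \<comment> \<open>This is \<open>2 ^ 4 / 441 \<le> 1 / 9\<close>.\<close>
  also have "\<dots> \<le> 2 ^ 33 / 9 * y / \<alpha> ^ 3"
    using \<alpha> y by (intro divide_right_mono mult_right_mono) auto
  finally show ?thesis
    by (simp add: C_BSG_H_def c_def y_def power_int_minus field_simps)
qed

text \<open>Here the four summands lie in \<open>Q\<close>. Popularity makes \<open>|Q|\<close> at
  most of order \<open>D * |S| / t\<close>, so \<open>D ^ 4\<close> cancels and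
  \<open>|Y + Y| * |Y|\<close> is at most of order
  \<open>|S| ^ 2 / t ^ 4 = (D * |S|) ^ 2 / (D * t ^ 2) ^ 2\<close>. The numerator is of order at
  most \<open>|Y| ^ 2\<close> by \<open>size\<close>, and \<open>Dt\<close> bounds the denominator
  below by a multiple of \<open>\<alpha> ^ 4\<close>.\<close>

lemma low_doubling:
  fixes \<alpha> t D \<delta> :: real
  assumes S: "S \<subseteq> F2 n" "S \<noteq> {}" and Q: "Q \<subseteq> F2 n" and \<alpha>: "0 < \<alpha>" and YN: "Y \<subseteq> N" and NS: "N \<subseteq> S"
    and cod_def: "\<And>x z. cod x z = card {b \<in> S. b + x \<in> Q \<and> b + z \<in> Q}"
    and D: "0 < D" and t: "0 < t" and Dt: "3 / 5 * (\<alpha>\<^sup>2 / 1024) \<le> D * t\<^sup>2"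
    and \<delta>: "\<delta> * real (card S) ^ 2 = real (card {(a, b) \<in> S \<times> S. a + b \<in> Q})" "\<delta> \<le> 5 / 3 * D"
    and pop: "\<And>d. d \<in> Q \<Longrightarrow> 3 / 8 * t * real (card S) \<le> real (rep S d)"
    and size: "D / 10 * real (card S) \<le> real (card Y)"
    and path: "\<And>x y. x \<in> Y \<Longrightarrow> y \<in> Y \<Longrightarrow> real (card N) / 2 \<le> real (card {z \<in> N.
      D\<^sup>2 / 8192 * real (card S) \<le> real (cod x z) \<and> D\<^sup>2 / 8192 * real (card S) \<le> real (cod y z)})"
  shows "real (card (Y + Y)) \<le> C_BSG * \<alpha> powi (-4) * real (card Y)"
proof -
  have finS: "finite S" by (rule finite_subset[OF S(1) finite_F2])
  have finQ: "finite Q" by (rule finite_subset[OF Q finite_F2])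
  define s y c q where "s = real (card S)" and "y = real (card Y)" and "c = real (card (Y + Y))"
    and "q = real (card Q)"
  have s: "s > 0" using finS S(2) by (simp add: s_def card_gt_0_iff)
  have size': "D / 10 * s \<le> y" using size by (simp add: s_def y_def)
  have "0 < D / 10 * s" using D s by simp
  then have y: "y > 0" using size' by linarith
  have yN: "y \<le> real (card N)"
    using finite_subset[OF NS finS] YN by (simp add: y_def card_mono)
  \<comment> \<open>A common neighbour \<open>b\<close> writes \<open>x + z\<close> as
    \<open>(b + x) + (b + z)\<close> with both summands in \<open>Q\<close>.\<close>
  have cod_le: "cod x z \<le> rep Q (x + z)" if "x \<in> S" "z \<in> S" for x z
    unfolding cod_def rep_def
  proof (rule card_inj_on_le)
    have F: "x \<in> F2 n" "z \<in> F2 n" using S that by auto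
    show "inj_on (\<lambda>b. b + x) {b \<in> S. b + x \<in> Q \<and> b + z \<in> Q}"
    proof (rule inj_onI)
      fix b b' assume b: "b \<in> {b \<in> S. b + x \<in> Q \<and> b + z \<in> Q}" "b' \<in> {b \<in> S. b + x \<in> Q \<and> b + z \<in> Q}"
        and eq: "b + x = b' + x"
      have "b \<in> F2 n" "b' \<in> F2 n" using b S by auto
      then show "b = b'"
        using eq comm_add_vec[of b n x] comm_add_vec[of b' n x] F F2_add_left_cancel[of x n b b'] by simp
    qed
    show "finite {b \<in> Q. b + (x + z) \<in> Q}" using finQ by simp
    have "b + x + (x + z) = b + z" if "b \<in> S" for b
      using F2_sum_shift'[OF F(1) _ F(2), of b] that S by auto
    then show "(\<lambda>b. b + x) ` {b \<in> S. b + x \<in> Q \<and> b + z \<in> Q} \<subseteq> {b \<in> Q. b + (x + z) \<in> Q}" by auto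
  qed
  \<comment> \<open>Counting the pairs of \<open>S\<close> by their sum: each element of
    \<open>Q\<close> has many of them. With \<open>\<delta> \<le> 5 / 3 * D\<close> this yields the
    constant \<open>40 / 9 = (5 / 3) / (3 / 8)\<close> below.\<close>
  have "q * (3 / 8 * t * s) \<le> \<delta> * s ^ 2"
  proof -
    have "q * (3 / 8 * t * s) = (\<Sum>d\<in>Q. 3 / 8 * t * s)" by (simp add: q_def)
    also have "\<dots> \<le> (\<Sum>d\<in>Q. real (rep S d))" using pop by (intro sum_mono) (auto simp: s_def)
    also have "\<dots> = real (\<Sum>d\<in>Q. rep S d)" by simp
    also have "\<dots> = \<delta> * s ^ 2" unfolding sum_rep[OF S(1) Q] using \<delta>(1) by (simp add: s_def)
    finally show ?thesis .
  qed
  also have "\<dots> \<le> 5 / 3 * D * s ^ 2" using \<delta>(2) by (intro mult_right_mono) auto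
  finally have "(q * (3 / 8 * t)) * s \<le> (5 / 3 * D * s) * s" by (simp add: power2_eq_square)
  then have "q * (3 / 8 * t) \<le> 5 / 3 * D * s" using s by simp
  then have "q * t \<le> 40 / 9 * D * s" by simp
  then have "(q * t) ^ 4 \<le> (40 / 9 * D * s) ^ 4" using t by (intro power_mono) (auto simp: q_def)
  then have qt: "q ^ 4 * t ^ 4 \<le> (40 / 9) ^ 4 * D ^ 4 * s ^ 4" by (simp only: power_mult_distrib)
  have "c * (real (card N) / 2) * (D\<^sup>2 / 8192 * s)\<^sup>2 \<le> q ^ 4"
    unfolding c_def s_def q_def
  proof (rule doubling_bound[where N = N and n = n])
    fix x x' assume x: "x \<in> Y" "x' \<in> Y"
    let ?K = "D\<^sup>2 / 8192 * real (card S)"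
    have "real (card N) / 2 \<le> real (card {z \<in> N. ?K \<le> real (cod x z) \<and> ?K \<le> real (cod x' z)})"
      by (rule path[OF x])
    also have "\<dots> \<le> real (card {z \<in> N. ?K \<le> real (rep Q (x + z)) \<and> ?K \<le> real (rep Q (x' + z))})"
      unfolding of_nat_le_iff
    proof (rule card_mono)
      show "finite {z \<in> N. ?K \<le> real (rep Q (x + z)) \<and> ?K \<le> real (rep Q (x' + z))}"
        using finite_subset[OF NS finS] by simp
      have "real (cod x z) \<le> real (rep Q (x + z)) \<and> real (cod x' z) \<le> real (rep Q (x' + z))" if "z \<in> N" for z
        using cod_le[of x z] cod_le[of x' z] x that YN NS by auto
      then show "{z \<in> N. ?K \<le> real (cod x z) \<and> ?K \<le> real (cod x' z)}
          \<subseteq> {z \<in> N. ?K \<le> real (rep Q (x + z)) \<and> ?K \<le> real (rep Q (x' + z))}"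
        using order_trans by blast
    qed
    finally show "real (card N) / 2 \<le> real (card {z \<in> N. ?K \<le> real (rep Q (x + z)) \<and> ?K \<le> real (rep Q (x' + z))})" .
  qed (use S Q NS YN in auto)
  moreover have "c * (y / 2) * (D\<^sup>2 / 8192 * s)\<^sup>2 \<le> c * (real (card N) / 2) * (D\<^sup>2 / 8192 * s)\<^sup>2"
    using yN by (intro mult_right_mono mult_left_mono) (auto simp: c_def)
  ultimately have "c * (y / 2) * (D\<^sup>2 / 8192 * s)\<^sup>2 \<le> q ^ 4" by simp
  then have "c * y * D ^ 4 * s\<^sup>2 / 2 ^ 27 \<le> q ^ 4"
    by (simp add: power2_eq_square power4_eq_xxxx mult_ac)
  then have "c * y * D ^ 4 * s\<^sup>2 / 2 ^ 27 * t ^ 4 \<le> (40 / 9) ^ 4 * D ^ 4 * s ^ 4"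
    using qt t by (smt (verit) mult_right_mono zero_le_power)
  then have "(c * y * t ^ 4 / 2 ^ 27) * (D ^ 4 * s\<^sup>2) \<le> ((40 / 9) ^ 4 * s\<^sup>2) * (D ^ 4 * s\<^sup>2)"
    by (simp add: power2_eq_square power4_eq_xxxx mult_ac)
  then have 1: "c * y * t ^ 4 / 2 ^ 27 \<le> (40 / 9) ^ 4 * s\<^sup>2"
    by (rule mult_right_le_imp_le) (use D s in simp)
  have "(D / 10 * s)\<^sup>2 \<le> y\<^sup>2" using size' D s by (intro power_mono) auto
  then have 2: "D\<^sup>2 * s\<^sup>2 \<le> 100 * y\<^sup>2" by (simp add: power2_eq_square mult_ac)
  have "(3 / 5 * (\<alpha>\<^sup>2 / 1024))\<^sup>2 \<le> (D * t\<^sup>2)\<^sup>2" by (intro power_mono Dt) (use \<alpha> in simp)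
  then have 3: "9 / 25 * \<alpha> ^ 4 / 2 ^ 20 \<le> D\<^sup>2 * t ^ 4"
    by (simp add: power2_eq_square power4_eq_xxxx mult_ac)
  have c: "0 \<le> c * y / 2 ^ 27" using y by (simp add: c_def)
  have "c * y / 2 ^ 27 * (9 / 25 * \<alpha> ^ 4 / 2 ^ 20) \<le> c * y / 2 ^ 27 * (D\<^sup>2 * t ^ 4)"
    by (rule mult_left_mono[OF 3 c])
  also have "\<dots> = D\<^sup>2 * (c * y * t ^ 4 / 2 ^ 27)" by simp
  also have "\<dots> \<le> D\<^sup>2 * ((40 / 9) ^ 4 * s\<^sup>2)" by (rule mult_left_mono[OF 1]) simp
  also have "\<dots> \<le> (40 / 9) ^ 4 * (100 * y\<^sup>2)" using 2 by simp
  finally have "(c * (9 / 25 * \<alpha> ^ 4 / 2 ^ 47)) * y \<le> ((40 / 9) ^ 4 * 100 * y) * y"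
    by (simp add: power2_eq_square mult_ac)
  then have "c * (9 / 25 * \<alpha> ^ 4 / 2 ^ 47) \<le> (40 / 9) ^ 4 * 100 * y" using y by simp
  then have "c \<le> (40 / 9) ^ 4 * 100 * 25 / 9 * 2 ^ 47 * y / \<alpha> ^ 4"
    using \<alpha> by (simp add: field_simps)
  also have "\<dots> \<le> 2 ^ 69 / 9 * y / \<alpha> ^ 4"
    using \<alpha> y by (intro divide_right_mono mult_right_mono) (auto simp: power_divide)
  finally show ?thesis
    by (simp add: C_BSG_def c_def y_def power_int_minus field_simps)
qed

section \<open>Cleaning a base set\<close>

text \<open>The list and the number of a \<open>Centre\<close> describe its set of differences:
  \<open>d\<close> belongs to it if at least that many listed points \<open>s\<close> have
  \<open>s + d\<close> in \<open>S\<close>.\<close>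

datatype seed =
    Difference point
  | Centre point "point list" nat

text \<open>The number and the first list are the threshold and the sample for testing links; the
  second list consists of the sampled partners, already restricted to the base.\<close>

datatype cleaning = Cleaning seed nat "point list" "point list"

definition popular :: "point list \<Rightarrow> nat \<Rightarrow> point \<Rightarrow> bool dtree" where
  "popular ss \<tau> d = dmap (\<lambda>k. \<tau> \<le> k) (dcnt (\<lambda>s. Ask (s + d) Answer) ss)"

lemma dval_popular [simp]: "dval S (popular ss \<tau> d) \<longleftrightarrow> \<tau> \<le> cnt (\<lambda>s. s + d \<in> S) ss"
  by (simp add: popular_def)

lemma dcost_popular: "dcost S (popular ss \<tau> d) \<le> length ss"
  using dcost_dcnt[of ss S "\<lambda>s. Ask (s + d) Answer" 1] by (simp add: popular_def)

fun in_base :: "seed \<Rightarrow> point \<Rightarrow> bool dtree" where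
  "in_base (Difference d) x = dand (Ask x Answer) (Ask (x + d) Answer)"
| "in_base (Centre a ss \<tau>) x = dand (Ask x Answer) (popular ss \<tau> (a + x))"

text \<open>Among the points \<open>b\<close> of \<open>S\<close> the passing ones number
  \<open>rep S (x + z)\<close> for a difference; for a centre they are the common neighbours of
  \<open>x\<close> and \<open>z\<close> in the graph of accepted differences.\<close>

fun linked :: "seed \<Rightarrow> point \<Rightarrow> point \<Rightarrow> point \<Rightarrow> bool dtree" where
  "linked (Difference d) x z b = Ask (b + (x + z)) Answer"
| "linked (Centre a ss \<tau>) x z b = dand (popular ss \<tau> (b + x)) (popular ss \<tau> (b + z))"

definition well_linked :: "seed \<Rightarrow> nat \<Rightarrow> point list \<Rightarrow> point \<Rightarrow> point \<Rightarrow> bool dtree" where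
  "well_linked sd \<tau> bs x z = dmap (\<lambda>k. \<tau> \<le> k) (dcnt (linked sd x z) bs)"

text \<open>The ratio \<open>3 / 32\<close> is \<open>1 / 4\<close> times \<open>(3 / 5) / (8 / 5)\<close>: a point with at least a quarter of the base
  badly linked to it is rejected even if the counts err by these factors.\<close>

fun member :: "cleaning \<Rightarrow> point \<Rightarrow> bool dtree" where
  "member (Cleaning sd \<tau> bs zs) x = dand (in_base sd x)
     (dmap (\<lambda>k. 32 * k \<le> 3 * length zs) (dcnt (\<lambda>z. dmap Not (well_linked sd \<tau> bs x z)) zs))"

definition base_of :: "point set \<Rightarrow> seed \<Rightarrow> point set" where
  "base_of S sd = {x. dval S (in_base sd x)}"

definition cleaned :: "point set \<Rightarrow> cleaning \<Rightarrow> point set" where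
  "cleaned S r = {x. dval S (member r x)}"

definition links :: "point set \<Rightarrow> seed \<Rightarrow> point \<Rightarrow> point \<Rightarrow> nat" where
  "links S sd x z = card {b \<in> S. dval S (linked sd x z b)}"

lemma base_of_subset: "base_of S sd \<subseteq> S"
  by (cases sd) (auto simp: base_of_def)

lemma cleaned_subset: "cleaned S (Cleaning sd \<tau> bs zs) \<subseteq> base_of S sd"
  by (auto simp: cleaned_def base_of_def)

definition clean :: "nat \<Rightarrow> nat \<Rightarrow> seed \<Rightarrow> real \<Rightarrow> real \<Rightarrow> cleaning option ralg" where
  "clean m w sd \<kappa> \<theta> =
     rbind (replicate_alg m draw) (\<lambda>bs.
     rbind (replicate_alg w draw) (\<lambda>zs.
     rbind (of_dtree (dfilter (in_base sd) zs)) (\<lambda>zs'.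
     rbind (replicate_alg w draw) (\<lambda>vs.
     rbind (of_dtree (dcnt (member (Cleaning sd (nat \<lceil>8 / 5 * \<kappa> * real m\<rceil>) bs zs')) vs)) (\<lambda>k.
       Return (if 8 / 5 * \<theta> * real w \<le> real k
         then Some (Cleaning sd (nat \<lceil>8 / 5 * \<kappa> * real m\<rceil>) bs zs') else None))))))"

lemma prob_uniform:
  assumes "finite S" "S \<noteq> {}"
  shows "Pr (pmf_of_set S) {x. P x} = real (card {x \<in> S. P x}) / real (card S)"
  using assms by (simp add: measure_pmf_of_set Int_def)

text \<open>The path hypothesis of \<open>doubling_bound\<close>, with \<open>M\<close> half the
  size of the base and links in place of representations.\<close>

definition richly_linked :: "point set \<Rightarrow> seed \<Rightarrow> real \<Rightarrow> point set \<Rightarrow> bool" where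
  "richly_linked S sd \<kappa> Y \<longleftrightarrow> (\<forall>x\<in>Y. \<forall>y\<in>Y. real (card (base_of S sd)) / 2
     \<le> real (card {z \<in> base_of S sd. \<kappa> * real (card S) \<le> real (links S sd x z) \<and> \<kappa> * real (card S) \<le> real (links S sd y z)}))"

text \<open>Both conditions leave the margin \<open>8 / 3\<close> of the tests. The factor
  \<open>7 / 8\<close> is the share of light rows which \<open>card_light_rows\<close> derives from
  the bound on bad pairs.\<close>

definition good_seed :: "point set \<Rightarrow> seed \<Rightarrow> real \<Rightarrow> real \<Rightarrow> bool" where
  "good_seed S sd \<kappa> \<theta> \<longleftrightarrow>
     8 / 3 * \<theta> * real (card S) \<le> 7 / 8 * real (card (base_of S sd)) \<and>
     real (card {(x, z) \<in> base_of S sd \<times> base_of S sd. real (links S sd x z) < 8 / 3 * \<kappa> * real (card S)})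
       \<le> 9 / 2048 * real (card (base_of S sd)) ^ 2"

text \<open>Rejection is an error only for a good seed, so one error bound serves both soundness and
  completeness.\<close>

fun clean_ok :: "point set \<Rightarrow> seed \<Rightarrow> real \<Rightarrow> real \<Rightarrow> cleaning option \<Rightarrow> bool" where
  "clean_ok S sd \<kappa> \<theta> None \<longleftrightarrow> \<not> good_seed S sd \<kappa> \<theta>"
| "clean_ok S sd \<kappa> \<theta> (Some r) \<longleftrightarrow> \<theta> * real (card S) \<le> real (card (cleaned S r)) \<and> richly_linked S sd \<kappa> (cleaned S r)"

lemma cnt_filter: "cnt P (filter Q xs) = cnt (\<lambda>x. Q x \<and> P x) xs"
  by (simp add: cnt_def conj_commute)

lemma result_clean:
  "result S (clean m w sd \<kappa> \<theta>) =
     bind_pmf (replicate_pmf m (pmf_of_set S)) (\<lambda>bs.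
     bind_pmf (replicate_pmf w (pmf_of_set S)) (\<lambda>zs.
     bind_pmf (replicate_pmf w (pmf_of_set S)) (\<lambda>vs.
       let r = Cleaning sd (nat \<lceil>8 / 5 * \<kappa> * real m\<rceil>) bs (filter (\<lambda>z. z \<in> base_of S sd) zs)
       in return_pmf (if 8 / 5 * \<theta> * real w \<le> real (cnt (\<lambda>x. x \<in> cleaned S r) vs) then Some r else None))))"
  unfolding clean_def
  by (simp only: result_rbind result_of_dtree result_replicate_alg result_draw result_Return dval_dfilter
      dval_dcnt bind_return_pmf cleaned_def base_of_def mem_Collect_eq Let_def)

text \<open>The three rounds of sampling: \<open>bs\<close> decides up to a constant which pairs have many links, \<open>zs\<close>
  decides which points have few badly linked partners, and \<open>vs\<close> estimates the size of the result.
  When the base is too small for the second round to be reliable, the third one rejects.\<close>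

lemma clean_correct:
  assumes S: "finite S" "S \<noteq> {}" and \<kappa>: "0 < \<kappa>" and \<theta>: "0 < \<theta>"
    and e1: "2 * real (card S) ^ 2 * exp (- (\<kappa> * real m / 15)) \<le> \<epsilon>"
    and e2: "8 * real (card S) * exp (- (9 / 256 * \<theta> * real w / 15)) \<le> \<epsilon>"
  shows "Pr (result S (clean m w sd \<kappa> \<theta>)) {r. \<not> clean_ok S sd \<kappa> \<theta> r} \<le> 3 * \<epsilon>"
proof -
  let ?p = "pmf_of_set S"
  define N where "N = base_of S sd"
  define s where "s = real (card S)"
  define \<nu> where "\<nu> = real (card N) / s"
  define \<tau> where "\<tau> = nat \<lceil>8 / 5 * \<kappa> * real m\<rceil>"
  have s: "s \<ge> 1" using S by (simp add: s_def card_gt_0_iff Suc_leI)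
  have NS: "N \<subseteq> S" unfolding N_def by (rule base_of_subset)
  have finN: "finite N" by (rule finite_subset[OF NS S(1)])
  have p: "Pr ?p {x. P x} = real (card {x \<in> S. P x}) / s" for P
    unfolding s_def by (rule prob_uniform[OF S])
  have \<epsilon>0: "0 \<le> \<epsilon>" using e2 by (meson exp_ge_zero mult_nonneg_nonneg of_nat_0_le_iff order_trans zero_le_numeral)
  define bgood where "bgood bs \<longleftrightarrow> (\<forall>i\<in>S \<times> S.
      (Pr ?p {b. dval S (linked sd (fst i) (snd i) b)} \<le> \<kappa> \<longrightarrow>
         real (cnt (\<lambda>b. dval S (linked sd (fst i) (snd i) b)) bs) < 8 / 5 * \<kappa> * real m) \<and>
      (8 / 3 * \<kappa> \<le> Pr ?p {b. dval S (linked sd (fst i) (snd i) b)} \<longrightarrow>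
         8 / 5 * \<kappa> * real m < real (cnt (\<lambda>b. dval S (linked sd (fst i) (snd i) b)) bs)))" for bs
  have bprob: "Pr (replicate_pmf m ?p) {bs. \<not> bgood bs} \<le> \<epsilon>"
  proof -
    have "Pr (replicate_pmf m ?p) {bs. \<not> bgood bs}
        \<le> real (card (S \<times> S)) * (2 * exp (- (\<kappa> * real m / 15)))"
      unfolding bgood_def by (rule chernoff_uniform) (use S \<kappa> in auto)
    also have "\<dots> = 2 * real (card S) ^ 2 * exp (- (\<kappa> * real m / 15))"
      by (simp add: card_cartesian_product power2_eq_square)
    finally show ?thesis using e1 by linarith
  qed
  have link_p: "Pr ?p {b. dval S (linked sd x z b)} = real (links S sd x z) / s" for x z
    by (simp add: p links_def)
  have good_link: "dval S (well_linked sd \<tau> bs x z) \<Longrightarrow> \<kappa> * s \<le> real (links S sd x z)"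
    and link_good: "8 / 3 * \<kappa> * s \<le> real (links S sd x z) \<Longrightarrow> dval S (well_linked sd \<tau> bs x z)"
    if bs: "bgood bs" and xz: "x \<in> S" "z \<in> S" for bs x z
  proof -
    let ?c = "cnt (\<lambda>b. dval S (linked sd x z b)) bs"
    have wl: "dval S (well_linked sd \<tau> bs x z) \<longleftrightarrow> 8 / 5 * \<kappa> * real m \<le> real ?c"
      using \<kappa> by (simp add: well_linked_def \<tau>_def nat_le_iff ceiling_le_iff)
    have b: "real (links S sd x z) / s \<le> \<kappa> \<Longrightarrow> real ?c < 8 / 5 * \<kappa> * real m"
      "8 / 3 * \<kappa> \<le> real (links S sd x z) / s \<Longrightarrow> 8 / 5 * \<kappa> * real m < real ?c"
      using bs xz unfolding bgood_def by (force simp: link_p)+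
    show "\<kappa> * s \<le> real (links S sd x z)" if "dval S (well_linked sd \<tau> bs x z)"
    proof (rule ccontr)
      assume "\<not> ?thesis"
      then have "real (links S sd x z) / s \<le> \<kappa>" using s by (simp add: field_simps)
      then show False using b(1) that wl by linarith
    qed
    show "dval S (well_linked sd \<tau> bs x z)" if "8 / 3 * \<kappa> * s \<le> real (links S sd x z)"
    proof -
      have "8 / 3 * \<kappa> \<le> real (links S sd x z) / s" using that s by (simp add: field_simps)
      then show ?thesis using b(2) wl by linarith
    qed
  qed
  define rec where "rec bs zs = Cleaning sd \<tau> bs (filter (\<lambda>z. z \<in> N) zs)" for bs zs
  define Bad where "Bad bs x = {z \<in> N. \<not> dval S (well_linked sd \<tau> bs x z)}" for bs x
  have in_Y: "x \<in> cleaned S (rec bs zs) \<longleftrightarrow>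
      x \<in> N \<and> 32 * cnt (\<lambda>z. z \<in> Bad bs x) zs \<le> 3 * cnt (\<lambda>z. z \<in> N) zs" for bs zs x
    by (simp add: cleaned_def rec_def N_def[symmetric] cnt_filter Bad_def base_of_def[of S sd, symmetric])
       (simp add: base_of_def N_def cnt_def)
  have YN: "cleaned S (rec bs zs) \<subseteq> N" for bs zs
    unfolding rec_def N_def by (rule cleaned_subset)
  have finY: "finite (cleaned S (rec bs zs))" for bs zs by (rule finite_subset[OF YN finN])
  have SI: "{x \<in> S. x \<in> A} = A" if "A \<subseteq> N" for A using that NS by auto
  define out where "out bs zs vs =
    (if 8 / 5 * \<theta> * real w \<le> real (cnt (\<lambda>x. x \<in> cleaned S (rec bs zs)) vs) then Some (rec bs zs) else None)" for bs zs vs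
  define vgood where "vgood bs zs vs \<longleftrightarrow>
     (real (card (cleaned S (rec bs zs))) / s \<le> \<theta> \<longrightarrow> real (cnt (\<lambda>x. x \<in> cleaned S (rec bs zs)) vs) < 8 / 5 * \<theta> * real w) \<and>
     (8 / 3 * \<theta> \<le> real (card (cleaned S (rec bs zs))) / s \<longrightarrow> 8 / 5 * \<theta> * real w < real (cnt (\<lambda>x. x \<in> cleaned S (rec bs zs)) vs))" for bs zs vs
  have exp_mono: "exp (- (\<eta> * real w / 15)) \<le> exp (- (9 / 256 * \<theta> * real w / 15))" if "9 / 256 * \<theta> \<le> \<eta>" for \<eta>
    using mult_right_mono[OF that, of "real w"] by simp
  have vprob: "Pr (replicate_pmf w ?p) {vs. \<not> vgood bs zs vs} \<le> \<epsilon>" for bs zs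
  proof -
    have "Pr (replicate_pmf w ?p) {vs. \<not> vgood bs zs vs} \<le> real (card {()}) * (2 * exp (- (\<theta> * real w / 15)))"
      using chernoff_uniform[of "{()}" \<theta> w ?p "\<lambda>_ x. x \<in> cleaned S (rec bs zs)"] \<theta>
      unfolding vgood_def by (simp only: p SI[OF YN]) simp
    also have "\<dots> = 2 * exp (- (\<theta> * real w / 15))" by simp
    also have "\<dots> \<le> 8 * s * exp (- (9 / 256 * \<theta> * real w / 15))"
      using s exp_mono[of \<theta>] \<theta> by (intro mult_mono) auto
    finally show ?thesis using e2 by (simp add: s_def)
  qed
  \<comment> \<open>The bounds are \<open>3 / 20 = 3 / 5 * (1 / 4)\<close> and
    \<open>9 / 160 = 8 / 5 * (9 / 256)\<close>. Divided by the opposite bounds \<open>8 / 5\<close>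
    and \<open>3 / 5\<close> on the base count, both give the acceptance ratio
    \<open>3 / 32\<close>.\<close>
  define zgood where "zgood bs zs \<longleftrightarrow> \<nu> < \<theta> \<or>
     (3 / 5 * \<nu> * real w < real (cnt (\<lambda>z. z \<in> N) zs) \<and> real (cnt (\<lambda>z. z \<in> N) zs) < 8 / 5 * \<nu> * real w \<and>
     (\<forall>x\<in>N. (\<nu> / 4 \<le> real (card (Bad bs x)) / s \<longrightarrow> 3 / 20 * \<nu> * real w < real (cnt (\<lambda>z. z \<in> Bad bs x) zs)) \<and>
        (real (card (Bad bs x)) / s \<le> 9 / 256 * \<nu> \<longrightarrow> real (cnt (\<lambda>z. z \<in> Bad bs x) zs) < 9 / 160 * \<nu> * real w)))" for bs zs
  have BadN: "Bad bs x \<subseteq> N" for bs x by (auto simp: Bad_def)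
  have zprob: "Pr (replicate_pmf w ?p) {zs. \<not> zgood bs zs} \<le> \<epsilon>" for bs
  proof (cases "\<nu> < \<theta>")
    case False
    let ?q = "replicate_pmf w ?p"
    let ?e = "exp (- (9 / 256 * \<theta> * real w / 15))"
    define U where "U \<eta> = {zs. \<not> (\<forall>i\<in>{()}.
        (\<nu> \<le> \<eta> \<longrightarrow> real (cnt (\<lambda>z. z \<in> N) zs) < 8 / 5 * \<eta> * real w) \<and>
        (8 / 3 * \<eta> \<le> \<nu> \<longrightarrow> 8 / 5 * \<eta> * real w < real (cnt (\<lambda>z. z \<in> N) zs)))}" for \<eta>
    define V where "V \<eta> = {zs. \<not> (\<forall>x\<in>N.
        (real (card (Bad bs x)) / s \<le> \<eta> \<longrightarrow> real (cnt (\<lambda>z. z \<in> Bad bs x) zs) < 8 / 5 * \<eta> * real w) \<and>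
        (8 / 3 * \<eta> \<le> real (card (Bad bs x)) / s \<longrightarrow> 8 / 5 * \<eta> * real w < real (cnt (\<lambda>z. z \<in> Bad bs x) zs)))}" for \<eta>
    have U: "Pr ?q (U \<eta>) \<le> 2 * s * ?e" if "9 / 256 * \<theta> \<le> \<eta>" for \<eta>
    proof -
      have "Pr ?q (U \<eta>) \<le> real (card {()}) * (2 * exp (- (\<eta> * real w / 15)))"
        using chernoff_uniform[of "{()}" \<eta> w ?p "\<lambda>_ x. x \<in> N"] that \<theta>
        unfolding U_def \<nu>_def by (simp only: p SI[OF subset_refl]) simp
      also have "\<dots> \<le> 2 * s * ?e" using exp_mono[OF that] s
        by (simp add: mult_mono order_trans[OF _ mult_right_mono[of 1 s ?e]])
      finally show ?thesis .
    qed
    have V: "Pr ?q (V \<eta>) \<le> 2 * s * ?e" if "9 / 256 * \<theta> \<le> \<eta>" for \<eta>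
    proof -
      have "Pr ?q (V \<eta>) \<le> real (card N) * (2 * exp (- (\<eta> * real w / 15)))"
        using chernoff_uniform[of N \<eta> w ?p "\<lambda>x z. z \<in> Bad bs x"] that \<theta> finN
        unfolding V_def by (simp only: p SI[OF BadN])
      also have "\<dots> \<le> s * (2 * ?e)"
        using exp_mono[OF that] NS S by (intro mult_mono) (auto simp: s_def card_mono)
      finally show ?thesis by simp
    qed
    have \<nu>: "\<theta> \<le> \<nu>" using False by simp
    \<comment> \<open>A lower bound on the count of an event of probability \<open>\<eta>\<close> is
      read off at \<open>3 / 8 * \<eta>\<close>; hence \<open>3 / 8 * \<nu>\<close> for the base and
      \<open>3 / 32 * \<nu>\<close> for a quarter of it.\<close>
    have "{zs. \<not> zgood bs zs} \<subseteq> (U \<nu> \<union> U (3 / 8 * \<nu>)) \<union> (V (3 / 32 * \<nu>) \<union> V (9 / 256 * \<nu>))"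
    proof
      fix zs assume zs: "zs \<in> {zs. \<not> zgood bs zs}"
      show "zs \<in> (U \<nu> \<union> U (3 / 8 * \<nu>)) \<union> (V (3 / 32 * \<nu>) \<union> V (9 / 256 * \<nu>))"
      proof (rule ccontr)
        assume "\<not> ?thesis"
        then have n: "zs \<notin> U \<nu>" "zs \<notin> U (3 / 8 * \<nu>)" "zs \<notin> V (3 / 32 * \<nu>)" "zs \<notin> V (9 / 256 * \<nu>)" by auto
        have "real (cnt (\<lambda>z. z \<in> N) zs) < 8 / 5 * \<nu> * real w" using n(1) by (simp add: U_def)
        moreover have "3 / 5 * \<nu> * real w < real (cnt (\<lambda>z. z \<in> N) zs)" using n(2) by (simp add: U_def)
        moreover have "3 / 20 * \<nu> * real w < real (cnt (\<lambda>z. z \<in> Bad bs x) zs)"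
          if "x \<in> N" "\<nu> / 4 \<le> real (card (Bad bs x)) / s" for x
          using n(3) that by (auto simp: V_def)
        moreover have "real (cnt (\<lambda>z. z \<in> Bad bs x) zs) < 9 / 160 * \<nu> * real w"
          if "x \<in> N" "real (card (Bad bs x)) / s \<le> 9 / 256 * \<nu>" for x
          using n(4) that by (auto simp: V_def)
        ultimately show False using zs by (auto simp: zgood_def)
      qed
    qed
    then have "Pr ?q {zs. \<not> zgood bs zs}
        \<le> Pr ?q ((U \<nu> \<union> U (3 / 8 * \<nu>)) \<union> (V (3 / 32 * \<nu>) \<union> V (9 / 256 * \<nu>)))"
      by (intro measure_pmf.finite_measure_mono) auto
    also have "\<dots> \<le> (Pr ?q (U \<nu>) + Pr ?q (U (3 / 8 * \<nu>)))
        + (Pr ?q (V (3 / 32 * \<nu>)) + Pr ?q (V (9 / 256 * \<nu>)))"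
      by (intro order_trans[OF measure_Un_le] add_mono) (auto intro: measure_Un_le)
    also have "\<dots> \<le> (2 * s * ?e + 2 * s * ?e) + (2 * s * ?e + 2 * s * ?e)"
      using \<nu> \<theta> by (intro add_mono U V) auto
    finally show ?thesis using e2 by (simp add: s_def)
  qed (use \<epsilon>0 in \<open>simp add: zgood_def\<close>)
  have ok: "clean_ok S sd \<kappa> \<theta> (out bs zs vs)" if b: "bgood bs" and z: "zgood bs zs" and v: "vgood bs zs vs" for bs zs vs
  proof -
    let ?Y = "cleaned S (rec bs zs)"
    let ?W = "real (cnt (\<lambda>z. z \<in> N) zs)"
    have "real (card ?Y) \<le> real (card N)" by (simp add: card_mono[OF finN YN])
    then have Y\<nu>: "real (card ?Y) / s \<le> \<nu>" unfolding \<nu>_def using s by (intro divide_right_mono) auto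
    have cN: "real (card N) = \<nu> * s" using s by (simp add: \<nu>_def)
    show ?thesis
    proof (cases "8 / 5 * \<theta> * real w \<le> real (cnt (\<lambda>x. x \<in> ?Y) vs)")
      case True
      then have big: "\<theta> < real (card ?Y) / s" using v by (auto simp: vgood_def)
      then have "\<not> \<nu> < \<theta>" using Y\<nu> by linarith
      then have zg: "?W < 8 / 5 * \<nu> * real w"
        "\<And>x. x \<in> N \<Longrightarrow> \<nu> / 4 \<le> real (card (Bad bs x)) / s \<Longrightarrow> 3 / 20 * \<nu> * real w < real (cnt (\<lambda>z. z \<in> Bad bs x) zs)"
        using z by (auto simp: zgood_def)
      have few: "real (card (Bad bs x)) \<le> real (card N) / 4" if x: "x \<in> ?Y" for x
      proof -
        have "x \<in> N" "real (32 * cnt (\<lambda>z. z \<in> Bad bs x) zs) \<le> real (3 * cnt (\<lambda>z. z \<in> N) zs)"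
          using x unfolding in_Y of_nat_le_iff by auto
        then have "\<not> \<nu> / 4 \<le> real (card (Bad bs x)) / s" using zg by fastforce
        then show ?thesis using s cN by (simp add: field_simps)
      qed
      have "richly_linked S sd \<kappa> ?Y"
        unfolding richly_linked_def N_def[symmetric] s_def[symmetric]
      proof (intro ballI)
        fix x y assume xy: "x \<in> ?Y" "y \<in> ?Y"
        have "x \<in> S" "y \<in> S" using xy YN NS by blast+
        \<comment> \<open>Each of \<open>x\<close> and \<open>y\<close> excludes at most a quarter
          of the base, so half of it connects them.\<close>
        then have "N - (Bad bs x \<union> Bad bs y) \<subseteq> {z \<in> N. \<kappa> * s \<le> real (links S sd x z) \<and> \<kappa> * s \<le> real (links S sd y z)}"
          using NS by (auto simp: Bad_def intro!: good_link[OF b])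
        then have "card (N - (Bad bs x \<union> Bad bs y))
            \<le> card {z \<in> N. \<kappa> * s \<le> real (links S sd x z) \<and> \<kappa> * s \<le> real (links S sd y z)}"
          using finN by (intro card_mono) auto
        moreover have "card N \<le> card (N - (Bad bs x \<union> Bad bs y)) + card (Bad bs x \<union> Bad bs y)"
          using BadN finN by (subst card_Diff_subset) (auto intro: finite_subset)
        moreover have "card (Bad bs x \<union> Bad bs y) \<le> card (Bad bs x) + card (Bad bs y)" by (rule card_Un_le)
        ultimately show "real (card N) / 2
            \<le> real (card {z \<in> N. \<kappa> * s \<le> real (links S sd x z) \<and> \<kappa> * s \<le> real (links S sd y z)})"
          using few[OF xy(1)] few[OF xy(2)] by linarith
      qed
      moreover have "\<theta> * s \<le> real (card ?Y)" using big s by (simp add: field_simps)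
      ultimately show ?thesis using True by (simp add: out_def s_def)
    next
      case False
      have "\<not> good_seed S sd \<kappa> \<theta>"
      proof
        assume g: "good_seed S sd \<kappa> \<theta>"
        then have g1: "8 / 3 * \<theta> * s \<le> 7 / 8 * real (card N)"
          and g2: "real (card {(x, z) \<in> N \<times> N. real (links S sd x z) < 8 / 3 * \<kappa> * s}) \<le> 9 / 2048 * real (card N) ^ 2"
          by (auto simp: good_seed_def s_def N_def)
        have "8 / 3 * \<theta> \<le> 7 / 8 * \<nu>" using g1 s by (simp add: cN field_simps)
        then have "\<not> \<nu> < \<theta>" using \<theta> by linarith
        then have zg: "3 / 5 * \<nu> * real w < ?W"
          "\<And>x. x \<in> N \<Longrightarrow> real (card (Bad bs x)) / s \<le> 9 / 256 * \<nu> \<Longrightarrow> real (cnt (\<lambda>z. z \<in> Bad bs x) zs) < 9 / 160 * \<nu> * real w"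
          using z by (auto simp: zgood_def)
        let ?L = "{x \<in> N. real (card {z \<in> N. real (links S sd x z) < 8 / 3 * \<kappa> * s}) \<le> 9 / 256 * real (card N)}"
        have "7 / 8 * real (card N) \<le> real (card ?L)" by (rule card_light_rows[OF finN g2])
        \<comment> \<open>Points with few weakly linked partners pass the test, so at least
          \<open>7 / 8\<close> of the base survives.\<close>
        also have "?L \<subseteq> ?Y"
        proof
          fix x assume x: "x \<in> ?L"
          have "Bad bs x \<subseteq> {z \<in> N. real (links S sd x z) < 8 / 3 * \<kappa> * s}"
            using link_good[OF b] x NS by (fastforce simp: Bad_def not_le[symmetric])
          then have "real (card (Bad bs x)) \<le> real (card {z \<in> N. real (links S sd x z) < 8 / 3 * \<kappa> * s})"
            using finN by (simp add: card_mono)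
          also have "\<dots> \<le> 9 / 256 * (\<nu> * s)" using x by (simp add: cN)
          finally have "real (card (Bad bs x)) / s \<le> 9 / 256 * \<nu>" using s by (simp add: field_simps)
          then have "real (cnt (\<lambda>z. z \<in> Bad bs x) zs) < 9 / 160 * \<nu> * real w" using zg(2) x by blast
          then have "real (32 * cnt (\<lambda>z. z \<in> Bad bs x) zs) \<le> real (3 * cnt (\<lambda>z. z \<in> N) zs)"
            using zg(1) by simp
          then show "x \<in> ?Y" unfolding in_Y of_nat_le_iff using x by blast
        qed
        then have "real (card ?L) \<le> real (card ?Y)" by (simp add: card_mono[OF finY])
        finally have "8 / 3 * \<theta> * s \<le> real (card ?Y)" using g1 by linarith
        then have "8 / 3 * \<theta> \<le> real (card ?Y) / s" using s by (simp add: field_simps)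
        then show False using v False by (auto simp: vgood_def)
      qed
      then show ?thesis using False by (simp add: out_def)
    qed
  qed
  have res: "result S (clean m w sd \<kappa> \<theta>) = bind_pmf (replicate_pmf m ?p) (\<lambda>bs.
     bind_pmf (replicate_pmf w ?p) (\<lambda>zs. bind_pmf (replicate_pmf w ?p) (\<lambda>vs. return_pmf (out bs zs vs))))"
    unfolding result_clean out_def rec_def \<tau>_def N_def Let_def ..
  have "Pr (result S (clean m w sd \<kappa> \<theta>)) {r. \<not> clean_ok S sd \<kappa> \<theta> r} \<le> \<epsilon> + (\<epsilon> + (\<epsilon> + 0))"
    unfolding res
  proof (rule prob_bind_le'[OF _ _ bprob])
    fix bs assume b: "bs \<notin> {bs. \<not> bgood bs}"
    show "Pr (bind_pmf (replicate_pmf w ?p) (\<lambda>zs. bind_pmf (replicate_pmf w ?p)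
        (\<lambda>vs. return_pmf (out bs zs vs)))) {r. \<not> clean_ok S sd \<kappa> \<theta> r} \<le> \<epsilon> + (\<epsilon> + 0)"
    proof (rule prob_bind_le'[OF _ _ zprob])
      fix zs assume z: "zs \<notin> {zs. \<not> zgood bs zs}"
      show "Pr (bind_pmf (replicate_pmf w ?p)
        (\<lambda>vs. return_pmf (out bs zs vs))) {r. \<not> clean_ok S sd \<kappa> \<theta> r} \<le> \<epsilon> + 0"
      proof (rule prob_bind_le'[OF _ _ vprob])
        fix vs assume "vs \<notin> {vs. \<not> vgood bs zs vs}"
        then show "Pr (return_pmf (out bs zs vs)) {r. \<not> clean_ok S sd \<kappa> \<theta> r} \<le> 0"
          using ok b z by simp
      qed simp
    qed (use \<epsilon>0 in simp)
  qed (use \<epsilon>0 in simp)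
  then show ?thesis by simp
qed

section \<open>Trials\<close>

lemma prob_mono_support:
  assumes "\<And>x. x \<in> set_pmf p \<Longrightarrow> x \<in> A \<Longrightarrow> x \<in> B"
  shows "Pr p A \<le> Pr p B"
  by (rule measure_pmf.finite_measure_mono_AE) (use assms in \<open>auto simp: AE_measure_pmf_iff\<close>)

lemma pair_uniform:
  assumes "finite S" "S \<noteq> {}"
  shows "uniform_pair S = pmf_of_set (S \<times> S)"
proof (rule pmf_eqI)
  fix p
  show "pmf (uniform_pair S) p = pmf (pmf_of_set (S \<times> S)) p"
    using assms by (cases p) (auto simp: pmf_pair pmf_of_set card_cartesian_product indicator_def)
qed

lemma set_clean:
  assumes "finite S" "S \<noteq> {}" "Some r \<in> set_pmf (result S (clean m w sd \<kappa> \<theta>))"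
  obtains bs zs where "r = Cleaning sd (nat \<lceil>8 / 5 * \<kappa> * real m\<rceil>) bs zs" "length bs = m" "length zs \<le> w"
    "set bs \<subseteq> S" "set zs \<subseteq> S"
proof -
  from assms(3) obtain bs zs where b: "bs \<in> set_pmf (replicate_pmf m (pmf_of_set S))"
    "zs \<in> set_pmf (replicate_pmf w (pmf_of_set S))"
    "r = Cleaning sd (nat \<lceil>8 / 5 * \<kappa> * real m\<rceil>) bs (filter (\<lambda>z. z \<in> base_of S sd) zs)"
    unfolding result_clean Let_def by (auto split: if_splits)
  show thesis
  proof (rule that[OF b(3)])
    show "length bs = m" "set bs \<subseteq> S" using b(1) assms(1,2) by (auto simp: set_replicate_pmf)
    have zs: "length zs = w" "set zs \<subseteq> S" using b(2) assms(1,2) by (auto simp: set_replicate_pmf)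
    show "length (filter (\<lambda>z. z \<in> base_of S sd) zs) \<le> w" using zs(1) length_filter_le by metis
    show "set (filter (\<lambda>z. z \<in> base_of S sd) zs) \<subseteq> S" using zs(2) by auto
  qed
qed

section \<open>Query costs of cleaning\<close>

fun seed_cost :: "seed \<Rightarrow> nat" where
  "seed_cost (Difference d) = 2"
| "seed_cost (Centre a ss \<tau>) = 1 + 2 * length ss"

lemma dcost_in_base: "dcost S (in_base sd x) \<le> seed_cost sd"
proof (cases sd)
  case (Difference d)
  then show ?thesis using dcost_dand[of S "Ask x Answer" "Ask (x + d) Answer"] by simp
next
  case (Centre a ss \<tau>)
  then show ?thesis
    using dcost_dand[of S "Ask x Answer" "popular ss \<tau> (a + x)"] dcost_popular[of S ss \<tau> "a + x"] by simp
qed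

lemma dcost_linked: "dcost S (linked sd x z b) \<le> seed_cost sd"
proof (cases sd)
  case (Centre a ss \<tau>)
  then show ?thesis
    using dcost_dand[of S "popular ss \<tau> (b + x)" "popular ss \<tau> (b + z)"]
      dcost_popular[of S ss \<tau> "b + x"] dcost_popular[of S ss \<tau> "b + z"] by simp
qed simp

lemma dcost_member:
  "dcost S (member (Cleaning sd \<tau> bs zs) x) \<le> seed_cost sd + length zs * (length bs * seed_cost sd)"
proof -
  have "dcost S (well_linked sd \<tau> bs x z) \<le> length bs * seed_cost sd" for z
    unfolding well_linked_def dcost_dmap by (rule dcost_dcnt) (rule dcost_linked)
  then have "dcost S (dcnt (\<lambda>z. dmap Not (well_linked sd \<tau> bs x z)) zs) \<le> length zs * (length bs * seed_cost sd)"
    by (intro dcost_dcnt) simp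
  then show ?thesis
    unfolding member.simps using dcost_in_base[of S sd x] by (intro order_trans[OF dcost_dand] add_mono) auto
qed

lemma cost_le_clean:
  assumes "finite S" "S \<noteq> {}"
  shows "cost_le S (clean m w sd \<kappa> \<theta>) (m + 2 * w)
    (w * seed_cost sd + w * (seed_cost sd + w * (m * seed_cost sd)))"
proof -
  let ?c = "seed_cost sd"
  have draw: "cost_le S (replicate_alg k draw) k 0" for k
    using cost_le_replicate_alg[OF cost_le_draw, of S k] by simp
  have len: "length xs = k" if "xs \<in> set_pmf (result S (replicate_alg k draw))" for xs k
    using that by (simp add: set_replicate_pmf)
  have "cost_le S (clean m w sd \<kappa> \<theta>) (m + (w + (0 + (w + (0 + 0)))))
    (0 + (0 + (w * ?c + (0 + (w * (?c + w * (m * ?c)) + 0)))))"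
    unfolding clean_def
  proof (intro cost_le_rbind draw cost_le_Return cost_le_of_dtree)
    fix bs zs
    assume zs: "zs \<in> set_pmf (result S (replicate_alg w draw))"
    show "dcost S (dfilter (in_base sd) zs) \<le> w * ?c"
      using dcost_dfilter[of zs S "in_base sd" ?c] dcost_in_base len[OF zs] by simp
  next
    fix bs zs zs' vs
    assume bs: "bs \<in> set_pmf (result S (replicate_alg m draw))"
      and zs: "zs \<in> set_pmf (result S (replicate_alg w draw))"
      and zs': "zs' \<in> set_pmf (result S (of_dtree (dfilter (in_base sd) zs)))"
      and vs: "vs \<in> set_pmf (result S (replicate_alg w draw))"
    have "length zs' \<le> w" using zs' len[OF zs] length_filter_le by (metis result_of_dtree dval_dfilter set_return_pmf singletonD)
    then have "dcost S (member (Cleaning sd (nat \<lceil>8 / 5 * \<kappa> * real m\<rceil>) bs zs') x) \<le> ?c + w * (m * ?c)" for x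
      using len[OF bs] by (intro order_trans[OF dcost_member] add_mono mult_mono) auto
    then show "dcost S (dcnt (member (Cleaning sd (nat \<lceil>8 / 5 * \<kappa> * real m\<rceil>) bs zs')) vs) \<le> w * (?c + w * (m * ?c))"
      using dcost_dcnt[of vs S] len[OF vs] by blast
  qed
  then show ?thesis by (simp add: mult_2)
qed

definition bsg_ok :: "point set \<Rightarrow> real \<Rightarrow> cleaning \<Rightarrow> bool" where
  "bsg_ok S \<alpha> r \<longleftrightarrow>
     c_BSG * sqrt \<alpha> * real (card S) \<le> real (card (cleaned S r)) \<and>
     real (card (cleaned S r + cleaned S r)) \<le> C_BSG * \<alpha> powi (-4) * real (card (cleaned S r)) \<and>
     ((\<exists>d \<tau> bs zs. r = Cleaning (Difference d) \<tau> bs zs) \<longrightarrow>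
        real (card (cleaned S r + cleaned S r)) \<le> C_BSG_H * \<alpha> powi (-3) * real (card (cleaned S r)))"

text \<open>\<open>\<alpha> / 2048\<close> is \<open>3 / 8\<close> of the link level
  \<open>\<alpha> / 768\<close> of \<open>many_good_differences\<close>, and \<open>21 / 128\<close>
  is \<open>3 / 8 * 7 / 8\<close> of its fibre size \<open>1 / 2\<close>.\<close>

definition high_trial :: "nat \<Rightarrow> nat \<Rightarrow> real \<Rightarrow> cleaning option ralg" where
  "high_trial m w \<alpha> = rbind draw_pair (\<lambda>(a, b).
     clean m w (Difference (a + b)) (\<alpha> / 2048) (21 / 128 * sqrt \<alpha>))"

text \<open>The threshold of \<open>chernoff_uniform\<close> at \<open>3 / 8 * t\<close>: popularity
  at least \<open>t\<close> is meant to pass, popularity at most \<open>3 / 8 * t\<close> to be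
  rejected.\<close>

definition pop_threshold :: "nat \<Rightarrow> real \<Rightarrow> nat" where
  "pop_threshold m t = nat \<lceil>3 / 5 * t * real m\<rceil>"

text \<open>The true density is unknown, so the thresholds are set from the measured
  \<open>D\<close>. The two tests on \<open>D\<close> are the bounds of
  \<open>energy_dichotomy\<close> weakened by \<open>3 / 5\<close>. In the size threshold,
  \<open>21 / 128 * sqrt \<alpha>\<close> is the size to be guaranteed, and \<open>D / 10\<close> is
  what \<open>low_doubling\<close> requires.\<close>

definition low_trial :: "nat \<Rightarrow> nat \<Rightarrow> real \<Rightarrow> real \<Rightarrow> cleaning option ralg" where
  "low_trial m w \<alpha> t =
     rbind (replicate_alg m draw) (\<lambda>ss.
     rbind (replicate_alg w draw_pair) (\<lambda>ps.
     rbind (of_dtree (dcnt (\<lambda>(a, b). popular ss (pop_threshold m t) (a + b)) ps)) (\<lambda>k.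
       let D = real k / real w in
       if 3 / 5 * sqrt \<alpha> \<le> D \<and> 3 / 5 * (\<alpha>\<^sup>2 / 1024) \<le> D * t\<^sup>2
       then rbind draw (\<lambda>a. clean m w (Centre a ss (pop_threshold m t)) (D\<^sup>2 / 8192)
          (max (21 / 128 * sqrt \<alpha>) (D / 10)))
       else Return None)))"

lemma high_bound_le:
  assumes "0 < \<alpha>" "\<alpha> < 1" "0 \<le> y"
  shows "C_BSG_H * \<alpha> powi (-3) * y \<le> C_BSG * \<alpha> powi (-4) * y"
proof -
  have "\<alpha> * (2 ^ 33 / 9) \<le> 1 * (2 ^ 69 / 9)" using assms by (intro mult_mono) auto
  then have "2 ^ 33 / 9 / \<alpha> ^ 3 \<le> 2 ^ 69 / 9 / \<alpha> ^ 4"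
    using assms by (simp add: field_simps power3_eq_cube power4_eq_xxxx)
  then have "C_BSG_H * \<alpha> powi (-3) \<le> C_BSG * \<alpha> powi (-4)"
    by (simp add: C_BSG_H_def C_BSG_def power_int_minus field_simps)
  then show ?thesis using assms(3) by (rule mult_right_mono)
qed

lemma links_Difference: "links S (Difference d) x z = rep S (x + z)"
  by (simp add: links_def rep_def)

lemma base_of_Difference: "base_of S (Difference d) = {x \<in> S. x + d \<in> S}"
  by (simp add: base_of_def)

lemma bsg_ok_Difference:
  assumes S: "S \<subseteq> F2 n" "S \<noteq> {}" and \<alpha>: "0 < \<alpha>" "\<alpha> < 1"
    and ok: "clean_ok S (Difference d) (\<alpha> / 2048) (21 / 128 * sqrt \<alpha>) (Some (Cleaning (Difference d) \<tau> bs zs))"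
  shows "bsg_ok S \<alpha> (Cleaning (Difference d) \<tau> bs zs)"
proof -
  let ?Y = "cleaned S (Cleaning (Difference d) \<tau> bs zs)"
  have "real (card (?Y + ?Y)) \<le> C_BSG_H * \<alpha> powi (-3) * real (card ?Y)"
  proof (rule high_doubling[OF S \<alpha>(1) cleaned_subset base_of_subset])
    show "21 / 128 * sqrt \<alpha> * real (card S) \<le> real (card ?Y)" using ok by simp
    fix x y assume "x \<in> ?Y" "y \<in> ?Y"
    then show "real (card (base_of S (Difference d))) / 2 \<le> real (card {z \<in> base_of S (Difference d).
        \<alpha> / 2048 * real (card S) \<le> real (rep S (x + z)) \<and> \<alpha> / 2048 * real (card S) \<le> real (rep S (y + z))})"
      using ok unfolding clean_ok.simps richly_linked_def links_Difference by blast
  qed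
  moreover have "C_BSG_H * \<alpha> powi (-3) * real (card ?Y) \<le> C_BSG * \<alpha> powi (-4) * real (card ?Y)"
    using \<alpha> by (intro high_bound_le) auto
  ultimately show ?thesis using ok by (auto simp: bsg_ok_def c_BSG_def)
qed

lemma prob_pair_uniform:
  assumes "finite S" "S \<noteq> {}"
  shows "Pr (uniform_pair S) {p. P p}
    = real (card {p \<in> S \<times> S. P p}) / real (card S) ^ 2"
  using assms unfolding pair_uniform[OF assms]
  by (subst prob_uniform) (auto simp: card_cartesian_product power2_eq_square)

text \<open>Here \<open>\<epsilon>\<close> bounds the failure probability of each round of sampling.\<close>

locale bsg =
  fixes n :: nat and S :: "point set" and \<alpha> \<epsilon> :: real and m w :: nat
  assumes S: "S \<subseteq> F2 n" "S \<noteq> {}" and \<alpha>: "0 < \<alpha>" "\<alpha> < 1"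
    and m_large: "2 * 4 ^ n * exp (- (\<alpha> / 32768 * real m / 15)) \<le> \<epsilon>"
    and w_large: "8 * 2 ^ n * exp (- (9 / 256 * (21 / 128 * sqrt \<alpha>) * real w / 15)) \<le> \<epsilon>"
    and w_pos: "0 < w"
begin

lemma fin: "finite S"
  by (rule finite_subset[OF S(1) finite_F2])

lemma card_S: "0 < real (card S)" "real (card S) \<le> 2 ^ n"
proof -
  show "0 < real (card S)" using fin S(2) by (simp add: card_gt_0_iff)
  have "card S \<le> 2 ^ n" using card_mono[OF finite_F2 S(1)] card_F2[of n] by linarith
  then show "real (card S) \<le> 2 ^ n" by (metis of_nat_le_iff of_nat_numeral of_nat_power)
qed

lemma \<epsilon>_nonneg: "0 \<le> \<epsilon>"
  by (rule order_trans[OF _ w_large]) simp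

text \<open>\<open>\<alpha> / 32768\<close> lies below all rates tested with \<open>m\<close>
  samples: \<open>\<alpha> / 2048\<close> and \<open>D ^ 2 / 8192\<close> for links, and
  \<open>3 / 8 * t\<close> for popularity.\<close>

lemma m_error:
  assumes "\<alpha> / 32768 \<le> \<kappa>" "0 \<le> c" "c \<le> 4 ^ n"
  shows "2 * c * exp (- (\<kappa> * real m / 15)) \<le> \<epsilon>"
proof -
  have "2 * c * exp (- (\<kappa> * real m / 15)) \<le> 2 * 4 ^ n * exp (- (\<alpha> / 32768 * real m / 15))"
    using assms mult_right_mono[OF assms(1), of "real m"] by (intro mult_mono) auto
  then show ?thesis using m_large by linarith
qed

text \<open>The rarest event estimated with \<open>w\<close> samples is a set of bad partners of
  relative size \<open>9 / 256\<close> in a base of density at least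
  \<open>\<theta>\<close>.\<close>

lemma w_error:
  assumes "21 / 128 * sqrt \<alpha> \<le> \<theta>" "0 \<le> c" "c \<le> 8 * 2 ^ n"
  shows "c * exp (- (9 / 256 * \<theta> * real w / 15)) \<le> \<epsilon>"
proof -
  have "c * exp (- (9 / 256 * \<theta> * real w / 15)) \<le> 8 * 2 ^ n * exp (- (9 / 256 * (21 / 128 * sqrt \<alpha>) * real w / 15))"
  proof (intro mult_mono)
    have "9 / 256 * (21 / 128 * sqrt \<alpha>) * real w / 15 \<le> 9 / 256 * \<theta> * real w / 15"
      by (intro divide_right_mono mult_right_mono mult_left_mono assms) auto
    then show "exp (- (9 / 256 * \<theta> * real w / 15)) \<le> exp (- (9 / 256 * (21 / 128 * sqrt \<alpha>) * real w / 15))"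
      by simp
  qed (use assms in auto)
  then show ?thesis using w_large by linarith
qed

lemma clean_error:
  assumes "\<alpha> / 32768 \<le> \<kappa>" "21 / 128 * sqrt \<alpha> \<le> \<theta>"
  shows "Pr (result S (clean m w sd \<kappa> \<theta>)) {r. \<not> clean_ok S sd \<kappa> \<theta> r} \<le> 3 * \<epsilon>"
proof (rule clean_correct[OF fin S(2)])
  have "0 < \<alpha> / 32768" "0 < 21 / 128 * sqrt \<alpha>" using \<alpha> by auto
  then show "0 < \<kappa>" "0 < \<theta>" using assms by linarith+
  have "(real (card S))\<^sup>2 \<le> (2 ^ n)\<^sup>2" using card_S by (intro power_mono) auto
  also have "\<dots> = (4 :: real) ^ n" by (simp add: power2_eq_square power_mult_distrib[symmetric])
  finally show "2 * real (card S) ^ 2 * exp (- (\<kappa> * real m / 15)) \<le> \<epsilon>"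
    by (intro m_error assms) auto
  show "8 * real (card S) * exp (- (9 / 256 * \<theta> * real w / 15)) \<le> \<epsilon>"
    using card_S by (intro w_error assms) auto
qed

lemma high_trial_sound:
  "Pr (result S (high_trial m w \<alpha>)) (Some ` {r. \<not> bsg_ok S \<alpha> r}) \<le> 3 * \<epsilon>"
proof -
  have "Pr (result S (high_trial m w \<alpha>)) (Some ` {r. \<not> bsg_ok S \<alpha> r}) \<le> 0 + 3 * \<epsilon>"
    unfolding high_trial_def result_rbind
  \<comment> \<open>Every sampled difference is acceptable for soundness; only cleaning can
    err.\<close>
  proof (rule prob_bind_le'[where B = "{}"])
    fix p assume "p \<in> set_pmf (result S draw_pair)"
    obtain a b where p: "p = (a, b)" by fastforce
    let ?A = "clean m w (Difference (a + b)) (\<alpha> / 2048) (21 / 128 * sqrt \<alpha>)"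
    have "Pr (result S ?A) (Some ` {r. \<not> bsg_ok S \<alpha> r})
      \<le> Pr (result S ?A) {r. \<not> clean_ok S (Difference (a + b)) (\<alpha> / 2048) (21 / 128 * sqrt \<alpha>) r}"
    proof (rule prob_mono_support)
      fix ro assume ro: "ro \<in> set_pmf (result S ?A)" "ro \<in> Some ` {r. \<not> bsg_ok S \<alpha> r}"
      then obtain r where r: "ro = Some r" "\<not> bsg_ok S \<alpha> r" by auto
      obtain bs zs where "r = Cleaning (Difference (a + b)) (nat \<lceil>8 / 5 * (\<alpha> / 2048) * real m\<rceil>) bs zs"
        using set_clean[OF fin S(2)] ro(1) r(1) by metis
      then show "ro \<in> {r. \<not> clean_ok S (Difference (a + b)) (\<alpha> / 2048) (21 / 128 * sqrt \<alpha>) r}"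
        using r bsg_ok_Difference[OF S \<alpha>] by blast
    qed
    also have "\<dots> \<le> 3 * \<epsilon>" using \<alpha> by (intro clean_error) auto
    finally show "Pr (result S (case p of (a, b) \<Rightarrow>
        clean m w (Difference (a + b)) (\<alpha> / 2048) (21 / 128 * sqrt \<alpha>))) (Some ` {r. \<not> bsg_ok S \<alpha> r}) \<le> 3 * \<epsilon>"
      by (simp add: p)
  qed (use \<epsilon>_nonneg in auto)
  then show ?thesis by simp
qed

lemma high_trial_complete:
  assumes H: "3 / 8 * \<alpha> * real (card S) ^ 3
        \<le> (\<Sum>d\<in>{d \<in> F2 n. sqrt \<alpha> / 2 * real (card S) \<le> real (rep S d)}. real (rep S d) ^ 2)"
  shows "Pr (result S (high_trial m w \<alpha>)) {None} \<le> (1 - \<alpha> / 16) + 3 * \<epsilon>"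
  unfolding high_trial_def result_rbind
proof (rule prob_bind_le')
  let ?good = "\<lambda>p. good_seed S (Difference (fst p + snd p)) (\<alpha> / 2048) (21 / 128 * sqrt \<alpha>)"
  let ?q = "uniform_pair S"
  have "\<alpha> / 16 * real (card S) ^ 2 \<le> real (card {p \<in> S \<times> S. ?good p})"
  proof (rule order_trans[OF many_good_differences[OF S \<alpha>(1) _ H, of "\<lambda>d. base_of S (Difference d)"]])
    show "base_of S (Difference d) = {x \<in> S. x + d \<in> S}" for d by (rule base_of_Difference)
    show "real (card {(a, b) \<in> S \<times> S. sqrt \<alpha> / 2 * real (card S) \<le> real (card (base_of S (Difference (a + b)))) \<and>
        real (card {(x, z) \<in> base_of S (Difference (a + b)) \<times> base_of S (Difference (a + b)).
          real (rep S (x + z)) < \<alpha> / 768 * real (card S)})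
        \<le> 9 / 2048 * real (card (base_of S (Difference (a + b)))) ^ 2}) \<le> real (card {p \<in> S \<times> S. ?good p})"
      unfolding of_nat_le_iff
      by (rule card_mono) (use fin in \<open>auto simp: good_seed_def links_Difference\<close>)
  qed
  then have "\<alpha> / 16 \<le> Pr ?q {p. ?good p}"
    unfolding prob_pair_uniform[OF fin S(2)] using card_S by (simp add: field_simps)
  from prob_compl_le[OF this]
  show "Pr (result S draw_pair) (- {p. ?good p}) \<le> 1 - \<alpha> / 16" by simp
  fix p assume "p \<notin> - {p. ?good p}"
  then have good: "?good p" by simp
  let ?A = "clean m w (Difference (fst p + snd p)) (\<alpha> / 2048) (21 / 128 * sqrt \<alpha>)"
  have "Pr (result S ?A) {None}
    \<le> Pr (result S ?A) {r. \<not> clean_ok S (Difference (fst p + snd p)) (\<alpha> / 2048) (21 / 128 * sqrt \<alpha>) r}"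
    using good by (intro measure_pmf.finite_measure_mono) auto
  also have "\<dots> \<le> 3 * \<epsilon>" using \<alpha> by (intro clean_error) auto
  finally show "Pr (result S (case p of (a, b) \<Rightarrow>
        clean m w (Difference (a + b)) (\<alpha> / 2048) (21 / 128 * sqrt \<alpha>))) {None} \<le> 3 * \<epsilon>"
    by (simp add: case_prod_beta')
qed (use \<epsilon>_nonneg in simp)

end

section \<open>Trials of the low branch\<close>

context bsg
begin

definition pop_set :: "real \<Rightarrow> point list \<Rightarrow> point set" where
  "pop_set t ss = {d \<in> F2 n. pop_threshold m t \<le> cnt (\<lambda>s. s + d \<in> S) ss}"

definition pop_density :: "real \<Rightarrow> point list \<Rightarrow> real" where
  "pop_density t ss = real (card {(a, b) \<in> S \<times> S. a + b \<in> pop_set t ss}) / real (card S) ^ 2"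

definition pop_ok :: "real \<Rightarrow> point list \<Rightarrow> bool" where
  "pop_ok t ss \<longleftrightarrow> (\<forall>d\<in>F2 n. (d \<in> pop_set t ss \<longrightarrow> 3 / 8 * t * real (card S) \<le> real (rep S d)) \<and>
     (t * real (card S) \<le> real (rep S d) \<longrightarrow> d \<in> pop_set t ss))"

text \<open>Densities below \<open>sqrt \<alpha>\<close> are too small for two-sided estimation with
  \<open>w\<close> samples; \<open>density_le\<close> deals with them.\<close>

definition density_ok :: "real \<Rightarrow> point list \<Rightarrow> (point \<times> point) list \<Rightarrow> bool" where
  "density_ok t ss ps \<longleftrightarrow> (sqrt \<alpha> \<le> pop_density t ss \<longrightarrow>
     3 / 5 * pop_density t ss * real w < real (cnt (\<lambda>p. fst p + snd p \<in> pop_set t ss) ps) \<and>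
     real (cnt (\<lambda>p. fst p + snd p \<in> pop_set t ss) ps) < 8 / 5 * pop_density t ss * real w)"

abbreviation centre :: "real \<Rightarrow> point list \<Rightarrow> point \<Rightarrow> seed" where
  "centre t ss a \<equiv> Centre a ss (pop_threshold m t)"

lemma pop_set_F2: "pop_set t ss \<subseteq> F2 n"
  by (auto simp: pop_set_def)

lemma S_add: "a \<in> S \<Longrightarrow> b \<in> S \<Longrightarrow> a + b \<in> F2 n"
  by (rule add_carrier_vec; use S in blast)

lemma popular_iff:
  "a \<in> S \<Longrightarrow> b \<in> S \<Longrightarrow> dval S (popular ss (pop_threshold m t) (a + b)) \<longleftrightarrow> a + b \<in> pop_set t ss"
  using S_add by (simp add: pop_set_def)

lemma base_of_centre: "a \<in> S \<Longrightarrow> base_of S (centre t ss a) = {x \<in> S. a + x \<in> pop_set t ss}"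
  using S_add by (auto simp: base_of_def pop_set_def)

lemma links_centre:
  "x \<in> S \<Longrightarrow> z \<in> S \<Longrightarrow> links S (centre t ss a) x z = card {b \<in> S. b + x \<in> pop_set t ss \<and> b + z \<in> pop_set t ss}"
  unfolding links_def by (rule arg_cong[where f = card]) (use S_add in \<open>auto simp: pop_set_def\<close>)

lemma pop_density_eq: "pop_density t ss * real (card S) ^ 2 = real (card {(a, b) \<in> S \<times> S. a + b \<in> pop_set t ss})"
  using card_S by (simp add: pop_density_def)

lemma pop_ok_error:
  assumes t: "\<alpha> / 32 \<le> t"
  shows "Pr (replicate_pmf m (pmf_of_set S)) {ss. \<not> pop_ok t ss} \<le> \<epsilon>"
proof -
  let ?\<theta> = "3 / 8 * t"
  have t0: "0 < t" using t \<alpha> by linarith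
  have pr: "Pr (pmf_of_set S) {s. s + d \<in> S} = real (rep S d) / real (card S)" for d
    by (simp add: prob_uniform[OF fin S(2)] rep_def)
  have "Pr (replicate_pmf m (pmf_of_set S)) {ss. \<not> pop_ok t ss}
    \<le> Pr (replicate_pmf m (pmf_of_set S)) {ss. \<not> (\<forall>d\<in>F2 n.
      (Pr (pmf_of_set S) {s. s + d \<in> S} \<le> ?\<theta> \<longrightarrow> real (cnt (\<lambda>s. s + d \<in> S) ss) < 8 / 5 * ?\<theta> * real m) \<and>
      (8 / 3 * ?\<theta> \<le> Pr (pmf_of_set S) {s. s + d \<in> S} \<longrightarrow> 8 / 5 * ?\<theta> * real m < real (cnt (\<lambda>s. s + d \<in> S) ss)))}"
  proof (intro measure_pmf.finite_measure_mono subsetI)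
    fix ss assume ss: "ss \<in> {ss. \<not> pop_ok t ss}"
    have "pop_ok t ss" if *: "\<forall>d\<in>F2 n.
      (real (rep S d) / real (card S) \<le> ?\<theta> \<longrightarrow> real (cnt (\<lambda>s. s + d \<in> S) ss) < 8 / 5 * ?\<theta> * real m) \<and>
      (8 / 3 * ?\<theta> \<le> real (rep S d) / real (card S) \<longrightarrow> 8 / 5 * ?\<theta> * real m < real (cnt (\<lambda>s. s + d \<in> S) ss))"
      unfolding pop_ok_def
    proof (intro ballI conjI impI)
      fix d assume d: "d \<in> F2 n"
      have iff: "d \<in> pop_set t ss \<longleftrightarrow> 3 / 5 * t * real m \<le> real (cnt (\<lambda>s. s + d \<in> S) ss)"
        using d by (simp add: pop_set_def pop_threshold_def nat_le_iff ceiling_le_iff)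
      have a: "real (rep S d) / real (card S) \<le> ?\<theta> \<Longrightarrow> real (cnt (\<lambda>s. s + d \<in> S) ss) < 3 / 5 * t * real m"
        and b: "t \<le> real (rep S d) / real (card S) \<Longrightarrow> 3 / 5 * t * real m < real (cnt (\<lambda>s. s + d \<in> S) ss)"
        using bspec[OF * d] by auto
      show "3 / 8 * t * real (card S) \<le> real (rep S d)" if "d \<in> pop_set t ss"
      proof (rule ccontr)
        assume "\<not> ?thesis"
        then have "real (rep S d) / real (card S) \<le> ?\<theta>" using card_S by (simp add: field_simps)
        then show False using a that iff by linarith
      qed
      show "d \<in> pop_set t ss" if "t * real (card S) \<le> real (rep S d)"
      proof -
        have "t \<le> real (rep S d) / real (card S)" using that card_S by (simp add: field_simps)
        then show ?thesis using b iff by linarith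
      qed
    qed
    then show "ss \<in> {ss. \<not> (\<forall>d\<in>F2 n.
      (Pr (pmf_of_set S) {s. s + d \<in> S} \<le> ?\<theta> \<longrightarrow> real (cnt (\<lambda>s. s + d \<in> S) ss) < 8 / 5 * ?\<theta> * real m) \<and>
      (8 / 3 * ?\<theta> \<le> Pr (pmf_of_set S) {s. s + d \<in> S} \<longrightarrow> 8 / 5 * ?\<theta> * real m < real (cnt (\<lambda>s. s + d \<in> S) ss)))}"
      using ss unfolding pr by blast
  qed simp
  also have "\<dots> \<le> real (card (F2 n)) * (2 * exp (- (?\<theta> * real m / 15)))"
    by (rule chernoff_uniform) (use t0 in auto)
  also have "\<dots> = 2 * real (card (F2 n)) * exp (- (?\<theta> * real m / 15))" by simp
  also have "\<dots> \<le> \<epsilon>"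
  proof (rule m_error)
    have "real (card (F2 n)) \<le> 2 ^ n" using card_F2[of n] by (metis of_nat_le_iff of_nat_numeral of_nat_power)
    also have "\<dots> \<le> 4 ^ n" by (rule power_mono) auto
    finally show "real (card (F2 n)) \<le> 4 ^ n" .
  qed (use t \<alpha> in auto)
  finally show ?thesis .
qed

lemma density_ok_error:
  "Pr (replicate_pmf w (uniform_pair S)) {ps. \<not> density_ok t ss ps} \<le> \<epsilon>"
proof (cases "sqrt \<alpha> \<le> pop_density t ss")
  case True
  let ?q = "uniform_pair S"
  let ?P = "\<lambda>p. fst p + snd p \<in> pop_set t ss"
  define \<delta> where "\<delta> = pop_density t ss"
  have sq: "0 < sqrt \<alpha>" using \<alpha> by simp
  have \<delta>: "sqrt \<alpha> \<le> \<delta>" using True by (simp add: \<delta>_def)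
  have pr: "Pr ?q {p. ?P p} = \<delta>"
    unfolding prob_pair_uniform[OF fin S(2)] \<delta>_def pop_density_def
    by (intro arg_cong2[where f = "(/)"] arg_cong[where f = real] arg_cong[where f = card] refl) auto
  define U where "U \<eta> = {ps. \<not> (\<forall>i\<in>{()}. (\<delta> \<le> \<eta> \<longrightarrow> real (cnt ?P ps) < 8 / 5 * \<eta> * real w) \<and>
      (8 / 3 * \<eta> \<le> \<delta> \<longrightarrow> 8 / 5 * \<eta> * real w < real (cnt ?P ps)))}" for \<eta>
  let ?e = "exp (- (9 / 256 * (21 / 128 * sqrt \<alpha>) * real w / 15))"
  have U: "Pr (replicate_pmf w ?q) (U \<eta>) \<le> 2 * ?e" if "3 / 8 * \<delta> \<le> \<eta>" for \<eta>
  proof -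
    have \<eta>: "9 / 256 * (21 / 128 * sqrt \<alpha>) \<le> \<eta>" "0 \<le> \<eta>" using that \<delta> sq by linarith+
    have "Pr (replicate_pmf w ?q) (U \<eta>) \<le> real (card {()}) * (2 * exp (- (\<eta> * real w / 15)))"
      using chernoff_uniform[of "{()}" \<eta> w ?q "\<lambda>_. ?P"] \<eta>(2) unfolding U_def pr by simp
    also have "\<dots> \<le> 2 * ?e"
    proof -
      have "9 / 256 * (21 / 128 * sqrt \<alpha>) * real w / 15 \<le> \<eta> * real w / 15"
        by (intro divide_right_mono mult_right_mono \<eta>(1)) auto
      then show ?thesis by simp
    qed
    finally show ?thesis .
  qed
  have "{ps. \<not> density_ok t ss ps} \<subseteq> U \<delta> \<union> U (3 / 8 * \<delta>)"
    by (auto simp: density_ok_def U_def \<delta>_def)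
  then have "Pr (replicate_pmf w ?q) {ps. \<not> density_ok t ss ps}
      \<le> Pr (replicate_pmf w ?q) (U \<delta> \<union> U (3 / 8 * \<delta>))"
    by (intro measure_pmf.finite_measure_mono) auto
  also have "\<dots> \<le> Pr (replicate_pmf w ?q) (U \<delta>) + Pr (replicate_pmf w ?q) (U (3 / 8 * \<delta>))"
    by (rule measure_Un_le) auto
  also have "\<dots> \<le> 2 * ?e + 2 * ?e" by (intro add_mono U) (use \<delta> sq in linarith)+
  also have "\<dots> = 4 * ?e" by simp
  also have "\<dots> \<le> 8 * 2 ^ n * ?e"
  proof (rule mult_right_mono)
    have "(1 :: real) \<le> 2 ^ n" by simp
    then show "(4 :: real) \<le> 8 * 2 ^ n" by linarith
  qed simp
  finally show ?thesis using w_large by linarith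
qed (use \<epsilon>_nonneg in \<open>simp add: density_ok_def\<close>)

lemma bsg_ok_Centre:
  assumes t: "0 < t" and ss: "pop_ok t ss" and a: "a \<in> S"
    and D: "3 / 5 * sqrt \<alpha> \<le> D" "3 / 5 * (\<alpha>\<^sup>2 / 1024) \<le> D * t\<^sup>2" "pop_density t ss \<le> 5 / 3 * D"
    and ok: "clean_ok S (centre t ss a) (D\<^sup>2 / 8192) (max (21 / 128 * sqrt \<alpha>) (D / 10))
      (Some (Cleaning (centre t ss a) \<tau> bs zs))"
  shows "bsg_ok S \<alpha> (Cleaning (centre t ss a) \<tau> bs zs)"
proof -
  let ?Y = "cleaned S (Cleaning (centre t ss a) \<tau> bs zs)"
  let ?N = "base_of S (centre t ss a)"
  define cod where "cod x z = card {b \<in> S. b + x \<in> pop_set t ss \<and> b + z \<in> pop_set t ss}" for x z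
  have sq: "0 < sqrt \<alpha>" using \<alpha> by simp
  have size: "max (21 / 128 * sqrt \<alpha>) (D / 10) * real (card S) \<le> real (card ?Y)" using ok by simp
  have "real (card (?Y + ?Y)) \<le> C_BSG * \<alpha> powi (-4) * real (card ?Y)"
  proof (rule low_doubling[OF S pop_set_F2 \<alpha>(1) cleaned_subset base_of_subset cod_def _ t D(2) pop_density_eq D(3)])
    show "0 < D" using D(1) sq by linarith
    show "3 / 8 * t * real (card S) \<le> real (rep S d)" if "d \<in> pop_set t ss" for d
      using ss that pop_set_F2 by (auto simp: pop_ok_def)
    show "D / 10 * real (card S) \<le> real (card ?Y)"
      by (rule order_trans[OF mult_right_mono size]) auto
    fix x y assume xy: "x \<in> ?Y" "y \<in> ?Y"
    then have "x \<in> S" "y \<in> S" using cleaned_subset base_of_subset by blast+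
    moreover have "z \<in> S" if "z \<in> ?N" for z using that base_of_subset by blast
    ultimately have eq: "{z \<in> ?N. D\<^sup>2 / 8192 * real (card S) \<le> real (links S (centre t ss a) x z) \<and>
          D\<^sup>2 / 8192 * real (card S) \<le> real (links S (centre t ss a) y z)}
        = {z \<in> ?N. D\<^sup>2 / 8192 * real (card S) \<le> real (cod x z) \<and> D\<^sup>2 / 8192 * real (card S) \<le> real (cod y z)}"
      by (auto simp: links_centre cod_def)
    show "real (card ?N) / 2 \<le> real (card {z \<in> ?N.
        D\<^sup>2 / 8192 * real (card S) \<le> real (cod x z) \<and> D\<^sup>2 / 8192 * real (card S) \<le> real (cod y z)})"
      unfolding eq[symmetric] using ok xy unfolding clean_ok.simps richly_linked_def by blast
  qed
  moreover have "21 / 128 * sqrt \<alpha> * real (card S) \<le> real (card ?Y)"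
    by (rule order_trans[OF mult_right_mono size]) auto
  ultimately show ?thesis by (auto simp: bsg_ok_def c_BSG_def)
qed

lemma low_clean_error:
  assumes "3 / 5 * sqrt \<alpha> \<le> D"
  shows "Pr (result S (clean m w sd (D\<^sup>2 / 8192) (max (21 / 128 * sqrt \<alpha>) (D / 10))))
    {r. \<not> clean_ok S sd (D\<^sup>2 / 8192) (max (21 / 128 * sqrt \<alpha>) (D / 10)) r} \<le> 3 * \<epsilon>"
proof (rule clean_error)
  have "(3 / 5 * sqrt \<alpha>)\<^sup>2 \<le> D\<^sup>2" using assms \<alpha> by (intro power_mono) auto
  \<comment> \<open>\<open>(3 / 5) ^ 2\<close> exceeds \<open>1 / 4 = 8192 / 32768\<close>.\<close>
  then show "\<alpha> / 32768 \<le> D\<^sup>2 / 8192" using \<alpha> by (simp add: power_mult_distrib power_divide)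
qed simp

lemma cnt_popular:
  assumes "ps \<in> set_pmf (replicate_pmf w (uniform_pair S))"
  shows "cnt (\<lambda>x. dval S (case x of (a, b) \<Rightarrow> popular ss (pop_threshold m t) (a + b))) ps
    = cnt (\<lambda>p. fst p + snd p \<in> pop_set t ss) ps"
proof (rule cnt_cong)
  fix x assume "x \<in> set ps"
  then have "x \<in> S \<times> S"
    using assms fin S(2) by (auto simp: set_replicate_pmf pair_uniform lists_eq_set)
  then show "dval S (case x of (a, b) \<Rightarrow> popular ss (pop_threshold m t) (a + b))
      = (fst x + snd x \<in> pop_set t ss)"
    by (auto simp: popular_iff simp del: dval_popular)
qed

lemma result_low_trial:
  "result S (low_trial m w \<alpha> t) =
     bind_pmf (replicate_pmf m (pmf_of_set S)) (\<lambda>ss.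
     bind_pmf (replicate_pmf w (uniform_pair S)) (\<lambda>ps.
       let D = real (cnt (\<lambda>p. fst p + snd p \<in> pop_set t ss) ps) / real w in
       if 3 / 5 * sqrt \<alpha> \<le> D \<and> 3 / 5 * (\<alpha>\<^sup>2 / 1024) \<le> D * t\<^sup>2
       then bind_pmf (pmf_of_set S) (\<lambda>a. result S
         (clean m w (centre t ss a) (D\<^sup>2 / 8192) (max (21 / 128 * sqrt \<alpha>) (D / 10))))
       else return_pmf None))"
  unfolding low_trial_def result_rbind result_replicate_alg result_draw result_draw_pair
    result_of_dtree bind_return_pmf dval_dcnt
  by (intro bind_pmf_cong refl) (simp add: cnt_popular Let_def del: dval_popular)

text \<open>If the true density is below \<open>sqrt \<alpha>\<close> and was not estimated, the
  acceptance test \<open>3 / 5 * sqrt \<alpha> \<le> D\<close> gives the bound by itself.\<close>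

lemma density_le:
  assumes "density_ok t ss ps" "3 / 5 * sqrt \<alpha> \<le> real (cnt (\<lambda>p. fst p + snd p \<in> pop_set t ss) ps) / real w"
  shows "pop_density t ss \<le> 5 / 3 * (real (cnt (\<lambda>p. fst p + snd p \<in> pop_set t ss) ps) / real w)"
proof (cases "sqrt \<alpha> \<le> pop_density t ss")
  case True
  then have "3 / 5 * pop_density t ss * real w < real (cnt (\<lambda>p. fst p + snd p \<in> pop_set t ss) ps)"
    using assms(1) by (simp add: density_ok_def)
  then show ?thesis using w_pos by (simp add: field_simps)
next
  case False
  then show ?thesis using assms(2) by linarith
qed

lemma low_trial_sound:
  assumes t: "\<alpha> / 32 \<le> t"
  shows "Pr (result S (low_trial m w \<alpha> t)) (Some ` {r. \<not> bsg_ok S \<alpha> r}) \<le> 5 * \<epsilon>"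
proof -
  have t0: "0 < t" using t \<alpha> by linarith
  have "Pr (result S (low_trial m w \<alpha> t)) (Some ` {r. \<not> bsg_ok S \<alpha> r}) \<le> \<epsilon> + (\<epsilon> + 3 * \<epsilon>)"
    unfolding result_low_trial
  proof (rule prob_bind_le'[OF _ _ pop_ok_error[OF t]], rule prob_bind_le'[OF _ _ density_ok_error])
    fix ss ps
    assume ss: "ss \<notin> {ss. \<not> pop_ok t ss}" and ps: "ps \<notin> {ps. \<not> density_ok t ss ps}"
    define D where "D = real (cnt (\<lambda>p. fst p + snd p \<in> pop_set t ss) ps) / real w"
    let ?bad = "Some ` {r. \<not> bsg_ok S \<alpha> r}"
    let ?A = "\<lambda>a. clean m w (centre t ss a) (D\<^sup>2 / 8192) (max (21 / 128 * sqrt \<alpha>) (D / 10))"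
    have "Pr (if 3 / 5 * sqrt \<alpha> \<le> D \<and> 3 / 5 * (\<alpha>\<^sup>2 / 1024) \<le> D * t\<^sup>2
       then bind_pmf (pmf_of_set S) (\<lambda>a. result S (?A a)) else return_pmf None) ?bad \<le> 3 * \<epsilon>"
    proof (cases "3 / 5 * sqrt \<alpha> \<le> D \<and> 3 / 5 * (\<alpha>\<^sup>2 / 1024) \<le> D * t\<^sup>2")
      case True
      have dens: "pop_density t ss \<le> 5 / 3 * D"
        using density_le[of t ss ps] ps True by (simp add: D_def)
      have "Pr (bind_pmf (pmf_of_set S) (\<lambda>a. result S (?A a))) ?bad \<le> 0 + 3 * \<epsilon>"
      proof (rule prob_bind_le'[where B = "{}"])
        fix a assume "a \<in> set_pmf (pmf_of_set S)"
        then have a: "a \<in> S" using fin S(2) by simp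
        have "Pr (result S (?A a)) ?bad \<le> Pr (result S (?A a))
          {r. \<not> clean_ok S (centre t ss a) (D\<^sup>2 / 8192) (max (21 / 128 * sqrt \<alpha>) (D / 10)) r}"
        proof (rule prob_mono_support)
          fix ro assume ro: "ro \<in> set_pmf (result S (?A a))" "ro \<in> ?bad"
          then obtain r where r: "ro = Some r" "\<not> bsg_ok S \<alpha> r" by auto
          obtain bs zs where "r = Cleaning (centre t ss a) (nat \<lceil>8 / 5 * (D\<^sup>2 / 8192) * real m\<rceil>) bs zs"
            using set_clean[OF fin S(2)] ro(1) r(1) by metis
          then show "ro \<in> {r. \<not> clean_ok S (centre t ss a) (D\<^sup>2 / 8192) (max (21 / 128 * sqrt \<alpha>) (D / 10)) r}"
            using r bsg_ok_Centre[OF t0 _ a _ _ dens] ss True by blast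
        qed
        also have "\<dots> \<le> 3 * \<epsilon>" by (rule low_clean_error) (use True in simp)
        finally show "Pr (result S (?A a)) ?bad \<le> 3 * \<epsilon>" .
      qed (use \<epsilon>_nonneg in auto)
      then show ?thesis using True by simp
    qed (use \<epsilon>_nonneg in \<open>auto simp: indicator_def\<close>)
    then show "Pr (let D = real (cnt (\<lambda>p. fst p + snd p \<in> pop_set t ss) ps) / real w in
       if 3 / 5 * sqrt \<alpha> \<le> D \<and> 3 / 5 * (\<alpha>\<^sup>2 / 1024) \<le> D * t\<^sup>2
       then bind_pmf (pmf_of_set S) (\<lambda>a. result S
         (clean m w (centre t ss a) (D\<^sup>2 / 8192) (max (21 / 128 * sqrt \<alpha>) (D / 10))))
       else return_pmf None) ?bad \<le> 3 * \<epsilon>"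
      by (simp only: D_def Let_def)
  qed (use \<epsilon>_nonneg in auto)
  then show ?thesis by simp
qed

lemma low_trial_complete:
  assumes t: "\<alpha> / 32 \<le> t"
    and dense: "max (sqrt \<alpha>) (\<alpha> ^ 2 / (1024 * t ^ 2)) * real (card S) ^ 2
        \<le> real (card {(a, b) \<in> S \<times> S. t * real (card S) \<le> real (rep S (a + b))})"
  shows "Pr (result S (low_trial m w \<alpha> t)) {None} \<le> (1 - sqrt \<alpha> / 16) + 5 * \<epsilon>"
proof -
  have t0: "0 < t" using t \<alpha> by linarith
  have sq: "0 < sqrt \<alpha>" using \<alpha> by simp
  have sq1: "sqrt \<alpha> \<le> 1" using \<alpha> by simp
  have "Pr (result S (low_trial m w \<alpha> t)) {None} \<le> \<epsilon> + (\<epsilon> + ((1 - sqrt \<alpha> / 16) + 3 * \<epsilon>))"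
    unfolding result_low_trial
  proof (rule prob_bind_le'[OF _ _ pop_ok_error[OF t]], rule prob_bind_le'[OF _ _ density_ok_error])
    fix ss ps
    assume ss: "ss \<notin> {ss. \<not> pop_ok t ss}" and ps: "ps \<notin> {ps. \<not> density_ok t ss ps}"
    define \<delta> where "\<delta> = pop_density t ss"
    define D where "D = real (cnt (\<lambda>p. fst p + snd p \<in> pop_set t ss) ps) / real w"
    let ?A = "\<lambda>a. clean m w (centre t ss a) (D\<^sup>2 / 8192) (max (21 / 128 * sqrt \<alpha>) (D / 10))"
    \<comment> \<open>The sampled test accepts every difference of popularity at least
      \<open>t\<close>, so the density assumed in \<open>dense\<close> passes to
      \<open>pop_set\<close>.\<close>
    have "real (card {(a, b) \<in> S \<times> S. t * real (card S) \<le> real (rep S (a + b))})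
        \<le> real (card {(a, b) \<in> S \<times> S. a + b \<in> pop_set t ss})"
      unfolding of_nat_le_iff using ss S_add fin
      by (intro card_mono) (auto simp: pop_ok_def intro: finite_subset[OF _ finite_cartesian_product[OF fin fin]])
    then have "max (sqrt \<alpha>) (\<alpha> ^ 2 / (1024 * t ^ 2)) * real (card S) ^ 2 \<le> \<delta> * real (card S) ^ 2"
      using dense by (simp add: \<delta>_def pop_density_eq)
    then have "max (sqrt \<alpha>) (\<alpha> ^ 2 / (1024 * t ^ 2)) \<le> \<delta>"
      by (rule mult_right_le_imp_le) (use card_S in simp)
    then have \<delta>1: "sqrt \<alpha> \<le> \<delta>" and \<delta>2: "\<alpha> ^ 2 / (1024 * t ^ 2) \<le> \<delta>" by auto
    have \<delta>2': "\<alpha> ^ 2 / 1024 \<le> \<delta> * t ^ 2" using \<delta>2 t0 by (simp add: field_simps)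
    have "3 / 5 * \<delta> * real w < real (cnt (\<lambda>p. fst p + snd p \<in> pop_set t ss) ps)"
      "real (cnt (\<lambda>p. fst p + snd p \<in> pop_set t ss) ps) < 8 / 5 * \<delta> * real w"
      using ps \<delta>1 by (auto simp: density_ok_def \<delta>_def)
    then have D: "3 / 5 * \<delta> \<le> D" "D \<le> 8 / 5 * \<delta>" using w_pos by (auto simp: D_def field_simps)
    have "3 / 5 * (\<alpha>\<^sup>2 / 1024) \<le> 3 / 5 * \<delta> * t\<^sup>2" using \<delta>2' by simp
    also have "\<dots> \<le> D * t\<^sup>2" using D(1) by (intro mult_right_mono) auto
    finally have D2: "3 / 5 * (\<alpha>\<^sup>2 / 1024) \<le> D * t\<^sup>2" .
    have D1: "3 / 5 * sqrt \<alpha> \<le> D" using D(1) \<delta>1 by linarith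
    let ?\<theta> = "max (21 / 128 * sqrt \<alpha>) (D / 10)"
    let ?good = "\<lambda>a. good_seed S (centre t ss a) (D\<^sup>2 / 8192) ?\<theta>"
    define N where "N a = {x \<in> S. a + x \<in> pop_set t ss}" for a
    define cod where "cod x z = card {b \<in> S. b + x \<in> pop_set t ss \<and> b + z \<in> pop_set t ss}" for x z
    have "\<delta> / 16 * real (card S) \<le> real (card {a \<in> S. \<delta> / 2 * real (card S) \<le> real (card (N a)) \<and>
        real (card {(x, z) \<in> N a \<times> N a. real (cod x z) < D ^ 2 / 3072 * real (card S)})
          \<le> 9 / 2048 * real (card (N a)) ^ 2})"
      by (rule many_good_centres[OF S pop_set_F2 N_def cod_def _ pop_density_eq[of t ss, folded \<delta>_def]])
         (use \<delta>1 D1 D sq in linarith)+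
    also have "\<dots> \<le> real (card {a \<in> S. ?good a})"
      unfolding of_nat_le_iff
    proof (rule card_mono)
      show "finite {a \<in> S. ?good a}" using fin by simp
      show "{a \<in> S. \<delta> / 2 * real (card S) \<le> real (card (N a)) \<and>
        real (card {(x, z) \<in> N a \<times> N a. real (cod x z) < D ^ 2 / 3072 * real (card S)})
          \<le> 9 / 2048 * real (card (N a)) ^ 2} \<subseteq> {a \<in> S. ?good a}"
      proof
        fix a assume "a \<in> {a \<in> S. \<delta> / 2 * real (card S) \<le> real (card (N a)) \<and>
          real (card {(x, z) \<in> N a \<times> N a. real (cod x z) < D ^ 2 / 3072 * real (card S)})
            \<le> 9 / 2048 * real (card (N a)) ^ 2}"
        then have a: "a \<in> S" "\<delta> / 2 * real (card S) \<le> real (card (N a))"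
          "real (card {(x, z) \<in> N a \<times> N a. real (cod x z) < D ^ 2 / 3072 * real (card S)})
            \<le> 9 / 2048 * real (card (N a)) ^ 2" by auto
        have NE: "base_of S (centre t ss a) = N a" by (simp add: base_of_centre a(1) N_def)
        have NS: "N a \<subseteq> S" by (auto simp: N_def)
        have \<kappa>: "8 / 3 * (D\<^sup>2 / 8192) = D\<^sup>2 / 3072" by simp
        have eq: "{(x, z) \<in> N a \<times> N a. real (links S (centre t ss a) x z) < D\<^sup>2 / 3072 * real (card S)}
          = {(x, z) \<in> N a \<times> N a. real (cod x z) < D\<^sup>2 / 3072 * real (card S)}"
          using NS by (auto simp: links_centre cod_def subset_iff)
        \<comment> \<open>\<open>8 / 3 * (21 / 128)\<close> is exactly \<open>7 / 16\<close>, and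
          \<open>8 / 3 * (1 / 10) * (8 / 5) = 32 / 75\<close> is slightly less.\<close>
        have "8 / 3 * ?\<theta> \<le> 7 / 16 * \<delta>" 
        proof (cases "21 / 128 * sqrt \<alpha> \<le> D / 10")
          case True
          show ?thesis unfolding max_absorb2[OF True] using D(2) \<delta>1 sq by linarith
        next
          case False
          then have "?\<theta> = 21 / 128 * sqrt \<alpha>" by (intro max_absorb1) simp
          then show ?thesis using \<delta>1 by simp
        qed
        then have "8 / 3 * ?\<theta> * real (card S) \<le> 7 / 16 * \<delta> * real (card S)"
          using card_S by (intro mult_right_mono) auto
        also have "\<dots> = 7 / 8 * (\<delta> / 2 * real (card S))" by simp
        also have "\<dots> \<le> 7 / 8 * real (card (N a))" using a(2) by (rule mult_left_mono) simp
        finally have "?good a" using a(3) unfolding good_seed_def NE \<kappa> eq by blast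
        then show "a \<in> {a \<in> S. ?good a}" using a(1) by simp
      qed
    qed
    finally have "\<delta> / 16 \<le> Pr (pmf_of_set S) {a. ?good a}"
      unfolding prob_uniform[OF fin S(2)] using card_S by (simp add: field_simps)
    then have "sqrt \<alpha> / 16 \<le> Pr (pmf_of_set S) {a. ?good a}" using \<delta>1 by linarith
    from prob_compl_le[OF this]
    have "Pr (bind_pmf (pmf_of_set S) (\<lambda>a. result S (?A a))) {None} \<le> (1 - sqrt \<alpha> / 16) + 3 * \<epsilon>"
    proof (rule prob_bind_le'[rotated 2])
      fix a assume "a \<notin> - {a. ?good a}"
      then have good: "?good a" by simp
      have "Pr (result S (?A a)) {None} \<le> Pr (result S (?A a))
        {r. \<not> clean_ok S (centre t ss a) (D\<^sup>2 / 8192) ?\<theta> r}"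
        using good by (intro measure_pmf.finite_measure_mono) auto
      also have "\<dots> \<le> 3 * \<epsilon>" by (rule low_clean_error[OF D1])
      finally show "Pr (result S (?A a)) {None} \<le> 3 * \<epsilon>" .
    qed (use \<epsilon>_nonneg in simp)
    then show "Pr (let D = real (cnt (\<lambda>p. fst p + snd p \<in> pop_set t ss) ps) / real w in
       if 3 / 5 * sqrt \<alpha> \<le> D \<and> 3 / 5 * (\<alpha>\<^sup>2 / 1024) \<le> D * t\<^sup>2
       then bind_pmf (pmf_of_set S) (\<lambda>a. result S
         (clean m w (centre t ss a) (D\<^sup>2 / 8192) (max (21 / 128 * sqrt \<alpha>) (D / 10))))
       else return_pmf None) {None} \<le> (1 - sqrt \<alpha> / 16) + 3 * \<epsilon>"
      using D1 D2 by (simp only: D_def[symmetric] Let_def simp_thms if_True)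
  qed (use \<epsilon>_nonneg sq1 in linarith)+
  then show ?thesis by simp
qed

end

section \<open>Costs and encoding of records\<close>

fun seed_wf :: "nat \<Rightarrow> nat \<Rightarrow> point set \<Rightarrow> seed \<Rightarrow> bool" where
  "seed_wf n m S (Difference d) \<longleftrightarrow> d \<in> F2 n"
| "seed_wf n m S (Centre a ss \<tau>) \<longleftrightarrow> a \<in> S \<and> length ss = m \<and> set ss \<subseteq> S \<and> \<tau> \<le> m"

text \<open>Thresholds are stored in unary, so their bounds enter the record length.\<close>

fun cleaning_wf :: "nat \<Rightarrow> nat \<Rightarrow> nat \<Rightarrow> point set \<Rightarrow> cleaning \<Rightarrow> bool" where
  "cleaning_wf n m w S (Cleaning sd \<tau> bs zs) \<longleftrightarrow> seed_wf n m S sd \<and> \<tau> \<le> m \<and>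
     length bs = m \<and> length zs \<le> w \<and> set bs \<subseteq> S \<and> set zs \<subseteq> S"

lemma nat_ceiling_le:
  assumes "c \<le> 1"
  shows "nat \<lceil>c * real m\<rceil> \<le> m"
  using mult_right_mono[OF assms, of "real m"] by (simp add: nat_le_iff ceiling_le_iff)

lemma clean_wf:
  assumes "finite S" "S \<noteq> {}" "Some r \<in> set_pmf (result S (clean m w sd \<kappa> \<theta>))" "\<kappa> \<le> 5 / 8" "seed_wf n m S sd"
  shows "cleaning_wf n m w S r"
proof -
  obtain bs zs where "r = Cleaning sd (nat \<lceil>8 / 5 * \<kappa> * real m\<rceil>) bs zs" "length bs = m" "length zs \<le> w"
    "set bs \<subseteq> S" "set zs \<subseteq> S"
    using set_clean[OF assms(1-3)] by metis
  moreover have "nat \<lceil>8 / 5 * \<kappa> * real m\<rceil> \<le> m" using assms(4) by (intro nat_ceiling_le) simp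
  ultimately show ?thesis using assms(5) by simp
qed

lemma seed_cost_wf: "seed_wf n m S sd \<Longrightarrow> 1 \<le> m \<Longrightarrow> seed_cost sd \<le> 3 * m"
  by (cases sd) auto

text \<open>The dominant term: each of \<open>w\<close> validation points is compared with up to
  \<open>w\<close> partners by \<open>m\<close> link tests of at most \<open>3 * m\<close>
  queries.\<close>

lemma cost_le_clean_wf:
  assumes "finite S" "S \<noteq> {}" "seed_wf n m S sd" "1 \<le> m" "1 \<le> w"
  shows "cost_le S (clean m w sd \<kappa> \<theta>) (m + 2 * w) (9 * (w * m) ^ 2)"
proof (rule cost_le_mono[OF cost_le_clean[OF assms(1,2)]])
  have c: "seed_cost sd \<le> 3 * m" by (rule seed_cost_wf[OF assms(3,4)])
  have "w * seed_cost sd \<le> w * (3 * m)" using c by (rule mult_left_mono) simp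
  moreover have wm: "w * (3 * m) \<le> 3 * (w * m) ^ 2"
  proof -
    have "1 \<le> w * m" using assms(4,5) by simp
    then have "1 * (w * m) \<le> (w * m) * (w * m)" by (rule mult_right_mono) simp
    then show ?thesis by (simp add: power2_eq_square)
  qed
  moreover have "w * (w * (m * seed_cost sd)) \<le> w * (w * (m * (3 * m)))"
    using c by (intro mult_left_mono) auto
  moreover have "w * (w * (m * (3 * m))) = 3 * (w * m) ^ 2" by (simp add: power2_eq_square)
  ultimately show "w * seed_cost sd + w * (seed_cost sd + w * (m * seed_cost sd)) \<le> 9 * (w * m) ^ 2"
    unfolding add_mult_distrib2 by linarith
qed simp

lemma dcost_member_wf:
  assumes "cleaning_wf n m w S r" "1 \<le> m" "1 \<le> w"
  shows "dcost S' (member r x) \<le> 6 * (w * m ^ 2)"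
proof -
  obtain sd \<tau> bs zs where r: "r = Cleaning sd \<tau> bs zs" by (cases r)
  have c: "seed_cost sd \<le> 3 * m" using assms(1,2) by (intro seed_cost_wf) (auto simp: r)
  have "length zs * (length bs * seed_cost sd) \<le> w * (m * (3 * m))"
    using assms(1) c by (intro mult_mono) (auto simp: r)
  moreover have "m \<le> w * m ^ 2"
  proof -
    have "1 \<le> w * m" using assms(2,3) by simp
    then have "1 * m \<le> (w * m) * m" by (rule mult_right_mono) simp
    then show ?thesis by (simp add: power2_eq_square)
  qed
  moreover have "w * (m * (3 * m)) = 3 * (w * m ^ 2)" by (simp add: power2_eq_square)
  ultimately show ?thesis using dcost_member[of S' sd \<tau> bs zs x] c unfolding r by linarith
qed

context bsg
begin

lemma high_trial_wf: "Some r \<in> set_pmf (result S (high_trial m w \<alpha>)) \<Longrightarrow> cleaning_wf n m w S r"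
  using \<alpha> S_add fin S(2)
  by (auto simp: high_trial_def pair_uniform intro!: clean_wf[OF fin S(2)])

lemma low_trial_wf:
  assumes "t \<le> 1" "Some r \<in> set_pmf (result S (low_trial m w \<alpha> t))"
  shows "cleaning_wf n m w S r"
proof -
  obtain ss ps a D where ss: "ss \<in> set_pmf (replicate_pmf m (pmf_of_set S))" and a: "a \<in> S"
    and D: "D = real (cnt (\<lambda>p. fst p + snd p \<in> pop_set t ss) ps) / real w"
    and ps: "ps \<in> set_pmf (replicate_pmf w (uniform_pair S))"
    and r: "Some r \<in> set_pmf (result S (clean m w (centre t ss a) (D\<^sup>2 / 8192) (max (21 / 128 * sqrt \<alpha>) (D / 10))))"
    using assms(2) fin S(2) unfolding result_low_trial by (auto simp: Let_def split: if_splits)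
  have "length ps = w" using ps by (simp add: set_replicate_pmf)
  then have "cnt (\<lambda>p. fst p + snd p \<in> pop_set t ss) ps \<le> w" using cnt_le by metis
  then have "D \<le> 1" "0 \<le> D" using w_pos by (auto simp: D)
  then have "D\<^sup>2 \<le> 1" by (simp add: power_le_one)
  moreover have "pop_threshold m t \<le> m"
    unfolding pop_threshold_def using assms(1) by (intro nat_ceiling_le) simp
  moreover have "length ss = m" "set ss \<subseteq> S" using ss fin S(2) by (auto simp: set_replicate_pmf)
  ultimately show ?thesis using a by (intro clean_wf[OF fin S(2) r]) auto
qed

lemma cost_le_high_trial:
  assumes "1 \<le> m"
  shows "cost_le S (high_trial m w \<alpha>) (2 + (m + 2 * w)) (9 * (w * m) ^ 2)"
proof -
  have "cost_le S (high_trial m w \<alpha>) (2 + (m + 2 * w)) (0 + 9 * (w * m) ^ 2)"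
    unfolding high_trial_def
  proof (rule cost_le_rbind[OF cost_le_draw_pair])
    fix p assume "p \<in> set_pmf (result S draw_pair)"
    then have "fst p + snd p \<in> F2 n" using fin S(2) S_add by (auto simp: pair_uniform)
    then show "cost_le S (case p of (a, b) \<Rightarrow> clean m w (Difference (a + b)) (\<alpha> / 2048) (21 / 128 * sqrt \<alpha>))
        (m + 2 * w) (9 * (w * m) ^ 2)"
      using assms w_pos by (cases p) (auto intro!: cost_le_clean_wf[OF fin S(2), of n])
  qed
  then show ?thesis by simp
qed

lemma cost_le_low_trial:
  assumes "1 \<le> m" "t \<le> 1"
  shows "cost_le S (low_trial m w \<alpha> t) (2 * m + 4 * w + 1) (10 * (w * m) ^ 2)"
proof -
  have "cost_le S (low_trial m w \<alpha> t) (m * 1 + (w * 2 + (0 + (1 + (m + 2 * w)))))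
      (m * 0 + (w * 0 + (w * m + (0 + 9 * (w * m) ^ 2))))"
    unfolding low_trial_def
  proof (intro cost_le_rbind cost_le_replicate_alg cost_le_draw cost_le_draw_pair cost_le_of_dtree)
    fix ss ps
    assume ss: "ss \<in> set_pmf (result S (replicate_alg m draw))"
      and ps: "ps \<in> set_pmf (result S (replicate_alg w draw_pair))"
    have len: "length ss = m" "length ps = w" using ss ps by (auto simp: set_replicate_pmf)
    have "dcost S (case x of (a, b) \<Rightarrow> popular ss (pop_threshold m t) (a + b)) \<le> m" for x
      using dcost_popular[of S ss] len by (cases x) auto
    then show "dcost S (dcnt (\<lambda>(a, b). popular ss (pop_threshold m t) (a + b)) ps) \<le> w * m"
      using dcost_dcnt[of ps S] len by blast
  next
    fix ss ps k
    assume ss: "ss \<in> set_pmf (result S (replicate_alg m draw))"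
    have len: "length ss = m" "set ss \<subseteq> S" using ss fin S(2) by (auto simp: set_replicate_pmf)
    have "cost_le S (rbind draw (\<lambda>a. clean m w (centre t ss a) \<kappa> \<theta>)) (1 + (m + 2 * w)) (0 + 9 * (w * m) ^ 2)" for \<kappa> \<theta>
    proof (rule cost_le_rbind[OF cost_le_draw])
      fix a assume "a \<in> set_pmf (result S draw)"
      then have "a \<in> S" using fin S(2) by simp
      moreover have "pop_threshold m t \<le> m"
        unfolding pop_threshold_def using assms(2) by (intro nat_ceiling_le) simp
      ultimately show "cost_le S (clean m w (centre t ss a) \<kappa> \<theta>) (m + 2 * w) (9 * (w * m) ^ 2)"
        using len assms w_pos by (intro cost_le_clean_wf[OF fin S(2), of n]) auto
    qed
    then show "cost_le S (let D = real k / real w in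
       if 3 / 5 * sqrt \<alpha> \<le> D \<and> 3 / 5 * (\<alpha>\<^sup>2 / 1024) \<le> D * t\<^sup>2
       then rbind draw (\<lambda>a. clean m w (centre t ss a) (D\<^sup>2 / 8192) (max (21 / 128 * sqrt \<alpha>) (D / 10)))
       else Return None) (1 + (m + 2 * w)) (0 + 9 * (w * m) ^ 2)"
      by (simp add: Let_def)
  qed
  then show ?thesis
  proof (rule cost_le_mono)
    have "1 \<le> w * m" using assms w_pos by simp
    then have "1 * (w * m) \<le> (w * m) * (w * m)" by (rule mult_right_mono) simp
    then show "m * 0 + (w * 0 + (w * m + (0 + 9 * (w * m) ^ 2))) \<le> 10 * (w * m) ^ 2"
      by (simp add: power2_eq_square)
  qed simp
qed

end

section \<open>Records as bit strings\<close>

definition bits_of_point :: "point \<Rightarrow> bits" where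
  "bits_of_point v = map (\<lambda>b. b = 1) (list_of_vec v)"

lemma inj_bits_of_point: "inj bits_of_point"
proof (rule injI)
  fix u v assume "bits_of_point u = bits_of_point v"
  moreover have "inj (\<lambda>b :: bit. b = 1)"
    by (rule injI) (metis bit_not_one_iff)
  ultimately have "list_of_vec u = list_of_vec v"
    by (simp add: bits_of_point_def inj_map_eq_map)
  then show "u = v" using vec_list by metis
qed

lemma length_bits_of_point: "v \<in> F2 n \<Longrightarrow> length (bits_of_point v) = n"
  by (auto simp: bits_of_point_def)

text \<open>A prefix-free code: \<open>True\<close> announces a further bit, \<open>False\<close>
  ends the word.\<close>

primrec delimit :: "bits \<Rightarrow> bits" where
  "delimit [] = [False]"
| "delimit (b # bs) = True # b # delimit bs"

lemma delimit_append_inject: "delimit xs @ r = delimit ys @ s \<longleftrightarrow> xs = ys \<and> r = s"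
proof (induction xs arbitrary: ys)
  case Nil
  then show ?case by (cases ys) auto
next
  case (Cons x xs)
  then show ?case by (cases ys) auto
qed

lemma length_delimit: "length (delimit xs) = 2 * length xs + 1"
  by (induction xs) auto

primrec join_words :: "bits list \<Rightarrow> bits" where
  "join_words [] = []"
| "join_words (xs # xss) = delimit xs @ join_words xss"

lemma inj_join_words: "inj join_words"
proof (rule injI)
  fix xss yss :: "bits list"
  have ne: "delimit xs @ r \<noteq> []" for xs r by (cases xs) auto
  show "join_words xss = join_words yss \<Longrightarrow> xss = yss"
  proof (induction xss arbitrary: yss)
    case Nil
    then show ?case using ne by (cases yss) (auto simp del: append_is_Nil_conv)
  next
    case (Cons xs xss)
    then show ?case using ne by (cases yss) (auto simp: delimit_append_inject simp del: append_is_Nil_conv)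
  qed
qed

lemma length_join_words: "length (join_words xss) = (\<Sum>xs\<leftarrow>xss. 2 * length xs + 1)"
  by (induction xss) (auto simp: length_delimit)

text \<open>The stored length of \<open>ss\<close> shows where the sample ends once further words
  follow it.\<close>

fun words_of_seed :: "seed \<Rightarrow> bits list" where
  "words_of_seed (Difference d) = [[True], bits_of_point d]"
| "words_of_seed (Centre a ss \<tau>) =
     [[False], bits_of_point a, replicate \<tau> True, replicate (length ss) True] @ map bits_of_point ss"

fun words_of :: "cleaning \<Rightarrow> bits list" where
  "words_of (Cleaning sd \<tau> bs zs) =
     words_of_seed sd @ [replicate \<tau> True, replicate (length bs) True] @ map bits_of_point bs @ map bits_of_point zs"

lemma replicate_inject_length: "replicate k x = replicate l x \<longleftrightarrow> k = l"
  by (metis length_replicate)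

lemma inj_words_of: "inj words_of"
proof (rule injI)
  fix r r' assume eq: "words_of r = words_of r'"
  obtain sd \<tau> bs zs where r: "r = Cleaning sd \<tau> bs zs" by (cases r)
  obtain sd' \<tau>' bs' zs' where r': "r' = Cleaning sd' \<tau>' bs' zs'" by (cases r')
  note inj = inj_map_eq_map[OF inj_bits_of_point] inj_eq[OF inj_bits_of_point]
  show "r = r'"
    using eq unfolding r r'
    by (cases sd; cases sd') (auto simp: replicate_inject_length inj)
qed

definition encode :: "cleaning \<Rightarrow> bits" where
  "encode r = join_words (words_of r)"

lemma inj_encode: "inj encode"
  using inj_compose[OF inj_join_words inj_words_of] by (simp add: encode_def[abs_def] comp_def)

lemma encode_nonempty: "encode r \<noteq> []"
proof -
  obtain sd \<tau> bs zs where r: "r = Cleaning sd \<tau> bs zs" by (cases r)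
  show ?thesis by (cases sd) (auto simp: encode_def r)
qed

lemma length_encode:
  assumes "cleaning_wf n m w S r" "S \<subseteq> F2 n" "1 \<le> n" "w \<le> m" "1 \<le> m"
  shows "length (encode r) \<le> 40 * (n * m)"
proof -
  obtain sd \<tau> bs zs where r: "r = Cleaning sd \<tau> bs zs" by (cases r)
  have nm: "1 \<le> n * m" "n \<le> n * m" "m \<le> n * m" using assms(3,5) by auto
  have pts: "(\<Sum>xs\<leftarrow>map bits_of_point vs. 2 * length xs + 1) \<le> 3 * (n * m)" if "set vs \<subseteq> S" "length vs \<le> m" for vs
  proof -
    have "(\<Sum>xs\<leftarrow>map bits_of_point vs. 2 * length xs + 1) \<le> (\<Sum>v\<leftarrow>vs. 3 * n)"
      unfolding map_map comp_def
    proof (rule sum_list_mono)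
      fix v assume "v \<in> set vs"
      then have "v \<in> F2 n" using that(1) assms(2) by blast
      then show "2 * length (bits_of_point v) + 1 \<le> 3 * n" using assms(3) by (simp add: length_bits_of_point)
    qed
    also have "\<dots> = length vs * (3 * n)" by (simp add: sum_list_triv)
    also have "\<dots> \<le> m * (3 * n)" using that(2) by (rule mult_right_mono) simp
    finally show ?thesis by (simp add: mult_ac)
  qed
  have "(\<Sum>xs\<leftarrow>words_of_seed sd. 2 * length xs + 1) \<le> 15 * (n * m)"
  proof (cases sd)
    case (Difference d)
    then have "length (bits_of_point d) = n" using assms(1) by (simp add: r length_bits_of_point)
    then have "(\<Sum>xs\<leftarrow>words_of_seed sd. 2 * length xs + 1) = 4 + 2 * n" by (simp add: Difference)
    then show ?thesis using nm by linarith
  next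
    case (Centre a ss \<sigma>)
    then have "a \<in> F2 n" using assms(1,2) by (auto simp: r)
    moreover have "(\<Sum>xs\<leftarrow>map bits_of_point ss. 2 * length xs + 1) \<le> 3 * (n * m)"
      by (rule pts) (use assms(1) in \<open>auto simp: r Centre\<close>)
    moreover have "length ss = m" "\<sigma> \<le> m" using assms(1) by (auto simp: r Centre)
    moreover have "(\<Sum>xs\<leftarrow>words_of_seed sd. 2 * length xs + 1) = 3 + (2 * length (bits_of_point a) + 1)
        + (2 * \<sigma> + 1) + (2 * length ss + 1) + (\<Sum>xs\<leftarrow>map bits_of_point ss. 2 * length xs + 1)"
      by (simp add: Centre)
    ultimately show ?thesis using nm length_bits_of_point[of a n] by linarith
  qed
  moreover have "(\<Sum>xs\<leftarrow>map bits_of_point bs. 2 * length xs + 1) \<le> 3 * (n * m)"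
    by (rule pts) (use assms(1) in \<open>auto simp: r\<close>)
  moreover have "(\<Sum>xs\<leftarrow>map bits_of_point zs. 2 * length xs + 1) \<le> 3 * (n * m)"
    by (rule pts) (use assms(1,4) in \<open>auto simp: r\<close>)
  moreover have "\<tau> \<le> m" "length bs = m" using assms(1) by (auto simp: r)
  moreover have "length (encode r) = (\<Sum>xs\<leftarrow>words_of_seed sd. 2 * length xs + 1) + (2 * \<tau> + 1) + (2 * length bs + 1)
      + (\<Sum>xs\<leftarrow>map bits_of_point bs. 2 * length xs + 1) + (\<Sum>xs\<leftarrow>map bits_of_point zs. 2 * length xs + 1)"
    by (simp add: encode_def length_join_words r)
  ultimately show ?thesis using nm by linarith
qed

section \<open>The algorithm\<close>

definition scale_exp :: "real \<Rightarrow> nat" where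
  "scale_exp \<alpha> = nat \<lceil>log 2 (1 / sqrt \<alpha>)\<rceil>"

text \<open>An integer between \<open>1 / sqrt \<alpha>\<close> and
  \<open>2 / sqrt \<alpha>\<close>, used for sample sizes and repetitions; its exponent fixes the
  number of levels.\<close>

definition scale :: "real \<Rightarrow> nat" where
  "scale \<alpha> = 2 ^ scale_exp \<alpha>"

lemma scale_bounds:
  assumes "0 < \<alpha>" "\<alpha> < 1"
  shows "1 / sqrt \<alpha> \<le> 2 ^ scale_exp \<alpha>" "(2 :: real) ^ scale_exp \<alpha> \<le> 2 / sqrt \<alpha>"
proof -
  define x where "x = log 2 (1 / sqrt \<alpha>)"
  have sq: "0 < sqrt \<alpha>" "sqrt \<alpha> < 1" using assms by auto
  have px: "2 powr x = 1 / sqrt \<alpha>" using sq by (simp add: x_def)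
  have "0 \<le> x" using sq by (simp add: x_def)
  then have e: "x \<le> real (scale_exp \<alpha>)" "real (scale_exp \<alpha>) \<le> x + 1"
    by (auto simp: scale_exp_def x_def[symmetric])
  have p: "(2 :: real) ^ scale_exp \<alpha> = 2 powr real (scale_exp \<alpha>)" by (simp add: powr_realpow)
  show "1 / sqrt \<alpha> \<le> 2 ^ scale_exp \<alpha>"
    unfolding p px[symmetric] using e(1) by (rule powr_mono) simp
  have "2 powr real (scale_exp \<alpha>) \<le> 2 powr (x + 1)" using e(2) by (rule powr_mono) simp
  also have "\<dots> = 2 / sqrt \<alpha>" using px by (simp add: powr_add)
  finally show "(2 :: real) ^ scale_exp \<alpha> \<le> 2 / sqrt \<alpha>" unfolding p .
qed

text \<open>The square of the scale offsets the least rate, of order \<open>\<alpha>\<close>; the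
  factor \<open>l\<close> makes the tail exponential in \<open>l\<close>.\<close>

definition big_sample :: "real \<Rightarrow> nat \<Rightarrow> nat" where
  "big_sample \<alpha> l = 2 ^ 24 * (scale \<alpha> ^ 2 * l)"

definition small_sample :: "real \<Rightarrow> nat \<Rightarrow> nat" where
  "small_sample \<alpha> l = 2 ^ 24 * (scale \<alpha> * l)"

definition level :: "real \<Rightarrow> nat \<Rightarrow> real" where
  "level \<alpha> k = sqrt \<alpha> / 2 / 2 ^ k"

text \<open>A suitable trial succeeds with probability at least \<open>\<alpha> / 32\<close> in the
  high and \<open>sqrt \<alpha> / 32\<close> in the low branch, so these repetition counts reduce
  failure to \<open>exp (- l)\<close>.\<close>

definition trials :: "real \<Rightarrow> nat \<Rightarrow> cleaning option ralg list" where
  "trials \<alpha> l =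
     replicate (32 * (scale \<alpha> ^ 2 * l)) (high_trial (big_sample \<alpha> l) (small_sample \<alpha> l) \<alpha>) @
     concat (map (\<lambda>k. replicate (32 * (scale \<alpha> * l))
       (low_trial (big_sample \<alpha> l) (small_sample \<alpha> l) \<alpha> (level \<alpha> k))) [1..<scale_exp \<alpha> + 4])"

lemma exp_bounds: "(2 :: real) ^ k \<le> exp (real k)" "(4 :: real) ^ k \<le> exp (2 * real k)"
proof -
  have 2: "(2 :: real) \<le> exp 1" using exp_ge_add_one_self[of 1] by simp
  show p: "(2 :: real) ^ k \<le> exp (real k)" for k
    using power_mono[OF 2, of k] by (simp add: exp_of_nat_mult[symmetric])
  have "(4 :: real) ^ k = 2 ^ (2 * k)" by (simp add: power_mult)
  then show "(4 :: real) ^ k \<le> exp (2 * real k)" using p[of "2 * k"] by simp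
qed

section \<open>Analysis of the list of trials\<close>

locale bsg_run =
  fixes n :: nat and S :: "point set" and \<alpha> :: real and l :: nat
  assumes S: "S \<subseteq> F2 n" "S \<noteq> {}" and \<alpha>: "0 < \<alpha>" "\<alpha> < 1"
    and l: "n + 1 \<le> l" "exp (- real l) \<le> \<alpha>"
begin

abbreviation "R \<equiv> scale \<alpha>"
abbreviation "m \<equiv> big_sample \<alpha> l"
abbreviation "w \<equiv> small_sample \<alpha> l"

lemma R_ge: "1 \<le> sqrt \<alpha> * real R" "1 \<le> \<alpha> * real R ^ 2"
proof -
  have sq: "0 < sqrt \<alpha>" using \<alpha> by simp
  show 1: "1 \<le> sqrt \<alpha> * real R" using scale_bounds(1)[OF \<alpha>] sq by (simp add: scale_def field_simps)
  have "1 ^ 2 \<le> (sqrt \<alpha> * real R) ^ 2" using 1 by (intro power_mono) auto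
  then show "1 \<le> \<alpha> * real R ^ 2" using \<alpha> by (simp add: power_mult_distrib)
qed

lemma R_le: "real R ^ 2 \<le> 4 / \<alpha>"
proof -
  have "real R ^ 2 \<le> (2 / sqrt \<alpha>) ^ 2"
    using scale_bounds(2)[OF \<alpha>] by (intro power_mono) (auto simp: scale_def)
  then show ?thesis using \<alpha> by (simp add: power_divide)
qed

lemma R_pos: "1 \<le> R" by (simp add: scale_def)

lemma l_pos: "1 \<le> l" using l(1) by simp

lemma m_pos: "1 \<le> m" and w_pos': "1 \<le> w" and w_le_m: "w \<le> m"
proof -
  have "1 \<le> R ^ 2 * l" "1 \<le> R * l" using R_pos l_pos by auto
  then show "1 \<le> m" "1 \<le> w" by (auto simp: big_sample_def small_sample_def)
  have "R * 1 * l \<le> R * R * l" using R_pos by (intro mult_right_mono mult_left_mono) auto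
  then show "w \<le> m" by (simp add: big_sample_def small_sample_def power2_eq_square)
qed

text \<open>The exponent \<open>18\<close> leaves \<open>1\<close> in \<open>trials_sound\<close>:
  the factors \<open>1 / \<alpha>\<close> and \<open>l\<close> in the number of trials use up one
  each, and the constant \<open>160 * 4 * 5 = 3200\<close> at most fifteen.\<close>

sublocale bsg n S \<alpha> "exp (- 18 * real l)" m w
proof
  have "2 * (4 :: real) ^ n \<le> exp 1 * exp (2 * real n)"
    using exp_bounds(1)[of 1] exp_bounds(2)[of n] by (intro mult_mono) auto
  also have "\<dots> = exp (1 + 2 * real n)" by (simp add: exp_add)
  also have "\<dots> \<le> exp (2 * real l)" using l(1) by simp
  finally have 1: "2 * (4 :: real) ^ n \<le> exp (2 * real l)" .
  have "1 * real l \<le> (\<alpha> * real R ^ 2) * real l" using R_ge(2) by (intro mult_right_mono) auto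
  moreover have "\<alpha> / 32768 * real m / 15 = 16777216 / 491520 * ((\<alpha> * real R ^ 2) * real l)"
    by (simp add: big_sample_def)
  \<comment> \<open>\<open>2 ^ 24 / (32768 * 15)\<close> exceeds \<open>34\<close>.\<close>
  ultimately have "34 * real l \<le> \<alpha> / 32768 * real m / 15" by linarith
  then have "exp (- (\<alpha> / 32768 * real m / 15)) \<le> exp (- (34 * real l))" by simp
  with 1 have "2 * 4 ^ n * exp (- (\<alpha> / 32768 * real m / 15)) \<le> exp (2 * real l) * exp (- (34 * real l))"
    by (intro mult_mono) auto
  also have "\<dots> = exp (- (32 * real l))" by (simp add: exp_add[symmetric])
  also have "\<dots> \<le> exp (- 18 * real l)" by simp
  finally show "2 * 4 ^ n * exp (- (\<alpha> / 32768 * real m / 15)) \<le> exp (- 18 * real l)" .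
  have "8 * (2 :: real) ^ n \<le> exp (real 3) * exp (real n)"
    using exp_bounds(1)[of 3] exp_bounds(1)[of n] by (intro mult_mono) auto
  also have "\<dots> = exp (3 + real n)" by (simp add: exp_add)
  also have "\<dots> \<le> exp (3 * real l)" using l(1) by simp
  finally have 2: "8 * (2 :: real) ^ n \<le> exp (3 * real l)" .
  have "1 * real l \<le> (sqrt \<alpha> * real R) * real l" using R_ge(1) by (intro mult_right_mono) auto
  moreover have "9 / 256 * (21 / 128 * sqrt \<alpha>) * real w / 15 = 189 / 491520 * 16777216 * ((sqrt \<alpha> * real R) * real l)"
    by (simp add: small_sample_def)
  ultimately have "21 * real l \<le> 9 / 256 * (21 / 128 * sqrt \<alpha>) * real w / 15" by linarith
  then have "exp (- (9 / 256 * (21 / 128 * sqrt \<alpha>) * real w / 15)) \<le> exp (- (21 * real l))" by simp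
  with 2 have "8 * 2 ^ n * exp (- (9 / 256 * (21 / 128 * sqrt \<alpha>) * real w / 15)) \<le> exp (3 * real l) * exp (- (21 * real l))"
    by (intro mult_mono) auto
  also have "\<dots> = exp (- 18 * real l)" by (simp add: exp_add[symmetric])
  finally show "8 * 2 ^ n * exp (- (9 / 256 * (21 / 128 * sqrt \<alpha>) * real w / 15)) \<le> exp (- 18 * real l)" .
  show "0 < w" using w_pos' by simp
qed (use S \<alpha> in auto)

lemma level_bounds:
  shows "level \<alpha> k \<le> 1" and "k \<le> scale_exp \<alpha> + 3 \<Longrightarrow> \<alpha> / 32 \<le> level \<alpha> k"
proof -
  have sq: "0 < sqrt \<alpha>" "sqrt \<alpha> < 1" "sqrt \<alpha> * sqrt \<alpha> = \<alpha>" using \<alpha> by auto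
  have "(1 :: real) \<le> 2 ^ k" by simp
  then have "sqrt \<alpha> * 1 \<le> 2 * 2 ^ k" using sq by (intro mult_mono) linarith+
  then show "level \<alpha> k \<le> 1" by (simp add: level_def field_simps)
  assume "k \<le> scale_exp \<alpha> + 3"
  then have "(2 :: real) ^ k \<le> 2 ^ (scale_exp \<alpha> + 3)" by (rule power_increasing) simp
  also have "\<dots> \<le> 16 / sqrt \<alpha>" using scale_bounds(2)[OF \<alpha>] by (simp add: power_add)
  finally have "2 ^ k * sqrt \<alpha> \<le> 16" using sq by (simp add: field_simps)
  then have "2 ^ k * sqrt \<alpha> * sqrt \<alpha> \<le> 16 * sqrt \<alpha>" using sq by (intro mult_right_mono) auto
  then have "2 ^ k * \<alpha> \<le> 16 * sqrt \<alpha>" by (simp only: mult.assoc sq(3))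
  then show "\<alpha> / 32 \<le> level \<alpha> k" by (simp add: level_def field_simps)
qed

lemma trials_cases:
  assumes "A \<in> set (trials \<alpha> l)"
  obtains "A = high_trial m w \<alpha>" | k where "k \<le> scale_exp \<alpha> + 3" "A = low_trial m w \<alpha> (level \<alpha> k)"
proof -
  have "A = high_trial m w \<alpha> \<or> (\<exists>k. k < scale_exp \<alpha> + 4 \<and> A = low_trial m w \<alpha> (level \<alpha> k))"
    using assms by (auto simp: trials_def)
  moreover have "k \<le> scale_exp \<alpha> + 3" if "k < scale_exp \<alpha> + 4" for k using that by simp
  ultimately show thesis using that by blast
qed

lemma length_trials: "length (trials \<alpha> l) \<le> 160 * (R ^ 2 * l)"
proof -
  \<comment> \<open>The logarithmic number of levels is absorbed by a factor \<open>R\<close>, which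
    is affordable because a low trial is repeated only about \<open>R * l\<close> times.\<close>
  have e: "scale_exp \<alpha> + 3 \<le> 4 * R"
  proof -
    have "e + 3 \<le> 4 * 2 ^ e" for e :: nat by (induction e) auto
    then show ?thesis by (simp add: scale_def)
  qed
  have "length (trials \<alpha> l) = 32 * (R ^ 2 * l) + (scale_exp \<alpha> + 3) * (32 * (R * l))"
    by (simp add: trials_def length_concat comp_def sum_list_triv)
  also have "\<dots> \<le> 32 * (R ^ 2 * l) + (4 * R) * (32 * (R * l))"
    using e by (intro add_mono mult_right_mono) auto
  finally show ?thesis by (simp add: power2_eq_square mult_ac)
qed

lemma trials_sound:
  "Pr (result S (first_success (trials \<alpha> l))) (Some ` {r. \<not> bsg_ok S \<alpha> r}) \<le> exp (- real l)"
proof -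
  let ?\<epsilon> = "exp (- 18 * real l)"
  have "Pr (result S (first_success (trials \<alpha> l))) (Some ` {r. \<not> bsg_ok S \<alpha> r})
      \<le> real (length (trials \<alpha> l)) * (5 * ?\<epsilon>)"
  proof (rule first_success_Some)
    fix A assume "A \<in> set (trials \<alpha> l)"
    then show "Pr (result S A) (Some ` {r. \<not> bsg_ok S \<alpha> r}) \<le> 5 * ?\<epsilon>"
    proof (cases rule: trials_cases)
      case 1
      have "3 * ?\<epsilon> \<le> 5 * ?\<epsilon>" by simp
      then show ?thesis unfolding 1 using high_trial_sound by (rule order_trans[rotated])
    next
      case (2 k)
      then show ?thesis using low_trial_sound level_bounds(2) by simp
    qed
  qed simp
  also have "\<dots> \<le> (160 * (4 * exp (real l) * exp (real l))) * (5 * ?\<epsilon>)"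
  proof (rule mult_right_mono)
    have "real (length (trials \<alpha> l)) \<le> real (160 * (R ^ 2 * l))" using length_trials by (simp only: of_nat_le_iff)
    also have "\<dots> = 160 * (real R ^ 2 * real l)" by simp
    also have "\<dots> \<le> 160 * (4 * exp (real l) * exp (real l))"
    proof (intro mult_left_mono mult_mono)
      have "4 / \<alpha> \<le> 4 / exp (- real l)" using l(2) \<alpha> by (intro divide_left_mono) auto
      then show "real R ^ 2 \<le> 4 * exp (real l)" using R_le by (simp add: exp_minus field_simps)
      show "real l \<le> exp (real l)" using exp_ge_add_one_self[of "real l"] by linarith
    qed auto
    finally show "real (length (trials \<alpha> l)) \<le> 160 * (4 * exp (real l) * exp (real l))" .
  qed simp
  also have "\<dots> = 3200 * exp (- 16 * real l)" by (simp add: exp_add[symmetric])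
  also have "\<dots> \<le> exp (15 * real l) * exp (- 16 * real l)"
  proof (rule mult_right_mono)
    have "(3200 :: real) \<le> 2 ^ 15" by simp
    also have "\<dots> \<le> exp (real 15)" by (rule exp_bounds)
    also have "\<dots> \<le> exp (15 * real l)" using l_pos by simp
    finally show "3200 \<le> exp (15 * real l)" .
  qed simp
  also have "\<dots> = exp (- real l)" by (simp add: exp_add[symmetric])
  finally show ?thesis .
qed

text \<open>The sampling errors of a trial, up to five times \<open>exp (- 18 * l)\<close>, then
  cost at most half of its success probability \<open>\<alpha> / 16\<close> or
  \<open>sqrt \<alpha> / 16\<close>.\<close>

lemma small_error: "160 * exp (- 18 * real l) \<le> \<alpha>"
proof -
  have "(160 :: real) \<le> 2 ^ 17" by simp
  also have "\<dots> \<le> exp (real 17)" by (rule exp_bounds)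
  also have "\<dots> \<le> exp (17 * real l)" using l_pos by simp
  finally have "160 * exp (- 18 * real l) \<le> exp (17 * real l) * exp (- 18 * real l)" by (intro mult_right_mono) auto
  also have "\<dots> = exp (- real l)" by (simp add: exp_add[symmetric])
  finally show ?thesis using l(2) by linarith
qed

lemma repeated_failure:
  assumes "Pr (result S A) {None} \<le> 1 - q / 32" "0 \<le> q" "1 \<le> q * real c"
  shows "Pr (result S (first_success (replicate (32 * (c * l)) A))) {None} \<le> exp (- real l)"
proof -
  have "Pr (result S (first_success (replicate (32 * (c * l)) A))) {None}
      = Pr (result S A) {None} ^ (32 * (c * l))"
    by (rule first_success_replicate_None)
  also have "\<dots> \<le> exp (- (q / 32)) ^ (32 * (c * l))"
    using assms(1) exp_ge_add_one_self[of "- (q / 32)"] by (intro power_mono) auto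
  also have "\<dots> = exp (- (q * real c * real l))" by (simp add: exp_of_nat_mult[symmetric] mult_ac)
  also have "\<dots> \<le> exp (- real l)" using mult_right_mono[OF assms(3), of "real l"] by simp
  finally show ?thesis .
qed

lemma trials_complete:
  assumes E: "\<alpha> * real (card S) ^ 3 \<le> real (energy S)"
  shows "Pr (result S (first_success (trials \<alpha> l))) {None} \<le> exp (- real l)"
  using S \<alpha>(1) E scale_bounds[OF \<alpha>]
proof (cases rule: energy_dichotomy)
  case high
  let ?A = "high_trial m w \<alpha>"
  have "Pr (result S (first_success (trials \<alpha> l))) {None}
      \<le> Pr (result S (first_success (replicate (32 * (R ^ 2 * l)) ?A))) {None}"
    using first_success_sublist_None[of S "[]"] by (simp only: trials_def append_Nil)
  also have "\<dots> \<le> exp (- real l)"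
    by (rule repeated_failure[of _ \<alpha>])
       (use high_trial_complete[OF high] small_error \<alpha> R_ge(2) in auto)
  finally show ?thesis .
next
  case (low k)
  let ?A = "\<lambda>k. low_trial m w \<alpha> (level \<alpha> k)"
  have "k \<in> set [1..<scale_exp \<alpha> + 4]" using low(1) by auto
  then obtain xs ys where ks: "[1..<scale_exp \<alpha> + 4] = xs @ k # ys" using split_list by metis
  have "trials \<alpha> l = (replicate (32 * (R ^ 2 * l)) (high_trial m w \<alpha>) @ concat (map (\<lambda>k. replicate (32 * (R * l)) (?A k)) xs))
      @ replicate (32 * (R * l)) (?A k) @ concat (map (\<lambda>k. replicate (32 * (R * l)) (?A k)) ys)"
    by (simp only: trials_def ks map_append list.map concat_append concat.simps append_assoc)
  then have "Pr (result S (first_success (trials \<alpha> l))) {None}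
      \<le> Pr (result S (first_success (replicate (32 * (R * l)) (?A k)))) {None}"
    by (simp only: first_success_sublist_None)
  also have "\<dots> \<le> exp (- real l)"
  proof (rule repeated_failure[of _ "sqrt \<alpha>"])
    have sq: "0 < sqrt \<alpha>" using \<alpha> by simp
    have "\<alpha> \<le> sqrt \<alpha>"
    proof -
      have "sqrt \<alpha> * sqrt \<alpha> \<le> sqrt \<alpha> * 1" using \<alpha> by (intro mult_left_mono) auto
      then show ?thesis using \<alpha> by simp
    qed
    moreover have "Pr (result S (?A k)) {None} \<le> (1 - sqrt \<alpha> / 16) + 5 * exp (- 18 * real l)"
      using low by (intro low_trial_complete level_bounds(2)) (auto simp: level_def)
    ultimately show "Pr (result S (?A k)) {None} \<le> 1 - sqrt \<alpha> / 32"
      using small_error by linarith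
    show "0 \<le> sqrt \<alpha>" using sq by simp
    show "1 \<le> sqrt \<alpha> * real R" by (rule R_ge(1))
  qed
  finally show ?thesis .
qed

lemma trials_wf:
  assumes "Some r \<in> set_pmf (result S (first_success (trials \<alpha> l)))"
  shows "cleaning_wf n m w S r"
proof -
  obtain A where A: "A \<in> set (trials \<alpha> l)" "Some r \<in> set_pmf (result S A)"
    using set_first_success[OF assms] by blast
  from A(1) show ?thesis
  proof (cases rule: trials_cases)
    case 1
    then show ?thesis using A(2) high_trial_wf by simp
  next
    case (2 k)
    then show ?thesis using A(2) low_trial_wf[OF level_bounds(1)] by simp
  qed
qed

lemma trials_cost:
  "cost_le S (first_success (trials \<alpha> l)) (160 * (R ^ 2 * l) * (8 * m)) (160 * (R ^ 2 * l) * (10 * (w * m) ^ 2))"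
proof -
  have "cost_le S A (8 * m) (10 * (w * m) ^ 2)" if "A \<in> set (trials \<alpha> l)" for A
    using that
  proof (cases rule: trials_cases)
    case 1
    show ?thesis unfolding 1
      by (rule cost_le_mono[OF cost_le_high_trial[OF m_pos]]) (use w_le_m m_pos in auto)
  next
    case (2 k)
    show ?thesis unfolding 2
      by (rule cost_le_mono[OF cost_le_low_trial[OF m_pos level_bounds(1)]]) (use w_le_m m_pos in auto)
  qed
  then have "cost_le S (first_success (trials \<alpha> l)) (length (trials \<alpha> l) * (8 * m)) (length (trials \<alpha> l) * (10 * (w * m) ^ 2))"
    by (rule cost_le_first_success)
  then show ?thesis
    by (rule cost_le_mono) (intro mult_right_mono length_trials; simp)+
qed

end

definition bsg_algorithm :: "nat \<Rightarrow> real \<Rightarrow> real \<Rightarrow> real \<Rightarrow> bits option ralg" where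
  "bsg_algorithm n \<alpha> \<rho>snd \<rho>cmp = (if n = 0 then Return (Some [])
     else rbind (first_success (trials \<alpha> (nat \<lceil>Lam n \<alpha> \<rho>snd \<rho>cmp\<rceil>))) (\<lambda>r. Return (map_option encode r)))"

section \<open>Interpretation of records\<close>

definition decode :: "bits \<Rightarrow> cleaning" where
  "decode = inv_into UNIV encode"

lemma decode_encode [simp]: "decode (encode r) = r"
  by (simp add: decode_def inj_encode)

fun branch_of_cleaning :: "cleaning \<Rightarrow> branch" where
  "branch_of_cleaning (Cleaning (Difference d) \<tau> bs zs) = High d"
| "branch_of_cleaning (Cleaning (Centre a ss \<sigma>) \<tau> bs zs) = Low a (popular ss \<sigma>)"

text \<open>In dimension zero the length bound leaves room for the empty record only; no encoding is empty.\<close>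

definition branch_of_record :: "bits \<Rightarrow> branch" where
  "branch_of_record D = (if D = [] then High (0\<^sub>v 0) else branch_of_cleaning (decode D))"

definition eval_record :: "bits \<Rightarrow> point \<Rightarrow> bool dtree" where
  "eval_record D x = (if D = [] then Ask x Answer else member (decode D) x)"

definition record_ok :: "nat \<Rightarrow> point set \<Rightarrow> real \<Rightarrow> bits \<Rightarrow> bool" where
  "record_ok n S \<alpha> D \<longleftrightarrow> (let Y = Yset eval_record n S D in
     c_BSG * sqrt \<alpha> * real (card S) \<le> real (card Y) \<and>
     real (card (Y + Y)) \<le> C_BSG * \<alpha> powi (-4) * real (card Y) \<and>
     (is_high (branch_of_record D) \<longrightarrow> real (card (Y + Y)) \<le> C_BSG_H * \<alpha> powi (-3) * real (card Y)))"

lemma Yset_encode: "S \<subseteq> F2 n \<Longrightarrow> Yset eval_record n S (encode r) = cleaned S r"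
proof -
  assume S: "S \<subseteq> F2 n"
  obtain sd \<tau> bs zs where "r = Cleaning sd \<tau> bs zs" by (cases r)
  then have "cleaned S r \<subseteq> F2 n" using cleaned_subset base_of_subset S by blast
  then show ?thesis by (auto simp: Yset_def eval_record_def encode_nonempty cleaned_def)
qed

lemma record_ok_encode:
  assumes "S \<subseteq> F2 n" "bsg_ok S \<alpha> r"
  shows "record_ok n S \<alpha> (encode r)"
proof -
  obtain sd \<tau> bs zs where r: "r = Cleaning sd \<tau> bs zs" by (cases r)
  have "is_high (branch_of_record (encode r)) \<Longrightarrow> \<exists>d \<tau> bs zs. r = Cleaning (Difference d) \<tau> bs zs"
    by (cases sd) (auto simp: branch_of_record_def encode_nonempty r is_high_def)
  then show ?thesis
    using assms(2) by (simp add: record_ok_def Yset_encode[OF assms(1)] bsg_ok_def)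
qed

lemma cleaned_subset_branch:
  assumes S: "S \<subseteq> F2 n" and wf: "cleaning_wf n m w S r"
  shows "valid_branch n S (branch_of_cleaning r)" "cleaned S r \<subseteq> base_set S (branch_of_cleaning r)"
proof -
  obtain sd \<tau> bs zs where r: "r = Cleaning sd \<tau> bs zs" by (cases r)
  have sub: "cleaned S r \<subseteq> base_of S sd" unfolding r by (rule cleaned_subset)
  show "valid_branch n S (branch_of_cleaning r)" using wf by (cases sd) (auto simp: r)
  show "cleaned S r \<subseteq> base_set S (branch_of_cleaning r)"
  proof (cases sd)
    case (Difference d)
    \<comment> \<open>Converts the membership \<open>x + d \<in> S\<close> tested by the algorithm
      into membership in the translate \<open>S + d\<close>.\<close>
    have "x = (x + d) + d" if "x \<in> S" for x
    proof -
      have x: "x \<in> F2 n" and d: "d \<in> F2 n" using that S wf by (auto simp: r Difference)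
      have "(x + d) + d = d + (d + x)" using x d by (simp add: comm_add_vec[of x n d] comm_add_vec[of "d + x" n d])
      then show ?thesis using F2_cancel[OF d x] by simp
    qed
    then show ?thesis using sub by (auto simp: r Difference base_of_def)
  next
    case (Centre a ss \<sigma>)
    then show ?thesis using sub by (auto simp: r base_of_def)
  qed
qed

lemma exp_le_of_log:
  assumes "0 < x" "log 2 (1 / x) \<le> real l"
  shows "exp (- real l) \<le> x"
proof -
  have "ln (1 / x) = log 2 (1 / x) * ln 2" by (simp add: log_def)
  also have "\<dots> \<le> real l * 1"
    using assms(2) ln2_le_25_over_36 by (intro mult_mono) auto
  finally have "- ln x \<le> real l" using assms(1) by (simp add: ln_div)
  then have "exp (- real l) \<le> exp (ln x)" by simp
  then show ?thesis using assms(1) by simp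
qed

lemma prob_map_option:
  "Pr (result S (rbind A (\<lambda>r. Return (map_option f r)))) B
    = Pr (result S A) {r. map_option f r \<in> B}"
proof -
  have "result S (rbind A (\<lambda>r. Return (map_option f r))) = map_pmf (map_option f) (result S A)"
    by (simp add: map_pmf_def)
  then show ?thesis by (simp add: vimage_def)
qed

text \<open>One integer \<open>l\<close> of order \<open>\<Lambda>\<close> dominates the dimension
  and serves as exponent for \<open>\<alpha>\<close> and both error probabilities.\<close>

lemma Lam_bounds:
  fixes n :: nat and \<alpha> \<rho>snd \<rho>cmp :: real
  assumes "0 < \<alpha>" "\<alpha> < 1" "0 < \<rho>snd" "\<rho>snd < 1" "0 < \<rho>cmp" "\<rho>cmp < 1"
  defines "L \<equiv> Lam n \<alpha> \<rho>snd \<rho>cmp"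
  defines "l \<equiv> nat \<lceil>L\<rceil>"
  shows "1 \<le> L" "n + 1 \<le> l" "real l \<le> 2 * L"
    "exp (- real l) \<le> \<alpha>" "exp (- real l) \<le> \<rho>snd" "exp (- real l) \<le> \<rho>cmp"
proof -
  have logs: "0 \<le> log 2 (1 / \<alpha>)" "0 \<le> log 2 (1 / \<rho>snd)" "0 \<le> log 2 (1 / \<rho>cmp)"
    using assms by auto
  have L: "1 + real n \<le> L" "log 2 (1 / \<alpha>) \<le> L" "log 2 (1 / \<rho>snd) \<le> L" "log 2 (1 / \<rho>cmp) \<le> L"
    using logs by (auto simp: L_def Lam_def)
  show 1: "1 \<le> L" using L(1) by simp
  have l: "L \<le> real l" "real l \<le> L + 1" using 1 by (auto simp: l_def)
  show "n + 1 \<le> l" using L(1) l(1) by linarith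
  show "real l \<le> 2 * L" using l(2) 1 by linarith
  show "exp (- real l) \<le> \<alpha>" by (rule exp_le_of_log[OF assms(1)]) (use L l(1) in linarith)
  show "exp (- real l) \<le> \<rho>snd" by (rule exp_le_of_log[OF assms(3)]) (use L l(1) in linarith)
  show "exp (- real l) \<le> \<rho>cmp" by (rule exp_le_of_log[OF assms(5)]) (use L l(1) in linarith)
qed

context bsg_run
begin

lemma R_powers: "real R ^ 4 \<le> 16 * (1 / \<alpha> ^ 2)" "real R ^ 8 \<le> 256 * (1 / \<alpha> ^ 4)" "real R ^ 2 \<le> 4 * (1 / \<alpha> ^ 2)"
proof -
  have "(real R ^ 2) ^ 2 \<le> (4 / \<alpha>) ^ 2" using R_le by (intro power_mono) auto
  then show "real R ^ 4 \<le> 16 * (1 / \<alpha> ^ 2)" by (simp add: power_mult[symmetric] power_divide)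
  have "(real R ^ 2) ^ 4 \<le> (4 / \<alpha>) ^ 4" using R_le by (intro power_mono) auto
  then show "real R ^ 8 \<le> 256 * (1 / \<alpha> ^ 4)" by (simp add: power_mult[symmetric] power_divide)
  have "\<alpha> ^ 2 \<le> \<alpha>" using \<alpha> by (simp add: power2_eq_square mult_left_le)
  then have "4 / \<alpha> \<le> 4 / \<alpha> ^ 2" using \<alpha> by (intro divide_left_mono) auto
  then show "real R ^ 2 \<le> 4 * (1 / \<alpha> ^ 2)" using R_le by simp
qed

text \<open>In powers of \<open>R\<close> and \<open>l\<close>, the samples are
  \<open>R ^ 4 * l ^ 2\<close>, the queries \<open>R ^ 8 * l ^ 5\<close>, a membership test
  \<open>R ^ 5 * l ^ 3\<close> and a record \<open>n * R ^ 2 * l\<close>. As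
  \<open>R ^ 2 \<le> 4 / \<alpha>\<close>, only the query bound uses its full exponents.\<close>

lemma resource_bounds:
  assumes L: "real l \<le> 2 * L" "1 \<le> L"
  shows "real (160 * (R ^ 2 * l) * (8 * m)) \<le> 2 ^ 120 * \<alpha> powi (-2) * L ^ 4"
    and "real (160 * (R ^ 2 * l) * (10 * (w * m) ^ 2)) \<le> 2 ^ 120 * \<alpha> powi (-4) * L ^ 5"
    and "real (6 * (w * m ^ 2)) \<le> 2 ^ 120 * \<alpha> powi (-4) * L ^ 3"
    and "real (40 * (n * m)) \<le> 2 ^ 120 * real n * \<alpha> powi (-2) * L"
proof -
  have p: "\<alpha> powi (-2) = 1 / \<alpha> ^ 2" "\<alpha> powi (-4) = 1 / \<alpha> ^ 4"
    by (simp_all add: power_int_minus field_simps)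
  have inv: "0 \<le> 1 / \<alpha> ^ 2" "0 \<le> 1 / \<alpha> ^ 4" using \<alpha> by auto
  have lk: "real l ^ k \<le> 2 ^ k * L ^ k" for k
    using power_mono[OF L(1), of k] by (simp add: power_mult_distrib)
  have Rp: "1 \<le> real R" using R_pos by simp
  have alg: "160 * (r ^ 2 * x) * (8 * (c * (r ^ 2 * x))) = 1280 * c * (r ^ 4 * x ^ 2)"
    "160 * (r ^ 2 * x) * (10 * (c * (r * x) * (c * (r ^ 2 * x))) ^ 2) = 1600 * c ^ 4 * (r ^ 8 * x ^ 5)"
    "6 * (c * (r * x) * (c * (r ^ 2 * x)) ^ 2) = 6 * c ^ 3 * (r ^ 5 * x ^ 3)" for r x c :: real
    by (simp_all add: eval_nat_numeral mult_ac)
  have "real (160 * (R ^ 2 * l) * (8 * m)) = 1280 * 2 ^ 24 * (real R ^ 4 * real l ^ 2)"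
    using alg(1)[where r = "real R" and x = "real l" and c = "2 ^ 24"] by (simp add: big_sample_def)
  also have "\<dots> \<le> 1280 * 2 ^ 24 * ((16 * (1 / \<alpha> ^ 2)) * (2 ^ 2 * L ^ 4))"
  proof (intro mult_left_mono mult_mono R_powers)
    have "L ^ 2 \<le> L ^ 4" using L(2) by (intro power_increasing) auto
    then show "real l ^ 2 \<le> 2 ^ 2 * L ^ 4" using lk[of 2] by simp
  qed (use inv in auto)
  also have "\<dots> = (1280 * 2 ^ 24 * 64) * (1 / \<alpha> ^ 2 * L ^ 4)" by simp
  also have "\<dots> \<le> 2 ^ 120 * (1 / \<alpha> ^ 2 * L ^ 4)"
    using inv L(2) by (intro mult_right_mono) auto
  finally show "real (160 * (R ^ 2 * l) * (8 * m)) \<le> 2 ^ 120 * \<alpha> powi (-2) * L ^ 4" by (simp only: p mult.assoc)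
  have "real (160 * (R ^ 2 * l) * (10 * (w * m) ^ 2)) = 1600 * 2 ^ 96 * (real R ^ 8 * real l ^ 5)"
    using alg(2)[where r = "real R" and x = "real l" and c = "2 ^ 24"] by (simp add: big_sample_def small_sample_def)
  also have "\<dots> \<le> 1600 * 2 ^ 96 * ((256 * (1 / \<alpha> ^ 4)) * (2 ^ 5 * L ^ 5))"
    using inv by (intro mult_left_mono mult_mono R_powers lk) auto
  also have "\<dots> = (1600 * 2 ^ 96 * 8192) * (1 / \<alpha> ^ 4 * L ^ 5)" by simp
  also have "\<dots> \<le> 2 ^ 120 * (1 / \<alpha> ^ 4 * L ^ 5)"
    using inv L(2) by (intro mult_right_mono) auto
  finally show "real (160 * (R ^ 2 * l) * (10 * (w * m) ^ 2)) \<le> 2 ^ 120 * \<alpha> powi (-4) * L ^ 5" by (simp only: p mult.assoc)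
  have "real (6 * (w * m ^ 2)) = 6 * 2 ^ 72 * (real R ^ 5 * real l ^ 3)"
    using alg(3)[where r = "real R" and x = "real l" and c = "2 ^ 24"] by (simp add: big_sample_def small_sample_def)
  also have "\<dots> \<le> 6 * 2 ^ 72 * ((256 * (1 / \<alpha> ^ 4)) * (2 ^ 3 * L ^ 3))"
  proof (intro mult_left_mono mult_mono lk)
    have "real R ^ 5 \<le> real R ^ 8" using Rp by (intro power_increasing) auto
    then show "real R ^ 5 \<le> 256 * (1 / \<alpha> ^ 4)" using R_powers(2) by linarith
  qed (use inv in auto)
  also have "\<dots> = (6 * 2 ^ 72 * 2048) * (1 / \<alpha> ^ 4 * L ^ 3)" by simp
  also have "\<dots> \<le> 2 ^ 120 * (1 / \<alpha> ^ 4 * L ^ 3)"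
    using inv L(2) by (intro mult_right_mono) auto
  finally show "real (6 * (w * m ^ 2)) \<le> 2 ^ 120 * \<alpha> powi (-4) * L ^ 3" by (simp only: p mult.assoc)
  have "real (40 * (n * m)) = 40 * 2 ^ 24 * real n * (real R ^ 2 * real l)"
    by (simp add: big_sample_def)
  also have "\<dots> \<le> 40 * 2 ^ 24 * real n * ((4 * (1 / \<alpha> ^ 2)) * (2 * L))"
    using inv L by (intro mult_left_mono mult_mono R_powers) auto
  also have "\<dots> = (320 * 2 ^ 24) * (real n * (1 / \<alpha> ^ 2 * L))" by simp
  also have "\<dots> \<le> 2 ^ 120 * (real n * (1 / \<alpha> ^ 2 * L))"
    using inv L(2) by (intro mult_right_mono) auto
  finally show "real (40 * (n * m)) \<le> 2 ^ 120 * real n * \<alpha> powi (-2) * L" by (simp only: p mult.assoc)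
qed

end

section \<open>Assembling the specification\<close>

definition meets_spec :: "nat \<Rightarrow> point set \<Rightarrow> real \<Rightarrow> real \<Rightarrow> real \<Rightarrow> bool" where
  "meets_spec n S \<alpha> \<rho>snd \<rho>cmp \<longleftrightarrow>
     (let A = bsg_algorithm n \<alpha> \<rho>snd \<rho>cmp; P = result S A; Y = Yset eval_record n S; L = Lam n \<alpha> \<rho>snd \<rho>cmp in
      (\<forall>D. Some D \<in> set_pmf P \<longrightarrow> Y D \<subseteq> S \<and> valid_branch n S (branch_of_record D) \<and>
         Y D \<subseteq> base_set S (branch_of_record D)) \<and>
      Pr P (Some ` {D. \<not> record_ok n S \<alpha> D}) \<le> \<rho>snd \<and>
      (\<alpha> * real (card S) ^ 3 \<le> real (energy S) \<longrightarrow> Pr P {None} \<le> \<rho>cmp) \<and>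
      (\<forall>(out, samples, queries) \<in> set_pmf (run S A).
         real samples \<le> 2 ^ 120 * \<alpha> powi (-2) * L ^ 4 \<and> real queries \<le> 2 ^ 120 * \<alpha> powi (-4) * L ^ 5) \<and>
      (\<forall>D. Some D \<in> set_pmf P \<longrightarrow>
         (\<forall>x \<in> F2 n. real (dcost S (eval_record D x)) \<le> 2 ^ 120 * \<alpha> powi (-4) * L ^ 3) \<and>
         real (length D) \<le> 2 ^ 120 * real n * \<alpha> powi (-2) * L))"

lemma meets_spec_pos:
  assumes S: "S \<subseteq> F2 n" "S \<noteq> {}" and n: "n \<noteq> 0"
    and par: "0 < \<alpha>" "\<alpha> < 1" "0 < \<rho>snd" "\<rho>snd < 1" "0 < \<rho>cmp" "\<rho>cmp < 1"
  shows "meets_spec n S \<alpha> \<rho>snd \<rho>cmp"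
proof -
  define L where "L = Lam n \<alpha> \<rho>snd \<rho>cmp"
  define l where "l = nat \<lceil>L\<rceil>"
  note lam = Lam_bounds[OF par, of n, folded L_def, folded l_def]
  interpret bsg_run n S \<alpha> l
    by unfold_locales (use S par lam in auto)
  define T where "T = first_success (trials \<alpha> l)"
  define A where "A = rbind T (\<lambda>r. Return (map_option encode r))"
  have A: "bsg_algorithm n \<alpha> \<rho>snd \<rho>cmp = A"
    using n by (simp add: bsg_algorithm_def A_def T_def l_def L_def)
  note bounds = resource_bounds[OF lam(3,1)]
  have rec: "\<exists>r. D = encode r \<and> cleaning_wf n m w S r" if D: "Some D \<in> set_pmf (result S A)" for D
  proof -
    obtain x where "x \<in> set_pmf (result S T)" "Some D = map_option encode x"
      using D unfolding A_def by auto
    then show ?thesis using trials_wf unfolding T_def by (cases x) auto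
  qed
  have 1: "Yset eval_record n S D \<subseteq> S \<and> valid_branch n S (branch_of_record D) \<and>
      Yset eval_record n S D \<subseteq> base_set S (branch_of_record D)" if D: "Some D \<in> set_pmf (result S A)" for D
  proof -
    obtain r where r: "D = encode r" "cleaning_wf n m w S r" using rec[OF D] by blast
    have b: "branch_of_record D = branch_of_cleaning r" by (simp add: branch_of_record_def encode_nonempty r(1))
    have "base_set S B \<subseteq> S" for B by (cases B) auto
    then show ?thesis
      using cleaned_subset_branch[OF S(1) r(2)] unfolding b unfolding r(1) Yset_encode[OF S(1)] by blast
  qed
  have 2: "Pr (result S A) (Some ` {D. \<not> record_ok n S \<alpha> D}) \<le> \<rho>snd"
  proof -
    have "Pr (result S A) (Some ` {D. \<not> record_ok n S \<alpha> D})
        \<le> Pr (result S T) (Some ` {r. \<not> bsg_ok S \<alpha> r})"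
      unfolding A_def prob_map_option
    proof (intro measure_pmf.finite_measure_mono subsetI)
      fix ro assume "ro \<in> {r. map_option encode r \<in> Some ` {D. \<not> record_ok n S \<alpha> D}}"
      then show "ro \<in> Some ` {r. \<not> bsg_ok S \<alpha> r}"
        using record_ok_encode[OF S(1)] by (cases ro) auto
    qed simp
    also have "\<dots> \<le> exp (- real l)" unfolding T_def by (rule trials_sound)
    finally show ?thesis using lam(5) by linarith
  qed
  have 3: "Pr (result S A) {None} \<le> \<rho>cmp" if "\<alpha> * real (card S) ^ 3 \<le> real (energy S)"
  proof -
    have "{r. map_option encode r \<in> {None}} = {None}" by auto
    then have "Pr (result S A) {None} = Pr (result S T) {None}"
      unfolding A_def prob_map_option by simp
    also have "\<dots> \<le> exp (- real l)" unfolding T_def by (rule trials_complete[OF that])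
    finally show ?thesis using lam(6) by linarith
  qed
  have "cost_le S A (160 * (R ^ 2 * l) * (8 * m) + 0) (160 * (R ^ 2 * l) * (10 * (w * m) ^ 2) + 0)"
    unfolding A_def T_def by (rule cost_le_rbind[OF trials_cost]) simp
  then have cost: "cost_le S A (160 * (R ^ 2 * l) * (8 * m)) (160 * (R ^ 2 * l) * (10 * (w * m) ^ 2))"
    by (simp only: add_0_right)
  have 4: "case p of (out, samples, queries) \<Rightarrow> real samples \<le> 2 ^ 120 * \<alpha> powi (-2) * L ^ 4 \<and>
      real queries \<le> 2 ^ 120 * \<alpha> powi (-4) * L ^ 5" if p: "p \<in> set_pmf (run S A)" for p
  proof -
    obtain out s q where pe: "p = (out, s, q)" by (rule prod_cases3)
    have "s \<le> 160 * (R ^ 2 * l) * (8 * m) \<and> q \<le> 160 * (R ^ 2 * l) * (10 * (w * m) ^ 2)"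
      using bspec[OF cost[unfolded cost_le_def] p] unfolding pe prod.case .
    then have "real s \<le> real (160 * (R ^ 2 * l) * (8 * m))" "real q \<le> real (160 * (R ^ 2 * l) * (10 * (w * m) ^ 2))"
      unfolding of_nat_le_iff by blast+
    then show ?thesis unfolding pe prod.case using bounds(1,2) by (blast intro: order_trans)
  qed
  have 5: "(\<forall>x \<in> F2 n. real (dcost S (eval_record D x)) \<le> 2 ^ 120 * \<alpha> powi (-4) * L ^ 3) \<and>
      real (length D) \<le> 2 ^ 120 * real n * \<alpha> powi (-2) * L" if D: "Some D \<in> set_pmf (result S A)" for D
  proof -
    obtain r where r: "D = encode r" "cleaning_wf n m w S r" using rec[OF D] by blast
    have "real (dcost S (eval_record D x)) \<le> real (6 * (w * m ^ 2))" for x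
      unfolding of_nat_le_iff eval_record_def using dcost_member_wf[OF r(2) m_pos w_pos'] encode_nonempty
      by (simp add: r(1))
    moreover have "real (length D) \<le> real (40 * (n * m))"
      unfolding of_nat_le_iff r(1) by (rule length_encode[OF r(2) S(1) _ w_le_m m_pos]) (use n in simp)
    ultimately show ?thesis using bounds(3,4) by (meson order_trans)
  qed
  show ?thesis
    unfolding meets_spec_def Let_def A L_def[symmetric] using 1 2 3 4 5 by blast
qed

text \<open>The cube is a single point, so \<open>S\<close> equals its sumset and can be returned
  whole, tagged with the zero difference.\<close>

lemma meets_spec_zero:
  assumes S: "S \<subseteq> F2 0" "S \<noteq> {}"
    and par: "0 < \<alpha>" "\<alpha> < 1" "0 < \<rho>snd" "\<rho>snd < 1" "0 < \<rho>cmp" "\<rho>cmp < 1"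
  shows "meets_spec 0 S \<alpha> \<rho>snd \<rho>cmp"
proof -
  define z :: point where "z = 0\<^sub>v 0"
  have "x = z" if "x \<in> F2 0" for x :: point
    using that by (intro eq_vecI) (auto simp: z_def)
  then have F: "F2 0 = {z}" by (auto simp: z_def)
  then have Sz: "S = {z}" using S by auto
  have zz: "z + z = z" unfolding z_def by (rule left_zero_vec[OF zero_carrier_vec])
  have Y: "Yset eval_record 0 S [] = S" using S(1) by (auto simp: Yset_def eval_record_def)
  have YY: "S + S = S" using zz by (auto simp: Sz set_plus_def)
  have L: "1 \<le> Lam 0 \<alpha> \<rho>snd \<rho>cmp" by (rule Lam_bounds(1)[OF par])
  have inv: "1 \<le> \<alpha> powi (-4)" "1 \<le> \<alpha> powi (-3)" "1 \<le> \<alpha> powi (-2)"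
    using par power_le_one[of \<alpha>] by (auto simp: power_int_minus field_simps)
  have sq: "21 / 128 * sqrt \<alpha> \<le> 1" using par real_sqrt_le_1_iff[of \<alpha>] by linarith
  have ok: "record_ok 0 S \<alpha> []"
    unfolding record_ok_def Let_def Y YY using sq inv by (simp add: Sz c_BSG_def C_BSG_def C_BSG_H_def)
  have "1 * 1 \<le> \<alpha> powi (-4) * Lam 0 \<alpha> \<rho>snd \<rho>cmp ^ 3"
    using inv L by (intro mult_mono) auto
  then have cost: "1 \<le> 2 ^ 120 * (\<alpha> powi (-4) * Lam 0 \<alpha> \<rho>snd \<rho>cmp ^ 3)" by simp
  show ?thesis
    unfolding meets_spec_def Let_def bsg_algorithm_def
    using ok cost inv L S Y zz par
    by (auto simp: branch_of_record_def eval_record_def Sz z_def indicator_def mult.assoc image_iff)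
qed

theorem theorem4p1:
  shows "\<exists>(alg :: nat \<Rightarrow> real \<Rightarrow> real \<Rightarrow> real \<Rightarrow> bits option ralg)
      (branch_of :: bits \<Rightarrow> branch)
      (mem :: bits \<Rightarrow> point \<Rightarrow> bool dtree)
      (K1 :: real) (K2 :: real) (K3 :: real) (K4 :: real).
    \<forall>(n :: nat) (S :: point set) (\<alpha> :: real) (\<rho>snd :: real) (\<rho>cmp :: real).
      S \<subseteq> F2 n \<longrightarrow> S \<noteq> {} \<longrightarrow>
      0 < \<alpha> \<longrightarrow> \<alpha> < 1 \<longrightarrow> 0 < \<rho>snd \<longrightarrow> \<rho>snd < 1 \<longrightarrow> 0 < \<rho>cmp \<longrightarrow> \<rho>cmp < 1 \<longrightarrow>
      (let A = alg n \<alpha> \<rho>snd \<rho>cmp;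
           P = result S A;
           Y = Yset mem n S;
           L = Lam n \<alpha> \<rho>snd \<rho>cmp
       in
         \<comment> \<open>records\<close>
         (\<forall>D. Some D \<in> set_pmf P \<longrightarrow>
            Y D \<subseteq> S \<and> valid_branch n S (branch_of D) \<and> Y D \<subseteq> base_set S (branch_of D)) \<and>
         \<comment> \<open>soundness\<close>
         (\<exists>G. measure_pmf.prob P G \<ge> 1 - \<rho>snd \<and>
            (\<forall>D. Some D \<in> G \<longrightarrow>
               real (card (Y D)) \<ge> c_BSG * sqrt \<alpha> * real (card S) \<and>
               real (card (Y D + Y D)) \<le> C_BSG * \<alpha> powi (-4) * real (card (Y D)) \<and>
               (is_high (branch_of D) \<longrightarrow>
                  real (card (Y D + Y D)) \<le> C_BSG_H * \<alpha> powi (-3) * real (card (Y D))))) \<and>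
         measure_pmf.prob P {Some D |D.
             real (card (Y D)) < c_BSG * sqrt \<alpha> * real (card S) \<or>
             real (card (Y D + Y D)) > C_BSG * \<alpha> powi (-4) * real (card (Y D))} \<le> \<rho>snd \<and>
         \<comment> \<open>completeness\<close>
         (real (energy S) \<ge> \<alpha> * real (card S) ^ 3 \<longrightarrow> measure_pmf.prob P {None} \<le> \<rho>cmp) \<and>
         \<comment> \<open>resources, on every run\<close>
         (\<forall>(out, samples, queries) \<in> set_pmf (run S A).
            real samples \<le> K1 * \<alpha> powi (-2) * L ^ 4 \<and>
            real queries \<le> K2 * \<alpha> powi (-4) * L ^ 5) \<and>
         (\<forall>D. Some D \<in> set_pmf P \<longrightarrow>
            (\<forall>x \<in> F2 n. real (dcost S (mem D x)) \<le> K3 * \<alpha> powi (-4) * L ^ 3) \<and>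
            real (length D) \<le> K4 * real n * \<alpha> powi (-2) * L))"
proof -
  have spec: "meets_spec n S \<alpha> \<rho>snd \<rho>cmp"
    if "S \<subseteq> F2 n" "S \<noteq> {}" "0 < \<alpha>" "\<alpha> < 1" "0 < \<rho>snd" "\<rho>snd < 1" "0 < \<rho>cmp" "\<rho>cmp < 1"
    for n S and \<alpha> \<rho>snd \<rho>cmp :: real
    using that meets_spec_pos meets_spec_zero by (cases "n = 0") auto
  show ?thesis
  proof (rule exI[of _ bsg_algorithm], rule exI[of _ branch_of_record], rule exI[of _ eval_record],
      rule exI[of _ "2 ^ 120"], rule exI[of _ "2 ^ 120"], rule exI[of _ "2 ^ 120"], rule exI[of _ "2 ^ 120"],
      intro allI impI, goal_cases)
    case (1 n S \<alpha> \<rho>snd \<rho>cmp)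
    let ?P = "result S (bsg_algorithm n \<alpha> \<rho>snd \<rho>cmp)"
    let ?bad = "Some ` {D. \<not> record_ok n S \<alpha> D}"
    note sp = spec[OF 1, unfolded meets_spec_def Let_def]
    then have bad: "Pr ?P ?bad \<le> \<rho>snd" by blast
    show ?case
      unfolding Let_def
    proof (intro conjI, goal_cases)
      case 1
      then show ?case using sp by blast
    next
      case 2
      \<comment> \<open>The complement of \<open>?bad\<close> is the witness for the event
        \<open>G\<close>.\<close>
      have "1 - \<rho>snd \<le> Pr ?P (- ?bad)"
        using bad measure_pmf.prob_compl[of ?bad ?P] by (simp add: Compl_eq_Diff_UNIV)
      moreover have "record_ok n S \<alpha> D" if "Some D \<in> - ?bad" for D using that by auto
      ultimately show ?case unfolding record_ok_def Let_def by blast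
    next
      case 3
      have "{Some D |D. real (card (Yset eval_record n S D)) < c_BSG * sqrt \<alpha> * real (card S) \<or>
          C_BSG * \<alpha> powi (-4) * real (card (Yset eval_record n S D))
            < real (card (Yset eval_record n S D + Yset eval_record n S D))} \<subseteq> ?bad"
        by (auto simp: record_ok_def Let_def)
      then show ?case
        using bad by (intro order_trans[OF measure_pmf.finite_measure_mono bad]) auto
    next
      case 4
      then show ?case using sp by blast
    next
      case 5
      then show ?case using sp by blast
    next
      case 6
      then show ?case using sp by blast
    qed
  qed
qed

end
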